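(* Let $(F,d_F)$, $\pi$, $X^F$ and its transition density $(q_t(x,y))_{x,y\in F,t>0}$ satisfy the standing assumptions in the context. Let $(G^N)_{N\geq1}$ be a sequence of finite connected weighted graphs with at least two vertices, equipped with metrics $d_{G^N}$ on $V(G^N)$, for which there exists a sequence $(\gamma(N))_{N\geq1}$ such that, for any compact interval $I\subset(0,\infty)$, \[\left((V(G^N),d_{G^N}),\pi^N,(q^N_{\gamma(N)t}(x,y))_{x,y\in V(G^N),t\in I}\right)\rightarrow\left((F,d_F),\pi,(q_t(x,y))_{x,y\in F,t\in I}\right)\] in the spectral Gromov–Hausdorff sense. If $p\in[1,\infty]$ is such that $\lim_{t\to\infty}\|q_t(x,\cdot)-1\|_{L^p(\pi)}=0$ for every $x\in F$, then $t^p_{\rm mix}(F)\in(0,\infty)$ and \[\gamma(N)^{-1}t^p_{\rm mix}(G^N)\rightarrow t^p_{\rm mix}(F).\]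
   Context: **Limit space (standing assumptions).** $(F,d_F)$ is a compact metric space; $\pi$ is a non-atomic Borel probability measure on $F$ with full support such that $\pi(\partial B_F(x,r))=0$ for all $x\in F$, $r>0$, where $B_F(x,r)=\{y:d_F(x,y)<r\}$. $X^F$ is a $\pi$-symmetric Hunt process on $F$ with semigroup $(P_t)$ such that: (i) it is conservative: $P_t1=1$ $\pi$-a.e. for all $t>0$; (ii) it has a jointly continuous transition density $(q_t(x,y))_{x,y\in F,t>0}$ with respect to $\pi$, i.e. $\mathbf{E}_x[f(X^F_t)]=\int_Fq_t(x,y)f(y)\pi(dy)$ for bounded continuous $f$; (iii) $q_t(x,y)>0$ for all $x,y\in F$, $t>0$; (iv) for every $x\in F$, $t>0$, $q_t(x,\cdot)$ is not identically $1$. Set $D_p(x,t):=\|q_t(x,\cdot)-1\|_{L^p(\pi)}$ and $t^p_{\rm mix}(F):=\inf\{t>0:\sup_{x\in F}D_p(x,t)\leq1/4\}$. **Graphs.** $G=(V(G),E(G))$ is a finite connected graph with a symmetric weight function $\mu^G:V(G)^2\to[0,\infty)$, with $\mu^G_{xy}>0$ iff $\{x,y\}\in E(G)$. $X^G$ is the discrete-time Markov chain with transition probabilities $\mu^G_{xy}/\mu^G_x$, where $\mu^G_x=\sum_y\mu^G_{xy}$. $\pi^G(A)=\sum_{x\in A}\mu^G_x/\sum_{x\in V(G)}\mu^G_x$, $p^G_m(x,y)=\mathbf{P}^G_x(X^G_m=y)/\pi^G(\{y\})$, $q^G_m(x,y)=\frac12(p^G_m(x,y)+p^G_{m+1}(x,y))$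 for integers $m\geq0$, extended to real times by linear interpolation in $m$. $t^p_{\rm mix}(G):=\inf\{m>0:\sup_{x\in V(G)}\|q^G_m(x,\cdot)-1\|_{L^p(\pi^G)}\leq1/4\}$ ($m$ ranging over positive integers). For $G=G^N$ write $\pi^N,q^N$. **Spectral Gromov–Hausdorff convergence.** For a compact interval $I\subset(0,\infty)$, consider triples $(F,\pi,q)$ with $F=(F,d_F)$ a non-empty compact metric space, $\pi$ a Borel probability measure on $F$, and $q=(q_t(x,y))_{x,y\in F,t\in I}$ a jointly continuous real-valued function. Define \[\Delta_I((F,\pi,q),(F',\pi',q')):=\inf_{Z,\phi,\phi',\mathcal{C}}\Big\{d_H^Z(\phi(F),\phi'(F'))+d_P^Z(\pi\circ\phi^{-1},\pi'\circ\phi'^{-1})+\sup_{(x,x'),(y,y')\in\mathcal{C}}\big(d_Z(\phi(x),\phi'(x'))+d_Z(\phi(y),\phi'(y'))+\sup_{t\in I}|q_t(x,y)-q'_t(x',y')|\big)\Big\},\] the infimum being over all metric spaces $(Z,d_Z)$, isometric embeddings $\phi:F\to Z$, $\phi':F'\to Z$, and correspondences $\mathcal{C}\subseteq F\times F'$ (subsets projecting onto both $F$ and $F'$); $d_H^Z$ is Hausdorff distance and $d_P^Z$ Prohorov distance. Convergence in the spectral Gromov–Hausdorff sense is convergence with respect to $\Delta_I$. *)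

theory Defs
  imports "HOL-Probability.Probability"
begin

section \<open>Hunt processes\<close>

definition borel_of_top :: "'a topology \<Rightarrow> 'a measure" where
  "borel_of_top T = sigma (topspace T) {U. openin T U}"

text \<open>
  The state space is the whole type \<open>'f\<close>. The cemetery is \<open>None\<close>, adjoined as the point at
  infinity; it is an isolated point if the state space is compact.
\<close>

abbreviation cemetery_top :: "'f::metric_space option topology" where
  "cemetery_top \<equiv> Alexandroff_compactification euclidean"

text \<open>
  Hunt process in the sense of Fukushima, Oshima and Takeda: a normal right-continuous
  Markov process on the state space with cemetery, with left limits, which is strong Markov
  and quasi-left-continuous with respect to a right-continuous admissible filtration
  \<open>Fil\<close>. Time runs through \<open>[0, \<infinity>]\<close>, that is through \<open>ennreal\<close>.

  The axioms are stated for the laws \<open>P x\<close> only. Applied to the smallest right-continuous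
  filtration to which \<open>X\<close> is adapted, which consists of events whose probability is
  measurable in the starting point, they carry over to every initial distribution by integration.

  The Markov property is \<open>strong_markov\<close> for a constant time. That the cemetery is
  never left is part of \<open>absorbing\<close>, and no separate case \<open>\<sigma> \<omega> = \<infinity>\<close> is needed in
  \<open>strong_markov\<close>, as both sides then refer to \<open>None\<close>.
\<close>

locale hunt_process = filtration "space M" Fil
  for M :: "'w measure"
    and Fil :: "ennreal \<Rightarrow> 'w measure"
    and X :: "ennreal \<Rightarrow> 'w \<Rightarrow> 'f::metric_space option"
    and \<theta> :: "ennreal \<Rightarrow> 'w \<Rightarrow> 'w"
    and P :: "'f option \<Rightarrow> 'w measure" +
  assumes prob_law: "\<And>x. prob_space (P x)"
    and sets_law: "\<And>x. sets (P x) = sets M"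
    and sets_Fil: "\<And>t. sets (Fil t) \<subseteq> sets M"
    and Fil_right_continuous: "\<And>t. t < \<infinity> \<Longrightarrow> sets (Fil t) = (\<Inter>s\<in>{t<..}. sets (Fil s))"
    and adapted: "\<And>t. X t \<in> measurable (Fil t) (borel_of_top cemetery_top)"
    and kernel_measurable: "\<And>t A. A \<in> sets (borel_of_top cemetery_top) \<Longrightarrow>
          (\<lambda>x. emeasure (P x) {\<omega> \<in> space M. X t \<omega> \<in> A})
            \<in> borel_measurable (borel_of_top cemetery_top)"
    and normal: "\<And>x. emeasure (P x) {\<omega> \<in> space M. X 0 \<omega> = x} = 1"
    and infinity_cemetery: "\<And>\<omega>. \<omega> \<in> space M \<Longrightarrow> X \<infinity> \<omega> = None"
    and absorbing: "\<And>\<omega> s t. \<omega> \<in> space M \<Longrightarrow> X s \<omega> = None \<Longrightarrow> s \<le> t \<Longrightarrow> X t \<omega> = None"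
    and shift_space: "\<And>\<omega> t. \<omega> \<in> space M \<Longrightarrow> \<theta> t \<omega> \<in> space M"
    and shift: "\<And>\<omega> s t. \<omega> \<in> space M \<Longrightarrow> X s (\<theta> t \<omega>) = X (t + s) \<omega>"
    and right_continuous: "\<And>\<omega> t. \<omega> \<in> space M \<Longrightarrow> t < \<infinity> \<Longrightarrow>
          limitin cemetery_top (\<lambda>s. X s \<omega>) (X t \<omega>) (at_right t)"
    and left_limits: "\<And>\<omega> t. \<omega> \<in> space M \<Longrightarrow> 0 < t \<Longrightarrow> t < \<infinity> \<Longrightarrow>
          \<exists>l. limitin cemetery_top (\<lambda>s. X s \<omega>) l (at_left t)"
    and strong_markov: "\<And>\<sigma> s x A L. stopping_time Fil \<sigma> \<Longrightarrow>
          A \<in> sets (borel_of_top cemetery_top) \<Longrightarrow> L \<in> sets (pre_sigma \<sigma>) \<Longrightarrow>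
          emeasure (P x) {\<omega> \<in> L. X (\<sigma> \<omega> + s) \<omega> \<in> A} =
          (\<integral>\<^sup>+\<omega>\<in>L. emeasure (P (X (\<sigma> \<omega>) \<omega>)) {\<omega>' \<in> space M. X s \<omega>' \<in> A} \<partial>P x)"
    and quasi_left_continuous: "\<And>\<sigma> x. (\<And>n. stopping_time Fil (\<sigma> n)) \<Longrightarrow>
          (\<And>\<omega>. \<omega> \<in> space M \<Longrightarrow> incseq (\<lambda>n. \<sigma> n \<omega>)) \<Longrightarrow>
          AE \<omega> in P x. (SUP n. \<sigma> n \<omega>) < \<infinity> \<longrightarrow>
            limitin cemetery_top (\<lambda>n. X (\<sigma> n \<omega>) \<omega>) (X (SUP n. \<sigma> n \<omega>) \<omega>) sequentially"

text \<open>Functions on the state space vanish at the cemetery.\<close>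

definition at_state :: "('f \<Rightarrow> 'b) \<Rightarrow> 'f option \<Rightarrow> 'b::zero" where
  "at_state f y = (case y of None \<Rightarrow> 0 | Some z \<Rightarrow> f z)"

definition hunt_semigroup ::
  "(ennreal \<Rightarrow> 'w \<Rightarrow> 'f option) \<Rightarrow> ('f option \<Rightarrow> 'w measure) \<Rightarrow> real
    \<Rightarrow> ('f \<Rightarrow> ennreal) \<Rightarrow> 'f \<Rightarrow> ennreal" where
  "hunt_semigroup X P t f x = (\<integral>\<^sup>+\<omega>. at_state f (X (ennreal t) \<omega>) \<partial>P (Some x))"

definition symmetric_process ::
  "'f::topological_space measure \<Rightarrow> (ennreal \<Rightarrow> 'w \<Rightarrow> 'f option) \<Rightarrow> ('f option \<Rightarrow> 'w measure)
    \<Rightarrow> bool" where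
  "symmetric_process \<pi> X P \<longleftrightarrow>
     (\<forall>t>0. \<forall>f\<in>borel_measurable borel. \<forall>g\<in>borel_measurable borel.
        (\<integral>\<^sup>+x. hunt_semigroup X P t f x * g x \<partial>\<pi>) = (\<integral>\<^sup>+x. f x * hunt_semigroup X P t g x \<partial>\<pi>))"

definition conservative_process ::
  "'f measure \<Rightarrow> (ennreal \<Rightarrow> 'w \<Rightarrow> 'f option) \<Rightarrow> ('f option \<Rightarrow> 'w measure) \<Rightarrow> bool" where
  "conservative_process \<pi> X P \<longleftrightarrow>
     (\<forall>t>0. AE x in \<pi>. hunt_semigroup X P t (\<lambda>_. 1) x = 1)"

definition jointly_continuous :: "(real \<Rightarrow> 'f::topological_space \<Rightarrow> 'f \<Rightarrow> real) \<Rightarrow> bool" where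
  "jointly_continuous q \<longleftrightarrow>
     continuous_on ({0<..} \<times> UNIV \<times> UNIV) (\<lambda>(t, x, y). q t x y)"

definition transition_density ::
  "'f::topological_space measure \<Rightarrow> (ennreal \<Rightarrow> 'w \<Rightarrow> 'f option) \<Rightarrow> ('f option \<Rightarrow> 'w measure)
    \<Rightarrow> (real \<Rightarrow> 'f \<Rightarrow> 'f \<Rightarrow> real) \<Rightarrow> bool" where
  "transition_density \<pi> X P q \<longleftrightarrow>
     (\<forall>t>0. \<forall>x. \<forall>f :: 'f \<Rightarrow> real. continuous_on UNIV f \<longrightarrow> bounded (range f) \<longrightarrow>
        (\<integral>\<omega>. at_state f (X (ennreal t) \<omega>) \<partial>P (Some x)) = (\<integral>y. q t x y * f y \<partial>\<pi>))"

definition non_atomic :: "'a measure \<Rightarrow> bool" where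
  "non_atomic M \<longleftrightarrow> (\<forall>A\<in>sets M. 0 < emeasure M A \<longrightarrow>
     (\<exists>B\<in>sets M. B \<subseteq> A \<and> 0 < emeasure M B \<and> emeasure M B < emeasure M A))"


section \<open>Norms and mixing times\<close>

definition Lp_norm :: "ennreal \<Rightarrow> 'a measure \<Rightarrow> ('a \<Rightarrow> real) \<Rightarrow> ennreal" where
  "Lp_norm p M f =
     (if p = \<infinity> then esssup M (\<lambda>x. ennreal \<bar>f x\<bar>)
      else let I = (\<integral>\<^sup>+x. ennreal (\<bar>f x\<bar> powr enn2real p) \<partial>M)
           in if I = \<infinity> then \<infinity> else ennreal (enn2real I powr (1 / enn2real p)))"

text \<open>Mixing times are extended-valued, with the infimum of the empty set being \<open>\<infinity>\<close>.\<close>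

definition mixing_time_space ::
  "ennreal \<Rightarrow> 'f measure \<Rightarrow> (real \<Rightarrow> 'f \<Rightarrow> 'f \<Rightarrow> real) \<Rightarrow> ennreal" where
  "mixing_time_space p \<pi> q =
     Inf {ennreal t | t. 0 < t \<and> (SUP x. Lp_norm p \<pi> (\<lambda>y. q t x y - 1)) \<le> 1 / 4}"


section \<open>Finite weighted graphs\<close>

text \<open>Edges are unordered pairs \<open>{x, y}\<close> of vertices; loops are not excluded.\<close>

definition weighted_graph :: "'v set \<Rightarrow> 'v set set \<Rightarrow> ('v \<Rightarrow> 'v \<Rightarrow> real) \<Rightarrow> bool" where
  "weighted_graph V E \<mu> \<longleftrightarrow>
     finite V \<and> E \<subseteq> {{x, y} | x y. x \<in> V \<and> y \<in> V} \<and>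
     (\<forall>x\<in>V. \<forall>y\<in>V. 0 \<le> \<mu> x y \<and> \<mu> x y = \<mu> y x \<and> (0 < \<mu> x y \<longleftrightarrow> {x, y} \<in> E))"

definition connected_graph :: "'v set \<Rightarrow> 'v set set \<Rightarrow> bool" where
  "connected_graph V E \<longleftrightarrow>
     (\<forall>x\<in>V. \<forall>y\<in>V. (x, y) \<in> {(u, v). u \<in> V \<and> v \<in> V \<and> {u, v} \<in> E}\<^sup>*)"

definition vertex_weight :: "'v set \<Rightarrow> ('v \<Rightarrow> 'v \<Rightarrow> real) \<Rightarrow> 'v \<Rightarrow> real" where
  "vertex_weight V \<mu> x = (\<Sum>y\<in>V. \<mu> x y)"

definition graph_measure :: "'v set \<Rightarrow> ('v \<Rightarrow> 'v \<Rightarrow> real) \<Rightarrow> 'v measure" where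
  "graph_measure V \<mu> =
     point_measure V (\<lambda>x. ennreal (vertex_weight V \<mu> x / (\<Sum>z\<in>V. vertex_weight V \<mu> z)))"

text \<open>\<open>walk_prob V \<mu> m x y\<close> is the probability that the walk started at \<open>x\<close> is at \<open>y\<close> at time \<open>m\<close>.\<close>

primrec walk_prob :: "'v set \<Rightarrow> ('v \<Rightarrow> 'v \<Rightarrow> real) \<Rightarrow> nat \<Rightarrow> 'v \<Rightarrow> 'v \<Rightarrow> real" where
  "walk_prob V \<mu> 0 x y = (if x = y then 1 else 0)"
| "walk_prob V \<mu> (Suc m) x y =
     (\<Sum>z\<in>V. \<mu> x z / vertex_weight V \<mu> x * walk_prob V \<mu> m z y)"

definition walk_density :: "'v set \<Rightarrow> ('v \<Rightarrow> 'v \<Rightarrow> real) \<Rightarrow> nat \<Rightarrow> 'v \<Rightarrow> 'v \<Rightarrow> real" where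
  "walk_density V \<mu> m x y = walk_prob V \<mu> m x y / measure (graph_measure V \<mu>) {y}"

definition smoothed_density :: "'v set \<Rightarrow> ('v \<Rightarrow> 'v \<Rightarrow> real) \<Rightarrow> nat \<Rightarrow> 'v \<Rightarrow> 'v \<Rightarrow> real" where
  "smoothed_density V \<mu> m x y =
     (walk_density V \<mu> m x y + walk_density V \<mu> (m + 1) x y) / 2"

text \<open>Linear interpolation between integer times; only times \<open>s \<ge> 0\<close> are meaningful.\<close>

definition graph_density :: "'v set \<Rightarrow> ('v \<Rightarrow> 'v \<Rightarrow> real) \<Rightarrow> real \<Rightarrow> 'v \<Rightarrow> 'v \<Rightarrow> real" where
  "graph_density V \<mu> s x y =
     (1 - frac s) * smoothed_density V \<mu> (nat \<lfloor>s\<rfloor>) x y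
       + frac s * smoothed_density V \<mu> (nat \<lfloor>s\<rfloor> + 1) x y"

definition mixing_time_graph :: "ennreal \<Rightarrow> 'v set \<Rightarrow> ('v \<Rightarrow> 'v \<Rightarrow> real) \<Rightarrow> ennreal" where
  "mixing_time_graph p V \<mu> =
     Inf {of_nat m | m. 0 < m \<and>
       (SUP x\<in>V. Lp_norm p (graph_measure V \<mu>) (\<lambda>y. smoothed_density V \<mu> m x y - 1)) \<le> 1 / 4}"


section \<open>Spectral Gromov--Hausdorff distance\<close>

definition metric_borel :: "'a set \<Rightarrow> ('a \<Rightarrow> 'a \<Rightarrow> real) \<Rightarrow> 'a measure" where
  "metric_borel Z d = borel_of_top (Metric_space.mtopology Z d)"

definition hausdorff_dist :: "('z \<Rightarrow> 'z \<Rightarrow> real) \<Rightarrow> 'z set \<Rightarrow> 'z set \<Rightarrow> ennreal" where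
  "hausdorff_dist d A B =
     max (SUP a\<in>A. INF b\<in>B. ennreal (d a b)) (SUP b\<in>B. INF a\<in>A. ennreal (d a b))"

definition enlargement :: "'z set \<Rightarrow> ('z \<Rightarrow> 'z \<Rightarrow> real) \<Rightarrow> 'z set \<Rightarrow> real \<Rightarrow> 'z set" where
  "enlargement Z d A \<epsilon> = {z \<in> Z. \<exists>a\<in>A. d a z < \<epsilon>}"

definition prohorov_dist ::
  "'z set \<Rightarrow> ('z \<Rightarrow> 'z \<Rightarrow> real) \<Rightarrow> 'z measure \<Rightarrow> 'z measure \<Rightarrow> ennreal" where
  "prohorov_dist Z d \<mu> \<nu> =
     Inf {ennreal \<epsilon> | \<epsilon>. 0 < \<epsilon> \<and> (\<forall>A\<in>sets (metric_borel Z d).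
       emeasure \<mu> A \<le> emeasure \<nu> (enlargement Z d A \<epsilon>) + ennreal \<epsilon> \<and>
       emeasure \<nu> A \<le> emeasure \<mu> (enlargement Z d A \<epsilon>) + ennreal \<epsilon>)}"

definition isometric_embedding ::
  "'a set \<Rightarrow> ('a \<Rightarrow> 'a \<Rightarrow> real) \<Rightarrow> 'z set \<Rightarrow> ('z \<Rightarrow> 'z \<Rightarrow> real) \<Rightarrow> ('a \<Rightarrow> 'z) \<Rightarrow> bool" where
  "isometric_embedding F d Z dZ \<phi> \<longleftrightarrow>
     \<phi> ` F \<subseteq> Z \<and> (\<forall>x\<in>F. \<forall>y\<in>F. dZ (\<phi> x) (\<phi> y) = d x y)"

definition correspondence :: "'a set \<Rightarrow> 'b set \<Rightarrow> ('a \<times> 'b) set \<Rightarrow> bool" where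
  "correspondence F F' C \<longleftrightarrow> C \<subseteq> F \<times> F' \<and> fst ` C = F \<and> snd ` C = F'"

definition spectral_GH_cost ::
  "real set \<Rightarrow> 'a set \<Rightarrow> 'a measure \<Rightarrow> (real \<Rightarrow> 'a \<Rightarrow> 'a \<Rightarrow> real)
    \<Rightarrow> 'b set \<Rightarrow> 'b measure \<Rightarrow> (real \<Rightarrow> 'b \<Rightarrow> 'b \<Rightarrow> real)
    \<Rightarrow> 'z set \<Rightarrow> ('z \<Rightarrow> 'z \<Rightarrow> real) \<Rightarrow> ('a \<Rightarrow> 'z) \<Rightarrow> ('b \<Rightarrow> 'z) \<Rightarrow> ('a \<times> 'b) set \<Rightarrow> ennreal" where
  "spectral_GH_cost I F \<pi> q F' \<pi>' q' Z dZ \<phi> \<phi>' C =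
     hausdorff_dist dZ (\<phi> ` F) (\<phi>' ` F')
     + prohorov_dist Z dZ (distr \<pi> (metric_borel Z dZ) \<phi>) (distr \<pi>' (metric_borel Z dZ) \<phi>')
     + (SUP ((x, x'), (y, y')) \<in> C \<times> C.
          ennreal (dZ (\<phi> x) (\<phi>' x')) + ennreal (dZ (\<phi> y) (\<phi>' y'))
          + (SUP t\<in>I. ennreal \<bar>q t x y - q' t x' y'\<bar>))"

text \<open>
  The infimum over all metric spaces \<open>Z\<close> cannot range over all types. Since the cost depends only
  on the metric restricted to \<open>\<phi> ` F \<union> \<phi>' ` F'\<close> (for compact \<open>F\<close> and \<open>F'\<close>), it suffices to let \<open>Z\<close> range over the metric
  spaces whose points form a subset of \<open>'a + 'b\<close>: see \<open>spectral_GH_dist_le\<close> below.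
\<close>

definition spectral_GH_dist ::
  "real set \<Rightarrow> 'a set \<Rightarrow> ('a \<Rightarrow> 'a \<Rightarrow> real) \<Rightarrow> 'a measure \<Rightarrow> (real \<Rightarrow> 'a \<Rightarrow> 'a \<Rightarrow> real)
    \<Rightarrow> 'b set \<Rightarrow> ('b \<Rightarrow> 'b \<Rightarrow> real) \<Rightarrow> 'b measure \<Rightarrow> (real \<Rightarrow> 'b \<Rightarrow> 'b \<Rightarrow> real) \<Rightarrow> ennreal" where
  "spectral_GH_dist I F d \<pi> q F' d' \<pi>' q' =
     Inf {spectral_GH_cost I F \<pi> q F' \<pi>' q' Z dZ \<phi> \<phi>' C |
          (Z :: ('a + 'b) set) dZ \<phi> \<phi>' C.
          Metric_space Z dZ \<and> isometric_embedding F d Z dZ \<phi> \<and>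
          isometric_embedding F' d' Z dZ \<phi>' \<and> correspondence F F' C}"

lemma space_metric_borel:
  "Metric_space Z d \<Longrightarrow> space (metric_borel Z d) = Z"
  by (simp add: metric_borel_def borel_of_top_def space_measure_of_conv Metric_space.topspace_mtopology)

lemma sets_metric_borel:
  assumes "Metric_space Z d"
  shows "sets (metric_borel Z d) = sigma_sets Z {U. openin (Metric_space.mtopology Z d) U}"
proof -
  have "{U. openin (Metric_space.mtopology Z d) U} \<subseteq> Pow Z"
    using assms by (metis (no_types, lifting) Metric_space.topspace_mtopology PowI mem_Collect_eq
        openin_subset subsetI)
  then show ?thesis
    using assms by (simp add: metric_borel_def borel_of_top_def Metric_space.topspace_mtopology)
qed

lemma openin_imp_metric_borel:
  assumes "Metric_space Z d" "openin (Metric_space.mtopology Z d) U"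
  shows "U \<in> sets (metric_borel Z d)"
  using assms by (auto simp: sets_metric_borel)

lemma openin_enlargement:
  assumes Z: "Metric_space Z d" and "A \<subseteq> Z"
  shows "openin (Metric_space.mtopology Z d) (enlargement Z d A \<epsilon>)"
proof -
  have "enlargement Z d A \<epsilon> = (\<Union>a\<in>A. Metric_space.mball Z d a \<epsilon>)"
    using assms by (auto simp: enlargement_def Metric_space.mball_def)
  then show ?thesis
    using Metric_space.openin_mball[OF Z] by auto
qed

lemma isometric_embedding_continuous:
  assumes F: "Metric_space F d" and Z: "Metric_space Z dZ" and "isometric_embedding F d Z dZ \<phi>"
  shows "continuous_map (Metric_space.mtopology F d) (Metric_space.mtopology Z dZ) \<phi>"
proof -
  have "Metric_space12 F d Z dZ"
    using F Z by (simp add: Metric_space12_def)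
  from Metric_space12.isometry_imp_embedding_map[OF this, of \<phi>] assms(3)
  have "embedding_map (Metric_space.mtopology F d) (Metric_space.mtopology Z dZ) \<phi>"
    by (auto simp: isometric_embedding_def)
  then show ?thesis
    by (metis embedding_map_def homeomorphic_imp_continuous_map continuous_map_in_subtopology)
qed

lemma continuous_map_metric_borel:
  assumes F: "Metric_space F d" and Z: "Metric_space Z dZ"
    and cont: "continuous_map (Metric_space.mtopology F d) (Metric_space.mtopology Z dZ) f"
  shows "f \<in> measurable (metric_borel F d) (metric_borel Z dZ)"
proof (rule measurable_sigma_sets[OF sets_metric_borel[OF Z]])
  show "{U. openin (Metric_space.mtopology Z dZ) U} \<subseteq> Pow Z"
    by (metis (no_types, lifting) Z Metric_space.topspace_mtopology PowI mem_Collect_eq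
        openin_subset subsetI)
  show "f \<in> space (metric_borel F d) \<rightarrow> Z"
    using continuous_map_image_subset_topspace[OF cont]
    by (auto simp: space_metric_borel[OF F] Metric_space.topspace_mtopology[OF F]
        Metric_space.topspace_mtopology[OF Z])
  fix U assume "U \<in> {U. openin (Metric_space.mtopology Z dZ) U}"
  then have "openin (Metric_space.mtopology F d)
      {x \<in> topspace (Metric_space.mtopology F d). f x \<in> U}"
    using cont openin_continuous_map_preimage by blast
  moreover have "f -` U \<inter> space (metric_borel F d) =
      {x \<in> topspace (Metric_space.mtopology F d). f x \<in> U}"
    by (auto simp: space_metric_borel[OF F] Metric_space.topspace_mtopology[OF F])
  ultimately show "f -` U \<inter> space (metric_borel F d) \<in> sets (metric_borel F d)"
    using openin_imp_metric_borel[OF F] by simp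
qed

lemma emeasure_distr_embedding:
  assumes F: "Metric_space F d" and Z: "Metric_space Z dZ" and \<phi>: "isometric_embedding F d Z dZ \<phi>"
    and \<pi>: "sets \<pi> = sets (metric_borel F d)" and A: "A \<in> sets (metric_borel Z dZ)"
  shows "emeasure (distr \<pi> (metric_borel Z dZ) \<phi>) A = emeasure \<pi> {x \<in> F. \<phi> x \<in> A}"
proof -
  have "\<phi> \<in> measurable \<pi> (metric_borel Z dZ)"
    using continuous_map_metric_borel[OF F Z isometric_embedding_continuous[OF F Z \<phi>]]
      measurable_cong_sets[OF \<pi> refl] by blast
  moreover have "space \<pi> = F"
    using sets_eq_imp_space_eq[OF \<pi>] space_metric_borel[OF F] by simp
  ultimately show ?thesis
    using A by (auto simp: emeasure_distr intro!: arg_cong[where f="emeasure \<pi>"])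
qed

text \<open>Every metric space \<open>Z\<close>, over any type, gives an upper bound for the distance.\<close>

lemma spectral_GH_dist_le:
  fixes Z :: "'z set" and F :: "'a set" and F' :: "'b set"
  assumes F: "Metric_space F d" "compact_space (Metric_space.mtopology F d)"
    and F': "Metric_space F' d'" "compact_space (Metric_space.mtopology F' d')"
    and \<pi>: "sets \<pi> = sets (metric_borel F d)" and \<pi>': "sets \<pi>' = sets (metric_borel F' d')"
    and Z: "Metric_space Z dZ"
    and \<phi>: "isometric_embedding F d Z dZ \<phi>" and \<phi>': "isometric_embedding F' d' Z dZ \<phi>'"
    and C: "correspondence F F' C"
  shows "spectral_GH_dist I F d \<pi> q F' d' \<pi>' q'
           \<le> spectral_GH_cost I F \<pi> q F' \<pi>' q' Z dZ \<phi> \<phi>' C"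
proof -
  interpret Z: Metric_space Z dZ by fact
  define S where "S = \<phi> ` F \<union> \<phi>' ` F'"
  have SZ: "S \<subseteq> Z" using \<phi> \<phi>' by (auto simp: S_def isometric_embedding_def)
  define j where "j z = (if z \<in> \<phi> ` F then Inl (inv_into F \<phi> z) else Inr (inv_into F' \<phi>' z))" for z
  have inj: "inj_on j S"
    by (rule inj_onI) (auto simp: j_def S_def split: if_splits dest: inv_into_injective)
  define W where "W = j ` S"
  define k where "k = inv_into S j"
  define dW where "dW u v = dZ (k u) (k v)" for u v
  have kj: "k (j z) = z" if "z \<in> S" for z using inj that by (simp add: k_def)
  have kS: "k u \<in> S" "j (k u) = u" if "u \<in> W" for u
    using that kj by (auto simp: W_def)
  have W: "Metric_space W dW"
  proof
    show "0 \<le> dW x y" "dW x y = dW y x" for x y by (auto simp: dW_def Z.commute)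
    show "dW x y = 0 \<longleftrightarrow> x = y" if "x \<in> W" "y \<in> W" for x y
      using that kS SZ Z.zero[of "k x" "k y"] unfolding dW_def by (metis subsetD)
    show "dW x z \<le> dW x y + dW y z" if "x \<in> W" "y \<in> W" "z \<in> W" for x y z
      using that kS SZ Z.triangle[of "k x" "k y" "k z"] unfolding dW_def by (metis subsetD)
  qed
  interpret W: Metric_space W dW by fact
  define \<psi> where "\<psi> = (\<lambda>x. j (\<phi> x))"
  define \<psi>' where "\<psi>' = (\<lambda>x. j (\<phi>' x))"
  have S1: "\<phi> x \<in> S" if "x \<in> F" for x using that by (auto simp: S_def)
  have S2: "\<phi>' x \<in> S" if "x \<in> F'" for x using that by (auto simp: S_def)
  have \<psi>: "isometric_embedding F d W dW \<psi>"
    using \<phi> S1 by (auto simp: isometric_embedding_def \<psi>_def dW_def W_def kj)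
  have \<psi>': "isometric_embedding F' d' W dW \<psi>'"
    using \<phi>' S2 by (auto simp: isometric_embedding_def \<psi>'_def dW_def W_def kj)
  have "compactin Z.mtopology (\<phi> ` F)"
    using image_compactin[OF _ isometric_embedding_continuous[OF F(1) Z \<phi>], of F] F
    by (simp add: compact_space_def Metric_space.topspace_mtopology)
  moreover have "compactin Z.mtopology (\<phi>' ` F')"
    using image_compactin[OF _ isometric_embedding_continuous[OF F'(1) Z \<phi>'], of F'] F'
    by (simp add: compact_space_def Metric_space.topspace_mtopology)
  ultimately have "closedin Z.mtopology S"
    unfolding S_def using compactin_imp_closedin Z.Hausdorff_space_mtopology by blast
  then have "Z - S \<in> sets (metric_borel Z dZ)"
    by (auto intro!: openin_imp_metric_borel[OF Z])
  then have S_sets: "S \<in> sets (metric_borel Z dZ)"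
    using sets.compl_sets[of "Z - S" "metric_borel Z dZ"] SZ
    by (simp add: space_metric_borel[OF Z] double_diff)
  have j_cont: "continuous_map (Metric_space.mtopology S dZ) W.mtopology j"
    by (rule isometric_embedding_continuous[OF Z.subspace[OF SZ] W])
      (auto simp: isometric_embedding_def W_def dW_def kj)
  have preimage: "{z \<in> S. j z \<in> A} \<in> sets (metric_borel Z dZ)"
    if A: "A \<in> sets (metric_borel W dW)" for A
  proof -
    have "j \<in> measurable (restrict_space (metric_borel Z dZ) S) (metric_borel W dW)"
    proof (rule measurable_sigma_sets[OF sets_metric_borel[OF W]])
      show "{U. openin W.mtopology U} \<subseteq> Pow W"
        using openin_subset W.topspace_mtopology by fastforce
      show "j \<in> space (restrict_space (metric_borel Z dZ) S) \<rightarrow> W"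
        by (auto simp: space_restrict_space W_def)
      fix U assume "U \<in> {U. openin W.mtopology U}"
      moreover have "{z \<in> Z. z \<in> S \<and> j z \<in> U} = {z \<in> S. j z \<in> U}"
        using SZ by auto
      ultimately have "openin (subtopology Z.mtopology S) {z \<in> S. j z \<in> U}"
        using openin_continuous_map_preimage[OF j_cont, of U]
          Submetric.mtopology_submetric[of Z dZ S] Z SZ
          Metric_space.topspace_mtopology[OF Z.subspace[OF SZ]]
        by (simp add: Submetric_def Submetric_axioms_def)
      then obtain T where T: "openin Z.mtopology T" "{z \<in> S. j z \<in> U} = T \<inter> S"
        by (auto simp: openin_subtopology)
      have "j -` U \<inter> space (restrict_space (metric_borel Z dZ) S) = S \<inter> T"
        using T SZ by (auto simp: space_restrict_space space_metric_borel[OF Z])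
      then show "j -` U \<inter> space (restrict_space (metric_borel Z dZ) S)
          \<in> sets (restrict_space (metric_borel Z dZ) S)"
        using openin_imp_metric_borel[OF Z T(1)] by (auto simp: sets_restrict_space)
    qed
    from measurable_sets[OF this A]
    have "j -` A \<inter> S \<in> sets (restrict_space (metric_borel Z dZ) S)"
      using SZ by (simp add: space_restrict_space space_metric_borel[OF Z] Int_absorb2)
    then have "j -` A \<inter> S \<in> sets (metric_borel Z dZ)"
      using S_sets by (auto simp: sets_restrict_space)
    also have "j -` A \<inter> S = {z \<in> S. j z \<in> A}" by auto
    finally show ?thesis .
  qed
  let ?\<mu> = "distr \<pi> (metric_borel Z dZ) \<phi>" and ?\<nu> = "distr \<pi>' (metric_borel Z dZ) \<phi>'"
  let ?\<mu>' = "distr \<pi> (metric_borel W dW) \<psi>" and ?\<nu>' = "distr \<pi>' (metric_borel W dW) \<psi>'"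
  have prohorov: "prohorov_dist W dW ?\<mu>' ?\<nu>' \<le> prohorov_dist Z dZ ?\<mu> ?\<nu>"
    unfolding prohorov_dist_def
  proof (rule Inf_superset_mono, safe)
    fix \<epsilon> :: real
    assume \<epsilon>: "0 < \<epsilon>" and *: "\<forall>A\<in>sets (metric_borel Z dZ).
       emeasure ?\<mu> A \<le> emeasure ?\<nu> (enlargement Z dZ A \<epsilon>) + ennreal \<epsilon> \<and>
       emeasure ?\<nu> A \<le> emeasure ?\<mu> (enlargement Z dZ A \<epsilon>) + ennreal \<epsilon>"
    have "emeasure ?\<mu>' A \<le> emeasure ?\<nu>' (enlargement W dW A \<epsilon>) + ennreal \<epsilon> \<and>
       emeasure ?\<nu>' A \<le> emeasure ?\<mu>' (enlargement W dW A \<epsilon>) + ennreal \<epsilon>"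
      if A: "A \<in> sets (metric_borel W dW)" for A
    proof -
      define B where "B = {z \<in> S. j z \<in> A}"
      have B: "B \<in> sets (metric_borel Z dZ)" unfolding B_def by (rule preimage[OF A])
      have AW: "A \<subseteq> W" using sets.sets_into_space[OF A] by (simp add: space_metric_borel[OF W])
      have BZ: "B \<subseteq> Z" using SZ by (auto simp: B_def)
      have enl: "j z \<in> enlargement W dW A \<epsilon> \<longleftrightarrow> z \<in> enlargement Z dZ B \<epsilon>" if z: "z \<in> S" for z
      proof
        assume "j z \<in> enlargement W dW A \<epsilon>"
        then obtain a where "a \<in> A" "dW a (j z) < \<epsilon>" by (auto simp: enlargement_def)
        moreover from this have "k a \<in> B" using AW kS[of a] by (auto simp: B_def)
        ultimately show "z \<in> enlargement Z dZ B \<epsilon>"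
          using z SZ by (auto simp: enlargement_def dW_def kj)
      next
        assume "z \<in> enlargement Z dZ B \<epsilon>"
        then obtain b where "b \<in> B" "dZ b z < \<epsilon>" by (auto simp: enlargement_def)
        then show "j z \<in> enlargement W dW A \<epsilon>"
          using z by (auto simp: enlargement_def B_def dW_def kj W_def intro!: bexI[of _ "j b"])
      qed
      note eZ = openin_imp_metric_borel[OF Z openin_enlargement[OF Z BZ, of \<epsilon>]]
      note eW = openin_imp_metric_borel[OF W openin_enlargement[OF W AW, of \<epsilon>]]
      have 1: "emeasure ?\<mu>' A = emeasure ?\<mu> B"
        unfolding emeasure_distr_embedding[OF F(1) W \<psi> \<pi> A] emeasure_distr_embedding[OF F(1) Z \<phi> \<pi> B]
        using S1 by (auto simp: \<psi>_def B_def intro!: arg_cong[where f="emeasure \<pi>"])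
      have 2: "emeasure ?\<nu>' A = emeasure ?\<nu> B"
        unfolding emeasure_distr_embedding[OF F'(1) W \<psi>' \<pi>' A] emeasure_distr_embedding[OF F'(1) Z \<phi>' \<pi>' B]
        using S2 by (auto simp: \<psi>'_def B_def intro!: arg_cong[where f="emeasure \<pi>'"])
      have 3: "emeasure ?\<mu>' (enlargement W dW A \<epsilon>) = emeasure ?\<mu> (enlargement Z dZ B \<epsilon>)"
        unfolding emeasure_distr_embedding[OF F(1) W \<psi> \<pi> eW] emeasure_distr_embedding[OF F(1) Z \<phi> \<pi> eZ]
        using S1 enl by (auto simp: \<psi>_def intro!: arg_cong[where f="emeasure \<pi>"])
      have 4: "emeasure ?\<nu>' (enlargement W dW A \<epsilon>) = emeasure ?\<nu> (enlargement Z dZ B \<epsilon>)"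
        unfolding emeasure_distr_embedding[OF F'(1) W \<psi>' \<pi>' eW] emeasure_distr_embedding[OF F'(1) Z \<phi>' \<pi>' eZ]
        using S2 enl by (auto simp: \<psi>'_def intro!: arg_cong[where f="emeasure \<pi>'"])
      show ?thesis using * B by (simp only: 1 2 3 4)
    qed
    with \<epsilon> show "\<exists>\<epsilon>'. ennreal \<epsilon> = ennreal \<epsilon>' \<and> 0 < \<epsilon>' \<and> (\<forall>A\<in>sets (metric_borel W dW).
       emeasure ?\<mu>' A \<le> emeasure ?\<nu>' (enlargement W dW A \<epsilon>') + ennreal \<epsilon>' \<and>
       emeasure ?\<nu>' A \<le> emeasure ?\<mu>' (enlargement W dW A \<epsilon>') + ennreal \<epsilon>')"
      by blast
  qed
  have cross: "dW (\<psi> x) (\<psi>' y) = dZ (\<phi> x) (\<phi>' y)" if "x \<in> F" "y \<in> F'" for x y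
    using that S1 S2 by (simp add: dW_def \<psi>_def \<psi>'_def kj)
  have hausdorff: "hausdorff_dist dW (\<psi> ` F) (\<psi>' ` F') = hausdorff_dist dZ (\<phi> ` F) (\<phi>' ` F')"
    unfolding hausdorff_dist_def image_image
    by (intro arg_cong2[where f=max] SUP_cong INF_cong refl) (simp_all add: cross)
  have C': "x \<in> F \<and> y \<in> F'" if "(x, y) \<in> C" for x y
    using C that by (auto simp: correspondence_def)
  have "spectral_GH_dist I F d \<pi> q F' d' \<pi>' q' \<le> spectral_GH_cost I F \<pi> q F' \<pi>' q' W dW \<psi> \<psi>' C"
    unfolding spectral_GH_dist_def using W \<psi> \<psi>' C by (intro Inf_lower) blast
  also have "\<dots> \<le> spectral_GH_cost I F \<pi> q F' \<pi>' q' Z dZ \<phi> \<phi>' C"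
    unfolding spectral_GH_cost_def
  proof (intro add_mono prohorov)
    show "hausdorff_dist dW (\<psi> ` F) (\<psi>' ` F') \<le> hausdorff_dist dZ (\<phi> ` F) (\<phi>' ` F')"
      by (simp add: hausdorff)
    show "(SUP ((x, x'), (y, y')) \<in> C \<times> C.
          ennreal (dW (\<psi> x) (\<psi>' x')) + ennreal (dW (\<psi> y) (\<psi>' y'))
          + (SUP t\<in>I. ennreal \<bar>q t x y - q' t x' y'\<bar>))
      \<le> (SUP ((x, x'), (y, y')) \<in> C \<times> C.
          ennreal (dZ (\<phi> x) (\<phi>' x')) + ennreal (dZ (\<phi> y) (\<phi>' y'))
          + (SUP t\<in>I. ennreal \<bar>q t x y - q' t x' y'\<bar>))"
      by (rule eq_refl, rule SUP_cong) (auto simp: cross dest!: C')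
  qed
  finally show ?thesis .
qed

end

theory Submission
  imports Defs
begin

text \<open>
  Let \<open>D t\<close> be the supremum over the starting point \<open>x\<close> of the \<open>L\<^sup>p\<close> norm of \<open>q t x \<cdot> - 1\<close>, and let
  \<open>D\<^sub>N m\<close> be the same quantity for the smoothed walk on the \<open>N\<close>-th graph. Mixing times are the first
  times at which these functions are at most \<open>1/4\<close>. First passage times converge because of three
  facts: \<open>D\<^sub>N m\<close> converges to \<open>D t\<close> whenever \<open>m / \<gamma> N\<close> converges to \<open>t > 0\<close>, each \<open>D\<^sub>N\<close> is
  non-increasing, and \<open>D\<close> drops strictly below \<open>1/4\<close> immediately after it has reached this level.
  By monotonicity, convergence at each fixed time is enough: a graph whose distance still exceeds
  \<open>1/4\<close> at some step cannot have mixed at an earlier one.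

  Convergence (\<open>eventually_graph_distance_le\<close>, \<open>eventually_graph_distance_greater\<close>). Spectral
  Gromov--Hausdorff closeness gives a correspondence along which the densities almost agree, and
  Prohorov closeness of the measures then compares the tails of \<open>\<bar>q - 1\<bar>\<close> on the two spaces. Tails
  determine \<open>L\<^sup>p\<close> norms, with constants uniform in the starting point (\<open>Lp_norm_le_of_tails\<close>,
  \<open>Lp_norms_close\<close>). Rounding \<open>\<gamma> N * t\<close> to an integer is harmless because \<open>\<gamma>\<close> diverges
  (\<open>gamma_at_top\<close>), which is forced by the absence of atoms in the limit.

  Strict decrease (\<open>distance_contraction\<close>). Compactness and positivity give \<open>q s \<ge> c > 0\<close>. By the
  semigroup property \<open>q (t + s) x \<cdot> - 1\<close> is the average of the functions \<open>q t y \<cdot> - 1\<close> with respect to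
  \<open>q s x y\<close>. These functions have mean zero over \<open>y\<close>, so \<open>c\<close> can be subtracted from the kernel, and
  \<open>D (t + s) \<le> (1 - c) * D t\<close> follows. The semigroup property and stationarity are finite-sum
  identities on the graphs, so the estimate is proved there (\<open>Lp_norm_dens_average_le\<close>) and then
  carried over to the limit. It covers all exponents at once, including \<open>1\<close> and \<open>\<infinity>\<close>, for which the
  norm is not strictly convex. Iterating it shows that the mixing time of the limit is finite.

  Positivity of that mixing time (\<open>distance_greater_short_time\<close>). By right-continuity of
  the paths at time \<open>0\<close>, the law at a small time is concentrated near the starting point,
  where \<open>\<pi>\<close> has little mass.
\<close>

section \<open>Convexity of powers and tails of integrals\<close>

text \<open>
  The end point \<open>0\<close> is included because functions may vanish. There convexity reduces to
  \<open>s powr p \<le> s\<close> for \<open>s\<close> in the unit interval.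
\<close>

lemma convex_on_powr_nonneg:
  fixes p :: real
  assumes "1 \<le> p"
  shows "convex_on {0..} (\<lambda>x. x powr p)"
proof (rule convex_onI)
  have pow_le: "s powr p \<le> s" if "0 \<le> s" "s \<le> 1" for s :: real
    using powr_mono'[OF assms that] that by simp
  fix t x y :: real
  assume t: "0 < t" "t < 1" and xy: "x \<in> {0..}" "y \<in> {0..}"
  consider "x = 0" | "y = 0" | "0 < x" "0 < y" using xy by fastforce
  then show "((1 - t) *\<^sub>R x + t *\<^sub>R y) powr p \<le> (1 - t) * x powr p + t * y powr p"
  proof cases
    case 1
    with t xy pow_le[of t] show ?thesis by (simp add: powr_mult mult_right_mono)
  next
    case 2
    with t xy pow_le[of "1 - t"] show ?thesis by (simp add: powr_mult mult_right_mono)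
  next
    case 3
    with t convex_onD[OF powr_convex[OF assms], of t x y] show ?thesis by simp
  qed
qed simp

lemma powr_superadditive:
  fixes a b p :: real
  assumes "1 \<le> p" "0 \<le> a" "0 \<le> b"
  shows "a powr p + b powr p \<le> (a + b) powr p"
proof -
  have split: "x powr p = x * x powr (p - 1)" if "0 \<le> x" for x :: real
    using that by (simp add: powr_mult_base)
  have "a powr p + b powr p \<le> a * (a + b) powr (p - 1) + b * (a + b) powr (p - 1)"
    using assms by (simp add: split add_mono mult_left_mono powr_mono2)
  also have "\<dots> = (a + b) powr p"
    using assms by (simp add: split[of "a + b"] algebra_simps)
  finally show ?thesis .
qed

lemma powr_sum_le:
  fixes w a :: "'i \<Rightarrow> real"
  assumes p: "1 \<le> p" and S: "finite S" and w: "\<And>i. i \<in> S \<Longrightarrow> 0 \<le> w i" and W: "0 < sum w S"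
  shows "\<bar>\<Sum>i\<in>S. w i * a i\<bar> powr p
           \<le> sum w S powr p * (\<Sum>i\<in>S. w i / sum w S * \<bar>a i\<bar> powr p)"
proof -
  let ?W = "sum w S"
  have "\<bar>\<Sum>i\<in>S. w i * a i\<bar> \<le> (\<Sum>i\<in>S. w i * \<bar>a i\<bar>)"
    using w by (intro order_trans[OF sum_abs] sum_mono) (simp add: abs_mult)
  also have "\<dots> = ?W * (\<Sum>i\<in>S. (w i / ?W) *\<^sub>R \<bar>a i\<bar>)"
    using W by (simp add: sum_distrib_left)
  finally have "\<bar>\<Sum>i\<in>S. w i * a i\<bar> powr p \<le> (?W * (\<Sum>i\<in>S. (w i / ?W) *\<^sub>R \<bar>a i\<bar>)) powr p"
    using p by (intro powr_mono2) auto
  also have "\<dots> = ?W powr p * (\<Sum>i\<in>S. (w i / ?W) *\<^sub>R \<bar>a i\<bar>) powr p"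
    using w W by (intro powr_mult) 
  also have "\<dots> \<le> ?W powr p * (\<Sum>i\<in>S. (w i / ?W) * \<bar>a i\<bar> powr p)"
  proof (intro mult_left_mono)
    show "(\<Sum>i\<in>S. (w i / ?W) *\<^sub>R \<bar>a i\<bar>) powr p \<le> (\<Sum>i\<in>S. (w i / ?W) * \<bar>a i\<bar> powr p)"
      using S w W by (intro convex_on_sum[OF _ _ convex_on_powr_nonneg[OF p]])
        (auto simp flip: sum_divide_distrib)
  qed simp
  finally show ?thesis .
qed

lemma nn_integral_layer_cake:
  fixes u :: "'a \<Rightarrow> real"
  assumes "sigma_finite_measure M" and [measurable]: "u \<in> borel_measurable M"
    and nonneg: "\<And>x. x \<in> space M \<Longrightarrow> 0 \<le> u x"
  shows "(\<integral>\<^sup>+x. ennreal (u x) \<partial>M)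
       = (\<integral>\<^sup>+r. indicator {0..} r * emeasure M {x \<in> space M. r \<le> u x} \<partial>lborel)"
proof -
  interpret M: sigma_finite_measure M by fact
  interpret pair_sigma_finite M lborel ..
  let ?f = "\<lambda>(x, r). indicator {0..} r * of_bool (r \<le> u x) :: ennreal"
  have [measurable]: "?f \<in> borel_measurable (M \<Otimes>\<^sub>M lborel)"
    by measurable
  have "(\<integral>\<^sup>+x. ennreal (u x) \<partial>M) = (\<integral>\<^sup>+x. (\<integral>\<^sup>+r. ?f (x, r) \<partial>lborel) \<partial>M)"
  proof (rule nn_integral_cong)
    fix x assume "x \<in> space M"
    have "(\<integral>\<^sup>+r. ?f (x, r) \<partial>lborel) = (\<integral>\<^sup>+r. indicator {0..u x} r \<partial>lborel)"
      by (intro nn_integral_cong) (auto split: split_indicator)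
    then show "ennreal (u x) = (\<integral>\<^sup>+r. ?f (x, r) \<partial>lborel)"
      using nonneg[OF \<open>x \<in> space M\<close>] by simp
  qed
  also have "\<dots> = (\<integral>\<^sup>+r. (\<integral>\<^sup>+x. ?f (x, r) \<partial>M) \<partial>lborel)"
    by (rule Fubini'[symmetric]) simp
  also have "\<dots> = (\<integral>\<^sup>+r. indicator {0..} r * emeasure M {x \<in> space M. r \<le> u x} \<partial>lborel)"
  proof (rule nn_integral_cong)
    fix r :: real
    have "(\<integral>\<^sup>+x. ?f (x, r) \<partial>M)
        = (\<integral>\<^sup>+x. indicator {0..} r * indicator {x \<in> space M. r \<le> u x} x \<partial>M)"
      by (intro nn_integral_cong) (auto split: split_indicator)
    also have "\<dots> = indicator {0..} r * emeasure M {x \<in> space M. r \<le> u x}"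
      by (subst nn_integral_cmult_indicator) auto
    finally show "(\<integral>\<^sup>+x. ?f (x, r) \<partial>M) = indicator {0..} r * emeasure M {x \<in> space M. r \<le> u x}" .
  qed
  finally show ?thesis .
qed

text \<open>
  An error \<open>\<eta>\<close> in each tail probability integrates to \<open>K * \<eta>\<close> because only the levels in \<open>[0, K]\<close>
  matter. Tail inequalities of this kind are what a bound on the Prohorov distance delivers.
\<close>

lemma nn_integral_le_of_tails:
  fixes u :: "'a \<Rightarrow> real" and v :: "'b \<Rightarrow> real"
  assumes "sigma_finite_measure M" "sigma_finite_measure M'"
    and u[measurable]: "u \<in> borel_measurable M" and v[measurable]: "v \<in> borel_measurable M'"
    and u_range: "\<And>x. x \<in> space M \<Longrightarrow> 0 \<le> u x" "\<And>x. x \<in> space M \<Longrightarrow> u x \<le> K"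
    and v_nonneg: "\<And>x. x \<in> space M' \<Longrightarrow> 0 \<le> v x"
    and "0 \<le> K" "0 \<le> \<eta>"
    and tails: "\<And>r. 0 \<le> r \<Longrightarrow> emeasure M {x \<in> space M. r \<le> u x}
                  \<le> emeasure M' {x \<in> space M'. r \<le> v x} + ennreal \<eta>"
  shows "(\<integral>\<^sup>+x. ennreal (u x) \<partial>M) \<le> (\<integral>\<^sup>+x. ennreal (v x) \<partial>M') + ennreal (K * \<eta>)"
proof -
  interpret M': sigma_finite_measure M' by fact
  interpret pair_sigma_finite M' lborel ..
  have m: "(\<lambda>r. emeasure M' {x \<in> space M'. r \<le> v x}) \<in> borel_measurable lborel"
  proof -
    have "(\<lambda>r. (\<integral>\<^sup>+x. of_bool (r \<le> v x) \<partial>M')) \<in> borel_measurable lborel"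
      by measurable
    moreover have "(\<integral>\<^sup>+x. of_bool (r \<le> v x) \<partial>M') = emeasure M' {x \<in> space M'. r \<le> v x}" for r
    proof -
      have "(\<integral>\<^sup>+x. of_bool (r \<le> v x) \<partial>M') = (\<integral>\<^sup>+x. indicator {x \<in> space M'. r \<le> v x} x \<partial>M')"
        by (intro nn_integral_cong) (auto split: split_indicator)
      then show ?thesis by simp
    qed
    ultimately show ?thesis by simp
  qed
  have "(\<integral>\<^sup>+x. ennreal (u x) \<partial>M)
      = (\<integral>\<^sup>+r. indicator {0..} r * emeasure M {x \<in> space M. r \<le> u x} \<partial>lborel)"
    by (rule nn_integral_layer_cake) fact+
  also have "\<dots> \<le> (\<integral>\<^sup>+r. indicator {0..} r * emeasure M' {x \<in> space M'. r \<le> v x}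
                        + ennreal \<eta> * indicator {0..K} r \<partial>lborel)"
  proof (rule nn_integral_mono)
    fix r :: real
    have "emeasure M {x \<in> space M. r \<le> u x} = 0" if "K < r"
    proof -
      have "{x \<in> space M. r \<le> u x} = {}" using u_range(2) that by force
      then show ?thesis by (simp only: emeasure_empty)
    qed
    then show "indicator {0..} r * emeasure M {x \<in> space M. r \<le> u x}
        \<le> indicator {0..} r * emeasure M' {x \<in> space M'. r \<le> v x} + ennreal \<eta> * indicator {0..K} r"
      using tails[of r] by (cases "K < r") (auto split: split_indicator)
  qed
  also have "\<dots> = (\<integral>\<^sup>+r. indicator {0..} r * emeasure M' {x \<in> space M'. r \<le> v x} \<partial>lborel)
                  + (\<integral>\<^sup>+r. ennreal \<eta> * indicator {0..K} r \<partial>lborel)"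
    using m by (intro nn_integral_add) auto
  also have "(\<integral>\<^sup>+r. indicator {0..} r * emeasure M' {x \<in> space M'. r \<le> v x} \<partial>lborel)
      = (\<integral>\<^sup>+x. ennreal (v x) \<partial>M')"
    by (rule nn_integral_layer_cake[symmetric]) fact+
  also have "(\<integral>\<^sup>+r. ennreal \<eta> * indicator {0..K} r \<partial>lborel) = ennreal (K * \<eta>)"
    using \<open>0 \<le> K\<close> \<open>0 \<le> \<eta>\<close> by (subst nn_integral_cmult_indicator) (auto simp: ennreal_mult mult.commute)
  finally show ?thesis .
qed

section \<open>Estimates for the norms\<close>

lemma Lp_norm_le_iff_finite:
  assumes p: "1 \<le> p" "p \<noteq> \<infinity>" and c: "0 \<le> c"
  shows "Lp_norm p M f \<le> ennreal c
     \<longleftrightarrow> (\<integral>\<^sup>+x. ennreal (\<bar>f x\<bar> powr enn2real p) \<partial>M) \<le> ennreal (c powr enn2real p)"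
proof -
  define P where "P = enn2real p"
  have P: "1 \<le> P" using p enn2real_mono[of 1 p] by (simp add: P_def top.not_eq_extremum)
  define I where "I = (\<integral>\<^sup>+x. ennreal (\<bar>f x\<bar> powr P) \<partial>M)"
  have N: "Lp_norm p M f = (if I = \<infinity> then \<infinity> else ennreal (enn2real I powr (1 / P)))"
    using p by (simp add: Lp_norm_def P_def I_def Let_def)
  show ?thesis
  proof (cases "I = \<infinity>")
    case True
    then show ?thesis unfolding P_def[symmetric] I_def[symmetric] N by (simp add: top_unique)
  next
    case False
    then obtain i where i: "I = ennreal i" "0 \<le> i" by (cases I) auto
    have "i powr (1 / P) \<le> c \<longleftrightarrow> i \<le> c powr P"
    proof
      assume "i powr (1 / P) \<le> c"
      then have "(i powr (1 / P)) powr P \<le> c powr P" using P by (intro powr_mono2) auto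
      then show "i \<le> c powr P" using P i by (simp add: powr_powr)
    next
      assume "i \<le> c powr P"
      then have "i powr (1 / P) \<le> (c powr P) powr (1 / P)" using P i by (intro powr_mono2) auto
      then show "i powr (1 / P) \<le> c" using P c by (simp add: powr_powr)
    qed
    then show ?thesis unfolding P_def[symmetric] I_def[symmetric] N using i c by simp
  qed
qed

lemma Lp_norm_le_iff_infinite:
  assumes f: "f \<in> borel_measurable M" and c: "0 \<le> c"
  shows "Lp_norm \<infinity> M f \<le> ennreal c \<longleftrightarrow> (AE x in M. \<bar>f x\<bar> \<le> c)"
proof
  assume "Lp_norm \<infinity> M f \<le> ennreal c"
  then have le: "esssup M (\<lambda>x. ennreal \<bar>f x\<bar>) \<le> ennreal c" by (simp add: Lp_norm_def)
  have "AE x in M. ennreal \<bar>f x\<bar> \<le> esssup M (\<lambda>x. ennreal \<bar>f x\<bar>)" by (rule esssup_AE)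
  then show "AE x in M. \<bar>f x\<bar> \<le> c"
    by eventually_elim (use le c order_trans in fastforce)
next
  assume "AE x in M. \<bar>f x\<bar> \<le> c"
  then have "AE x in M. ennreal \<bar>f x\<bar> \<le> ennreal c"
    by eventually_elim (simp add: ennreal_leI)
  then show "Lp_norm \<infinity> M f \<le> ennreal c"
    using f by (auto simp: Lp_norm_def intro!: esssup_I)
qed

lemma Lp_norm_le_bound:
  assumes "prob_space M" "1 \<le> p" "f \<in> borel_measurable M" "0 \<le> K"
    and bound: "\<And>x. x \<in> space M \<Longrightarrow> \<bar>f x\<bar> \<le> K"
  shows "Lp_norm p M f \<le> ennreal K"
proof (cases "p = \<infinity>")
  case True
  have "AE x in M. \<bar>f x\<bar> \<le> K" using bound by simp
  with assms show ?thesis by (simp only: True Lp_norm_le_iff_infinite)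
next
  case False
  interpret prob_space M by fact
  have "(\<integral>\<^sup>+x. ennreal (\<bar>f x\<bar> powr enn2real p) \<partial>M) \<le> (\<integral>\<^sup>+x. ennreal (K powr enn2real p) \<partial>M)"
    using bound by (intro nn_integral_mono ennreal_leI powr_mono2) auto
  also have "\<dots> = ennreal (K powr enn2real p)" by (simp add: emeasure_space_1)
  finally show ?thesis using assms False by (simp add: Lp_norm_le_iff_finite)
qed

lemma Lp_norm_cong:
  assumes "f \<in> borel_measurable M" "g \<in> borel_measurable M" "\<And>x. x \<in> space M \<Longrightarrow> f x = g x"
  shows "Lp_norm p M f = Lp_norm p M g"
proof -
  have "esssup M (\<lambda>x. ennreal \<bar>f x\<bar>) = esssup M (\<lambda>x. ennreal \<bar>g x\<bar>)"
    using assms by (intro esssup_AE_cong) auto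
  moreover have "(\<integral>\<^sup>+x. ennreal (\<bar>f x\<bar> powr enn2real p) \<partial>M) = (\<integral>\<^sup>+x. ennreal (\<bar>g x\<bar> powr enn2real p) \<partial>M)"
    using assms(3) by (intro nn_integral_cong) auto
  ultimately show ?thesis by (simp add: Lp_norm_def)
qed

text \<open>
  Minkowski's inequality for a finite family of functions of norm at most \<open>c\<close>. Averaging over starting
  points, with total weight \<open>1\<close> or \<open>1 - c\<close>, is the mechanism behind all decay in time.
\<close>

lemma Lp_norm_weighted_sum_le:
  fixes f :: "'i \<Rightarrow> 'a \<Rightarrow> real"
  assumes p: "1 \<le> p" and S: "finite S" and w: "\<And>i. i \<in> S \<Longrightarrow> 0 \<le> w i" and W: "0 < sum w S"
    and f[measurable]: "\<And>i. i \<in> S \<Longrightarrow> f i \<in> borel_measurable M" and c: "0 \<le> c"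
    and le: "\<And>i. i \<in> S \<Longrightarrow> Lp_norm p M (f i) \<le> ennreal c"
  shows "Lp_norm p M (\<lambda>x. \<Sum>i\<in>S. w i * f i x) \<le> ennreal (sum w S * c)"
proof (cases "p = \<infinity>")
  case True
  have "AE x in M. \<forall>i\<in>S. \<bar>f i x\<bar> \<le> c"
    using le f c S by (simp add: AE_finite_all True Lp_norm_le_iff_infinite[simplified])
  then have "AE x in M. \<bar>\<Sum>i\<in>S. w i * f i x\<bar> \<le> sum w S * c"
  proof eventually_elim
    case (elim x)
    have "\<bar>\<Sum>i\<in>S. w i * f i x\<bar> \<le> (\<Sum>i\<in>S. w i * c)"
      using w elim by (intro order_trans[OF sum_abs] sum_mono) (simp add: abs_mult mult_left_mono)
    then show ?case by (simp add: sum_distrib_right)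
  qed
  moreover have "(\<lambda>x. \<Sum>i\<in>S. w i * f i x) \<in> borel_measurable M" by measurable
  ultimately show ?thesis
    using c W Lp_norm_le_iff_infinite[of "\<lambda>x. \<Sum>i\<in>S. w i * f i x" M "sum w S * c"] by (simp add: True)
next
  case False
  define P where "P = enn2real p"
  have P: "1 \<le> P" using p False enn2real_mono[of 1 p] by (simp add: P_def top.not_eq_extremum)
  let ?W = "sum w S"
  have "(\<integral>\<^sup>+x. ennreal (\<bar>\<Sum>i\<in>S. w i * f i x\<bar> powr P) \<partial>M)
      \<le> (\<integral>\<^sup>+x. (\<Sum>i\<in>S. ennreal (?W powr P * (w i / ?W)) * ennreal (\<bar>f i x\<bar> powr P)) \<partial>M)"
  proof (rule nn_integral_mono)
    fix x
    have "ennreal (\<bar>\<Sum>i\<in>S. w i * f i x\<bar> powr P)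
        \<le> ennreal (\<Sum>i\<in>S. (?W powr P * (w i / ?W)) * \<bar>f i x\<bar> powr P)"
      using powr_sum_le[OF P S w W, of "\<lambda>i. f i x"] by (simp add: sum_distrib_left mult.assoc ennreal_leI)
    also have "\<dots> = (\<Sum>i\<in>S. ennreal ((?W powr P * (w i / ?W)) * \<bar>f i x\<bar> powr P))"
      using w W by (intro sum_ennreal[symmetric]) auto
    also have "\<dots> = (\<Sum>i\<in>S. ennreal (?W powr P * (w i / ?W)) * ennreal (\<bar>f i x\<bar> powr P))"
      using w W by (intro sum.cong refl ennreal_mult) auto
    finally show "ennreal (\<bar>\<Sum>i\<in>S. w i * f i x\<bar> powr P)
        \<le> (\<Sum>i\<in>S. ennreal (?W powr P * (w i / ?W)) * ennreal (\<bar>f i x\<bar> powr P))" .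
  qed
  also have "\<dots> = (\<Sum>i\<in>S. ennreal (?W powr P * (w i / ?W)) * (\<integral>\<^sup>+x. ennreal (\<bar>f i x\<bar> powr P) \<partial>M))"
    by (subst nn_integral_sum) (auto simp: nn_integral_cmult)
  also have "\<dots> \<le> (\<Sum>i\<in>S. ennreal (?W powr P * (w i / ?W)) * ennreal (c powr P))"
    using le p False c by (intro sum_mono mult_left_mono) (auto simp: Lp_norm_le_iff_finite P_def)
  also have "\<dots> = ennreal (\<Sum>i\<in>S. ?W powr P * (w i / ?W) * c powr P)"
  proof -
    have "(\<Sum>i\<in>S. ennreal (?W powr P * (w i / ?W)) * ennreal (c powr P))
        = (\<Sum>i\<in>S. ennreal (?W powr P * (w i / ?W) * c powr P))"
      using w W by (intro sum.cong refl ennreal_mult[symmetric]) auto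
    also have "\<dots> = ennreal (\<Sum>i\<in>S. ?W powr P * (w i / ?W) * c powr P)"
      using w W by (intro sum_ennreal) auto
    finally show ?thesis .
  qed
  also have "(\<Sum>i\<in>S. ?W powr P * (w i / ?W) * c powr P) = (?W * c) powr P"
    using W c by (simp add: powr_mult flip: sum_distrib_right sum_distrib_left sum_divide_distrib)
  finally show ?thesis using p False c W by (simp add: Lp_norm_le_iff_finite P_def)
qed

text \<open>
  The average of \<open>\<bar>f\<bar>\<close> is at most its \<open>L\<^sup>p\<close> norm on a probability space. Young's inequality, in the form of
  the tangent line to \<open>y powr p\<close> at \<open>c\<close>, gives this directly.
\<close>

lemma integral_mult_le_Lp_norm:
  assumes "prob_space M" and p: "1 \<le> p" and f[measurable]: "f \<in> borel_measurable M"
    and g[measurable]: "g \<in> borel_measurable M" and g01: "\<And>x. 0 \<le> g x" "\<And>x. g x \<le> 1"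
    and K: "\<And>x. x \<in> space M \<Longrightarrow> \<bar>f x\<bar> \<le> K" and c: "0 < c" and le: "Lp_norm p M f \<le> ennreal c"
  shows "(\<integral>x. f x * g x \<partial>M) \<le> c"
proof -
  interpret prob_space M by fact
  have int: "integrable M (\<lambda>x. \<bar>f x\<bar>)"
    using K by (intro integrable_const_bound[where B=K]) auto
  have "(\<integral>x. f x * g x \<partial>M) \<le> (\<integral>x. \<bar>f x\<bar> \<partial>M)"
  proof (intro integral_mono int)
    have "\<bar>f x\<bar> * \<bar>g x\<bar> \<le> \<bar>f x\<bar>" for x
      using g01[of x] by (intro mult_left_le) auto
    then show "integrable M (\<lambda>x. f x * g x)"
      by (intro Bochner_Integration.integrable_bound[OF int]) (auto simp: abs_mult)
    show "f x * g x \<le> \<bar>f x\<bar>" for x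
      using \<open>\<bar>f x\<bar> * \<bar>g x\<bar> \<le> \<bar>f x\<bar>\<close> by (metis abs_ge_self abs_mult order_trans)
  qed
  also have "\<dots> \<le> c"
  proof (cases "p = \<infinity>")
    case True
    have "AE x in M. \<bar>f x\<bar> \<le> c"
      using le f c by (simp only: True Lp_norm_le_iff_infinite[OF f less_imp_le])
    then have "(\<integral>x. \<bar>f x\<bar> \<partial>M) \<le> (\<integral>x. c \<partial>M)" by (intro integral_mono_AE int) auto
    then show ?thesis by (simp add: prob_space)
  next
    case False
    define P where "P = enn2real p"
    have P: "1 \<le> P" using p False enn2real_mono[of 1 p] by (simp add: P_def top.not_eq_extremum)
    have I: "(\<integral>\<^sup>+x. ennreal (\<bar>f x\<bar> powr P) \<partial>M) \<le> ennreal (c powr P)"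
      using le p False c by (simp add: Lp_norm_le_iff_finite P_def)
    have intP: "integrable M (\<lambda>x. \<bar>f x\<bar> powr P)"
      using I by (intro integrableI_bounded) (auto simp: top_unique less_top[symmetric])
    have tangent: "P * c powr (P - 1) * y \<le> y powr P + (P - 1) * c powr P" if "0 \<le> y" for y
    proof (cases "P = 1")
      case True
      then show ?thesis using that c by simp
    next
      case False
      then have P1: "1 < P" using P by simp
      have "y * c powr (P - 1)
          \<le> y powr P / P + (c powr (P - 1)) powr (P / (P - 1)) / (P / (P - 1))"
        using P1 that by (intro Youngs_inequality) (auto simp: field_simps)
      also have "(c powr (P - 1)) powr (P / (P - 1)) = c powr P"
        using P1 by (simp add: powr_powr)
      finally show ?thesis using P1 by (simp add: field_simps)
    qed
    have "P * c powr (P - 1) * (\<integral>x. \<bar>f x\<bar> \<partial>M) = (\<integral>x. P * c powr (P - 1) * \<bar>f x\<bar> \<partial>M)"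
      by simp
    also have "\<dots> \<le> (\<integral>x. \<bar>f x\<bar> powr P + (P - 1) * c powr P \<partial>M)"
      using int intP tangent by (intro integral_mono) auto
    also have "\<dots> = (\<integral>x. \<bar>f x\<bar> powr P \<partial>M) + (P - 1) * c powr P"
      using intP by (simp add: prob_space)
    also have "(\<integral>x. \<bar>f x\<bar> powr P \<partial>M) \<le> c powr P"
      using I intP by (simp add: nn_integral_eq_integral)
    finally have "P * c powr (P - 1) * (\<integral>x. \<bar>f x\<bar> \<partial>M) \<le> P * c powr P"
      by (simp add: algebra_simps)
    also have "\<dots> = P * c powr (P - 1) * c" using c by (simp add: powr_mult_base mult.commute[of _ c])
    finally show ?thesis using P c by simp
  qed
  finally show ?thesis .
qed

text \<open>
  The first clause permits sets of measure \<open>\<eta>\<close> to be ignored, as Prohorov closeness does, and so cannot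
  see an essential supremum. The second clause is there for the exponent \<open>\<infinity>\<close>.
\<close>

definition tails_dominated ::
  "real \<Rightarrow> 'a measure \<Rightarrow> ('a \<Rightarrow> real) \<Rightarrow> 'b measure \<Rightarrow> ('b \<Rightarrow> real) \<Rightarrow> bool" where
  "tails_dominated \<eta> M f M' g \<longleftrightarrow>
     (\<forall>r. emeasure M {x \<in> space M. r \<le> \<bar>f x\<bar>}
        \<le> emeasure M' {x \<in> space M'. r \<le> \<bar>g x\<bar> + \<eta>} + ennreal \<eta>) \<and>
     (\<forall>c. (AE x in M'. \<bar>g x\<bar> \<le> c) \<longrightarrow> (AE x in M. \<bar>f x\<bar> \<le> c + \<eta>))"

text \<open>
  The constant \<open>\<eta>\<close> depends only on the exponent, the bound \<open>K\<close> and the target error, not on the two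
  spaces. This uniformity is what allows the supremum over starting points to be taken afterwards.
\<close>

lemma Lp_norm_le_of_tails:
  fixes K :: real
  assumes p: "1 \<le> p" and "0 \<le> K" "0 < \<kappa>"
  obtains \<eta> :: real where "0 < \<eta>"
    and "\<And>(M :: 'a measure) (M' :: 'b measure) f g.
        prob_space M \<Longrightarrow> prob_space M' \<Longrightarrow> f \<in> borel_measurable M \<Longrightarrow> g \<in> borel_measurable M' \<Longrightarrow>
        (\<And>x. x \<in> space M \<Longrightarrow> \<bar>f x\<bar> \<le> K) \<Longrightarrow> (\<And>x. x \<in> space M' \<Longrightarrow> \<bar>g x\<bar> \<le> K) \<Longrightarrow>
        tails_dominated \<eta> M f M' g \<Longrightarrow>
        Lp_norm p M f \<le> Lp_norm p M' g + ennreal \<kappa>"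
proof (cases "p = \<infinity>")
  case True
  show ?thesis
  proof (rule that[OF \<open>0 < \<kappa>\<close>])
    fix M :: "'a measure" and M' :: "'b measure" and f g
    assume M: "prob_space M" "prob_space M'"
      and f: "f \<in> borel_measurable M" and g: "g \<in> borel_measurable M'"
      and gK: "\<And>x. x \<in> space M' \<Longrightarrow> \<bar>g x\<bar> \<le> K"
      and dom: "tails_dominated \<kappa> M f M' g"
    have "Lp_norm p M' g < \<infinity>"
      using Lp_norm_le_bound[OF M(2) p g \<open>0 \<le> K\<close> gK] by (auto intro: le_less_trans)
    then obtain c where c: "Lp_norm p M' g = ennreal c" "0 \<le> c" by (cases "Lp_norm p M' g") auto
    have "AE x in M'. \<bar>g x\<bar> \<le> c" using c True Lp_norm_le_iff_infinite[OF g, of c] by simp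
    then have "AE x in M. \<bar>f x\<bar> \<le> c + \<kappa>" using dom by (simp add: tails_dominated_def)
    then have "Lp_norm p M f \<le> ennreal (c + \<kappa>)"
      using c \<open>0 < \<kappa>\<close> True Lp_norm_le_iff_infinite[OF f, of "c + \<kappa>"] by simp
    then show "Lp_norm p M f \<le> Lp_norm p M' g + ennreal \<kappa>"
      using c \<open>0 < \<kappa>\<close> by (simp flip: ennreal_plus)
  qed
next
  case False
  define P where "P = enn2real p"
  have P: "1 \<le> P" using p False enn2real_mono[of 1 p] by (simp add: P_def top.not_eq_extremum)
  \<comment> \<open>The range is \<open>[0, K + 1]\<close> since \<open>\<bar>g\<bar> + \<eta>\<close> with \<open>\<eta> \<le> 1\<close> is compared with \<open>\<bar>g\<bar>\<close>. One half of
    \<open>\<kappa> powr P\<close> pays for the shift by \<open>\<eta>\<close>, the other for the error \<open>\<eta>\<close> in the tails.\<close>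
  have "continuous_on {0..K+1} (\<lambda>x. x powr P)" using P by (intro continuous_on_powr' continuous_intros) auto
  then have "uniformly_continuous_on {0..K+1} (\<lambda>x. x powr P)"
    by (intro compact_uniformly_continuous) auto
  then obtain \<delta> where \<delta>: "0 < \<delta>" "\<And>a b. a \<in> {0..K+1} \<Longrightarrow> b \<in> {0..K+1} \<Longrightarrow> dist b a < \<delta>
      \<Longrightarrow> dist (b powr P) (a powr P) < \<kappa> powr P / 2"
    using \<open>0 < \<kappa>\<close> unfolding uniformly_continuous_on_def
    by (metis half_gt_zero powr_gt_zero less_irrefl)
  define \<eta> where "\<eta> = min (\<delta> / 2) (min 1 (\<kappa> powr P / (2 * (K powr P + 1))))"
  have "0 < K powr P + 1" by (smt (verit) powr_ge_zero)
  then have \<eta>: "0 < \<eta>" "\<eta> < \<delta>" "\<eta> \<le> 1" and "\<eta> \<le> \<kappa> powr P / (2 * (K powr P + 1))"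
    using \<delta>(1) \<open>0 < \<kappa>\<close> by (auto simp: \<eta>_def)
  then have "(K powr P + 1) * \<eta> \<le> \<kappa> powr P / 2"
    using \<open>0 < K powr P + 1\<close> by (simp add: field_simps)
  then have K\<eta>: "K powr P * \<eta> \<le> \<kappa> powr P / 2"
    using \<eta> by (simp add: algebra_simps)
  show ?thesis
  proof (rule that[OF \<eta>(1)])
    fix M :: "'a measure" and M' :: "'b measure" and f g
    assume M: "prob_space M" "prob_space M'"
      and f[measurable]: "f \<in> borel_measurable M" and g[measurable]: "g \<in> borel_measurable M'"
      and fK: "\<And>x. x \<in> space M \<Longrightarrow> \<bar>f x\<bar> \<le> K"
      and gK: "\<And>x. x \<in> space M' \<Longrightarrow> \<bar>g x\<bar> \<le> K"
      and dom: "tails_dominated \<eta> M f M' g"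
    interpret M: prob_space M by fact
    interpret M': prob_space M' by fact
    have "Lp_norm p M' g < \<infinity>"
      using Lp_norm_le_bound[OF M(2) p g \<open>0 \<le> K\<close> gK] by (auto intro: le_less_trans)
    then obtain c where c: "Lp_norm p M' g = ennreal c" "0 \<le> c" by (cases "Lp_norm p M' g") auto
    have level: "r \<le> a powr P \<longleftrightarrow> r powr (1 / P) \<le> a" if "0 \<le> r" "0 \<le> a" for r a :: real
    proof
      assume "r \<le> a powr P"
      then have "r powr (1 / P) \<le> (a powr P) powr (1 / P)" using P that by (intro powr_mono2) auto
      then show "r powr (1 / P) \<le> a" using P that by (simp add: powr_powr)
    next
      assume "r powr (1 / P) \<le> a"
      then have "(r powr (1 / P)) powr P \<le> a powr P" using P by (intro powr_mono2) auto
      then show "r \<le> a powr P" using P that by (simp add: powr_powr)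
    qed
    have "(\<integral>\<^sup>+x. ennreal (\<bar>f x\<bar> powr P) \<partial>M)
        \<le> (\<integral>\<^sup>+x. ennreal ((\<bar>g x\<bar> + \<eta>) powr P) \<partial>M') + ennreal (K powr P * \<eta>)"
    proof (rule nn_integral_le_of_tails)
      show "\<bar>f x\<bar> powr P \<le> K powr P" if "x \<in> space M" for x
        using fK[OF that] P by (intro powr_mono2) auto
      fix r :: real assume r: "0 \<le> r"
      show "emeasure M {x \<in> space M. r \<le> \<bar>f x\<bar> powr P}
          \<le> emeasure M' {x \<in> space M'. r \<le> (\<bar>g x\<bar> + \<eta>) powr P} + ennreal \<eta>"
        using dom r \<eta>(1) by (simp add: level tails_dominated_def)
    qed (use \<eta> M.sigma_finite_measure_axioms M'.sigma_finite_measure_axioms in auto)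
    also have "(\<integral>\<^sup>+x. ennreal ((\<bar>g x\<bar> + \<eta>) powr P) \<partial>M')
        \<le> (\<integral>\<^sup>+x. ennreal (\<bar>g x\<bar> powr P) + ennreal (\<kappa> powr P / 2) \<partial>M')"
    proof (rule nn_integral_mono)
      fix x assume "x \<in> space M'"
      then have "dist ((\<bar>g x\<bar> + \<eta>) powr P) (\<bar>g x\<bar> powr P) < \<kappa> powr P / 2"
        using gK \<eta> by (intro \<delta>(2)) (force simp: dist_real_def)+
      then have "(\<bar>g x\<bar> + \<eta>) powr P \<le> \<bar>g x\<bar> powr P + \<kappa> powr P / 2"
        unfolding dist_real_def by linarith
      then show "ennreal ((\<bar>g x\<bar> + \<eta>) powr P) \<le> ennreal (\<bar>g x\<bar> powr P) + ennreal (\<kappa> powr P / 2)"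
        by (simp flip: ennreal_plus add: ennreal_leI)
    qed
    also have "\<dots> = (\<integral>\<^sup>+x. ennreal (\<bar>g x\<bar> powr P) \<partial>M') + ennreal (\<kappa> powr P / 2)"
      by (subst nn_integral_add) (auto simp: M'.emeasure_space_1)
    also have "(\<integral>\<^sup>+x. ennreal (\<bar>g x\<bar> powr P) \<partial>M') \<le> ennreal (c powr P)"
      using c p False Lp_norm_le_iff_finite[of p c M' g] by (simp add: P_def)
    finally have "(\<integral>\<^sup>+x. ennreal (\<bar>f x\<bar> powr P) \<partial>M)
        \<le> ennreal (c powr P) + ennreal (\<kappa> powr P / 2) + ennreal (K powr P * \<eta>)"
      by (simp add: add_right_mono)
    also have "\<dots> = ennreal (c powr P + \<kappa> powr P / 2 + K powr P * \<eta>)"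
      using \<eta> by (simp flip: ennreal_plus)
    also have "\<dots> \<le> ennreal ((c + \<kappa>) powr P)"
      using K\<eta> powr_superadditive[OF P c(2), of \<kappa>] \<open>0 < \<kappa>\<close> by (intro ennreal_leI) simp
    finally have "Lp_norm p M f \<le> ennreal (c + \<kappa>)"
      using p False c \<open>0 < \<kappa>\<close> by (simp add: Lp_norm_le_iff_finite P_def del: ennreal_plus)
    then show "Lp_norm p M f \<le> Lp_norm p M' g + ennreal \<kappa>"
      using c \<open>0 < \<kappa>\<close> by (simp flip: ennreal_plus)
  qed
qed

section \<open>Random walks on finite graphs\<close>

text \<open>
  What the walk needs of the graph: positive vertex weights make the transition probabilities sum to
  \<open>1\<close> and every vertex an atom of the stationary measure.
\<close>

locale finite_walk =
  fixes V :: "'v set" and \<mu> :: "'v \<Rightarrow> 'v \<Rightarrow> real"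
  assumes finite_V: "finite V" and V_nonempty: "V \<noteq> {}"
    and weight_nonneg: "\<And>x y. x \<in> V \<Longrightarrow> y \<in> V \<Longrightarrow> 0 \<le> \<mu> x y"
    and weight_sym: "\<And>x y. x \<in> V \<Longrightarrow> y \<in> V \<Longrightarrow> \<mu> x y = \<mu> y x"
    and vertex_weight_pos: "\<And>x. x \<in> V \<Longrightarrow> 0 < vertex_weight V \<mu> x"

text \<open>
  With a second vertex to reach, connectedness provides an edge at each vertex.
\<close>

lemma finite_walk_of_connected_graph:
  assumes G: "weighted_graph V E \<mu>" "connected_graph V E" and card: "2 \<le> card V"
  shows "finite_walk V \<mu>"
proof
  show fin: "finite V" using G by (simp add: weighted_graph_def)
  show "V \<noteq> {}" using card by auto
  show nonneg: "0 \<le> \<mu> x y" and "\<mu> x y = \<mu> y x" if "x \<in> V" "y \<in> V" for x y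
    using G that by (auto simp: weighted_graph_def)
  show "0 < vertex_weight V \<mu> x" if x: "x \<in> V" for x
  proof -
    obtain y where y: "y \<in> V" "y \<noteq> x"
    proof -
      have "\<not> V \<subseteq> {x}" using card card_mono[of "{x}" V] by auto
      then show ?thesis using that by auto
    qed
    then have "(x, y) \<in> {(u, v). u \<in> V \<and> v \<in> V \<and> {u, v} \<in> E}\<^sup>*"
      using G(2) x by (auto simp: connected_graph_def)
    then obtain z where "z \<in> V" "{x, z} \<in> E"
      using y(2) by (cases rule: converse_rtranclE) auto
    then have "0 < \<mu> x z" using G(1) x by (auto simp: weighted_graph_def)
    then show ?thesis
      unfolding vertex_weight_def using fin nonneg x \<open>z \<in> V\<close> by (intro sum_pos2[of V z]) auto
  qed
qed

definition graph_distance :: "ennreal \<Rightarrow> 'v set \<Rightarrow> ('v \<Rightarrow> 'v \<Rightarrow> real) \<Rightarrow> nat \<Rightarrow> ennreal" where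
  "graph_distance p V \<mu> m =
     (SUP x\<in>V. Lp_norm p (graph_measure V \<mu>) (\<lambda>y. smoothed_density V \<mu> m x y - 1))"

context finite_walk
begin

abbreviation w :: "'v \<Rightarrow> real" where "w \<equiv> vertex_weight V \<mu>"
abbreviation total :: real where "total \<equiv> \<Sum>z\<in>V. w z"
abbreviation \<nu> :: "'v measure" where "\<nu> \<equiv> graph_measure V \<mu>"
abbreviation walk :: "nat \<Rightarrow> 'v \<Rightarrow> 'v \<Rightarrow> real" where "walk \<equiv> walk_prob V \<mu>"
abbreviation dens :: "nat \<Rightarrow> 'v \<Rightarrow> 'v \<Rightarrow> real" where "dens \<equiv> smoothed_density V \<mu>"

declare walk_prob.simps(2) [simp del]

lemma total_pos: "0 < total"
  using finite_V V_nonempty vertex_weight_pos by (intro sum_pos) auto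

lemma space_graph_measure: "space \<nu> = V"
  and sets_graph_measure: "sets \<nu> = Pow V"
  by (simp_all add: graph_measure_def space_point_measure sets_point_measure)

lemma borel_measurable_graph_measure: "f \<in> borel_measurable \<nu>"
  by (simp add: graph_measure_def)

lemma emeasure_graph_measure: "A \<subseteq> V \<Longrightarrow> emeasure \<nu> A = ennreal (sum w A / total)"
proof -
  assume A: "A \<subseteq> V"
  have "emeasure \<nu> A = (\<Sum>x\<in>A. ennreal (w x / total))"
    using A finite_V by (simp add: graph_measure_def emeasure_point_measure_finite)
  also have "\<dots> = ennreal (\<Sum>x\<in>A. w x / total)"
    using A total_pos vertex_weight_pos by (intro sum_ennreal) (auto intro!: divide_nonneg_nonneg less_imp_le)
  finally show ?thesis by (simp add: sum_divide_distrib)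
qed

lemma prob_space_graph_measure: "prob_space \<nu>"
  using total_pos by (intro prob_spaceI) (simp add: space_graph_measure emeasure_graph_measure)

lemma measure_vertex: "x \<in> V \<Longrightarrow> measure \<nu> {x} = w x / total"
  using vertex_weight_pos[of x] total_pos by (simp add: measure_def emeasure_graph_measure)

lemma measure_vertex_pos: "x \<in> V \<Longrightarrow> 0 < measure \<nu> {x}"
  using vertex_weight_pos[of x] total_pos by (simp add: measure_vertex)

lemma AE_graph_measure: "(AE x in \<nu>. Q x) \<longleftrightarrow> (\<forall>x\<in>V. Q x)"
  unfolding graph_measure_def AE_point_measure
  using vertex_weight_pos total_pos by (meson divide_pos_pos ennreal_less_zero_iff)

lemma step_nonneg: "x \<in> V \<Longrightarrow> z \<in> V \<Longrightarrow> 0 \<le> \<mu> x z / w x"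
  using weight_nonneg vertex_weight_pos[of x] by simp

lemma sum_step: "x \<in> V \<Longrightarrow> (\<Sum>z\<in>V. \<mu> x z / w x) = 1"
  using vertex_weight_pos[of x] by (simp add: vertex_weight_def flip: sum_divide_distrib)

lemma walk_nonneg: "x \<in> V \<Longrightarrow> 0 \<le> walk m x y"
proof (induction m arbitrary: x)
  case (Suc m)
  then show ?case
    unfolding walk_prob.simps by (intro sum_nonneg mult_nonneg_nonneg step_nonneg)
qed simp

lemma sum_walk: "x \<in> V \<Longrightarrow> (\<Sum>y\<in>V. walk m x y) = 1"
proof (induction m arbitrary: x)
  case 0
  then show ?case using finite_V by simp
next
  case (Suc m)
  have "(\<Sum>y\<in>V. walk (Suc m) x y) = (\<Sum>z\<in>V. \<mu> x z / w x * (\<Sum>y\<in>V. walk m z y))"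
    unfolding walk_prob.simps sum_distrib_left by (rule sum.swap)
  then show ?case using Suc by (simp add: sum_step)
qed

lemma walk_add: "x \<in> V \<Longrightarrow> walk (m + n) x y = (\<Sum>z\<in>V. walk m x z * walk n z y)"
proof (induction m arbitrary: x)
  case 0
  have "(\<Sum>z\<in>V. walk 0 x z * walk n z y) = (\<Sum>z\<in>V. if z = x then walk n z y else 0)"
    by (intro sum.cong) auto
  then show ?case using 0 finite_V by simp
next
  case (Suc m)
  have "walk (Suc m + n) x y = (\<Sum>u\<in>V. \<Sum>z\<in>V. \<mu> x u / w x * walk m u z * walk n z y)"
    using Suc by (simp add: sum_distrib_left mult.assoc walk_prob.simps(2))
  also have "\<dots> = (\<Sum>z\<in>V. (\<Sum>u\<in>V. \<mu> x u / w x * walk m u z) * walk n z y)"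
    unfolding sum_distrib_right by (rule sum.swap)
  finally show ?case by (simp add: walk_prob.simps(2))
qed

text \<open>This is where symmetry of the weights enters.\<close>

lemma walk_stationary: "y \<in> V \<Longrightarrow> (\<Sum>x\<in>V. w x * walk m x y) = w y"
proof (induction m)
  case 0
  have "(\<Sum>x\<in>V. w x * walk 0 x y) = (\<Sum>x\<in>V. if x = y then w x else 0)"
    by (intro sum.cong) auto
  then show ?case using 0 finite_V by simp
next
  case (Suc m)
  have "(\<Sum>x\<in>V. w x * walk (Suc m) x y) = (\<Sum>x\<in>V. \<Sum>z\<in>V. \<mu> x z * walk m z y)"
    unfolding walk_prob.simps sum_distrib_left
    using vertex_weight_pos by (intro sum.cong refl) (force simp: field_simps)
  also have "\<dots> = (\<Sum>z\<in>V. \<Sum>x\<in>V. \<mu> z x * walk m z y)"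
    by (subst sum.swap) (intro sum.cong refl, simp add: weight_sym)
  also have "\<dots> = (\<Sum>z\<in>V. w z * walk m z y)"
    by (simp add: vertex_weight_def sum_distrib_right)
  finally show ?case using Suc by simp
qed

lemma dens_eq: "dens m x y = (walk m x y + walk (Suc m) x y) / (2 * measure \<nu> {y})"
  by (simp add: smoothed_density_def walk_density_def add_divide_distrib)

lemma dens_nonneg: "x \<in> V \<Longrightarrow> 0 \<le> dens m x y"
  by (simp add: dens_eq walk_nonneg)

lemma dens_Suc: "dens (Suc m) x y = (\<Sum>z\<in>V. \<mu> x z / w x * dens m z y)"
proof -
  have "dens (Suc m) x y = ((\<Sum>z\<in>V. \<mu> x z / w x * walk m z y)
      + (\<Sum>z\<in>V. \<mu> x z / w x * walk (Suc m) z y)) / (2 * measure \<nu> {y})"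
    by (simp only: dens_eq walk_prob.simps(2)[of V \<mu> m x y] walk_prob.simps(2)[of V \<mu> "Suc m" x y])
  then show ?thesis
    unfolding dens_eq by (simp add: sum_divide_distrib sum.distrib add_divide_distrib distrib_left)
qed

lemma sum_dens_row: "x \<in> V \<Longrightarrow> (\<Sum>z\<in>V. measure \<nu> {z} * dens m x z) = 1"
proof -
  assume x: "x \<in> V"
  have "(\<Sum>z\<in>V. measure \<nu> {z} * dens m x z) = (\<Sum>z\<in>V. (walk m x z + walk (Suc m) x z) / 2)"
  proof (intro sum.cong refl)
    fix z assume "z \<in> V"
    then show "measure \<nu> {z} * dens m x z = (walk m x z + walk (Suc m) x z) / 2"
      using measure_vertex_pos[of z] unfolding dens_eq by simp
  qed
  also have "\<dots> = 1"
    using sum_walk[OF x, of m] sum_walk[OF x, of "Suc m"]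
    by (simp only: sum.distrib flip: sum_divide_distrib) simp
  finally show ?thesis .
qed

lemma sum_dens_column: "y \<in> V \<Longrightarrow> (\<Sum>z\<in>V. measure \<nu> {z} * dens m z y) = 1"
proof -
  assume y: "y \<in> V"
  have "(\<Sum>z\<in>V. measure \<nu> {z} * dens m z y)
      = (\<Sum>z\<in>V. (w z * walk m z y + w z * walk (Suc m) z y) / (2 * w y))"
  proof (intro sum.cong refl)
    fix z assume "z \<in> V"
    then show "measure \<nu> {z} * dens m z y = (w z * walk m z y + w z * walk (Suc m) z y) / (2 * w y)"
      unfolding dens_eq using total_pos y vertex_weight_pos[OF y]
      by (simp add: measure_vertex divide_simps) (simp add: algebra_simps)
  qed
  also have "\<dots> = (w y + w y) / (2 * w y)"
    using walk_stationary[OF y, of m] walk_stationary[OF y, of "Suc m"]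
    by (simp only: sum.distrib flip: sum_divide_distrib)
  also have "\<dots> = 1" using vertex_weight_pos[OF y] by simp
  finally show ?thesis .
qed

text \<open>
  The Chapman--Kolmogorov identity for smoothed densities. Composing two averages over consecutive
  times spreads the time over three steps, which is why two consecutive smoothed densities appear.
\<close>

lemma dens_average:
  assumes x: "x \<in> V"
  shows "(\<Sum>z\<in>V. measure \<nu> {z} * dens k x z * dens m z y) = (dens (m + k) x y + dens (Suc (m + k)) x y) / 2"
proof -
  have "(\<Sum>z\<in>V. measure \<nu> {z} * dens k x z * dens m z y)
      = (\<Sum>z\<in>V. (walk k x z * walk m z y + walk k x z * walk (Suc m) z y
           + walk (Suc k) x z * walk m z y + walk (Suc k) x z * walk (Suc m) z y)
           / (4 * measure \<nu> {y}))"
  proof (intro sum.cong refl)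
    fix z assume "z \<in> V"
    then show "measure \<nu> {z} * dens k x z * dens m z y
      = (walk k x z * walk m z y + walk k x z * walk (Suc m) z y
           + walk (Suc k) x z * walk m z y + walk (Suc k) x z * walk (Suc m) z y)
           / (4 * measure \<nu> {y})"
      using measure_vertex_pos[of z] unfolding dens_eq
      by (simp add: algebra_simps add_divide_distrib)
  qed
  also have "\<dots> = (walk (k + m) x y + walk (k + Suc m) x y
       + walk (Suc k + m) x y + walk (Suc k + Suc m) x y) / (4 * measure \<nu> {y})"
    unfolding walk_add[OF x] by (simp only: sum.distrib flip: sum_divide_distrib)
  also have "\<dots> = (dens (m + k) x y + dens (Suc (m + k)) x y) / 2"
    unfolding dens_eq by (cases "measure \<nu> {y} = 0") (simp_all add: field_simps)
  finally show ?thesis .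
qed

text \<open>
  The walk is run one step from \<open>x\<close> first, so the density at the later time is a convex combination of
  densities at the earlier time over the starting points.
\<close>

lemma graph_distance_Suc_le:
  assumes p: "1 \<le> p" and c: "0 \<le> c" and le: "graph_distance p V \<mu> m \<le> ennreal c"
  shows "graph_distance p V \<mu> (Suc m) \<le> ennreal c"
  unfolding graph_distance_def
proof (rule SUP_least)
  fix x assume x: "x \<in> V"
  have "dens (Suc m) x y - 1 = (\<Sum>z\<in>V. \<mu> x z / w x * (dens m z y - 1))" for y
    by (simp add: dens_Suc right_diff_distrib sum_subtractf sum_step[OF x])
  moreover have "Lp_norm p \<nu> (\<lambda>y. \<Sum>z\<in>V. \<mu> x z / w x * (dens m z y - 1))
      \<le> ennreal (sum (\<lambda>z. \<mu> x z / w x) V * c)"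
    using p c le x by (intro Lp_norm_weighted_sum_le finite_V step_nonneg)
      (auto simp: sum_step borel_measurable_graph_measure graph_distance_def SUP_le_iff)
  ultimately show "Lp_norm p \<nu> (\<lambda>y. dens (Suc m) x y - 1) \<le> ennreal c"
    by (simp add: sum_step[OF x])
qed

lemma graph_distance_le_mono:
  assumes p: "1 \<le> p" and c: "0 \<le> c" and le: "graph_distance p V \<mu> m \<le> ennreal c" and "m \<le> n"
  shows "graph_distance p V \<mu> n \<le> ennreal c"
  using \<open>m \<le> n\<close> by (induction n rule: dec_induct) (use le graph_distance_Suc_le[OF p c] in auto)

text \<open>
  Doeblin's argument. The functions \<open>dens m z \<cdot> - 1\<close> have mean zero over the starting point \<open>z\<close> by
  stationarity, so a constant \<open>c\<close> may be subtracted from the kernel that mixes them. The remaining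
  kernel is non-negative of total mass \<open>1 - c\<close>. The lower bound is asked of the smoothed kernel,
  because on a bipartite graph the walk at a fixed time never reaches vertices of the wrong parity.
\<close>

lemma Lp_norm_dens_average_le:
  assumes p: "1 \<le> p" and D: "0 \<le> D" and le: "graph_distance p V \<mu> m \<le> ennreal D"
    and c: "c < 1" and lower: "\<And>x z. x \<in> V \<Longrightarrow> z \<in> V \<Longrightarrow> c \<le> dens k x z" and x: "x \<in> V"
  shows "Lp_norm p \<nu> (\<lambda>y. (dens (m + k) x y + dens (Suc (m + k)) x y) / 2 - 1)
           \<le> ennreal ((1 - c) * D)"
proof -
  let ?v = "\<lambda>z. measure \<nu> {z} * (dens k x z - c)"
  have sum_vertex: "(\<Sum>z\<in>V. measure \<nu> {z}) = 1"
    using total_pos by (simp add: measure_vertex flip: sum_divide_distrib)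
  have sum_v: "sum ?v V = 1 - c"
    using sum_dens_row[OF x, of k] sum_vertex
    by (simp add: right_diff_distrib sum_subtractf flip: sum_distrib_right)
  have "(dens (m + k) x y + dens (Suc (m + k)) x y) / 2 - 1 = (\<Sum>z\<in>V. ?v z * (dens m z y - 1))"
    if y: "y \<in> V" for y
  proof -
    have "(\<Sum>z\<in>V. ?v z * (dens m z y - 1))
        = (\<Sum>z\<in>V. measure \<nu> {z} * dens k x z * dens m z y)
          - c * (\<Sum>z\<in>V. measure \<nu> {z} * dens m z y) - sum ?v V"
      unfolding sum_distrib_left sum_subtractf[symmetric]
      by (intro sum.cong refl) (simp add: algebra_simps)
    then show ?thesis
      unfolding dens_average[OF x] sum_dens_column[OF y] sum_v by simp
  qed
  then have "Lp_norm p \<nu> (\<lambda>y. (dens (m + k) x y + dens (Suc (m + k)) x y) / 2 - 1)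
      = Lp_norm p \<nu> (\<lambda>y. \<Sum>z\<in>V. ?v z * (dens m z y - 1))"
    by (intro Lp_norm_cong borel_measurable_graph_measure) (simp add: space_graph_measure)
  also have "\<dots> \<le> ennreal (sum ?v V * D)"
    using p D le x c lower sum_v by (intro Lp_norm_weighted_sum_le finite_V)
      (auto simp: borel_measurable_graph_measure graph_distance_def SUP_le_iff)
  finally show ?thesis by (simp add: sum_v)
qed

lemma graph_density_of_nat: "graph_density V \<mu> (real n) x y = dens n x y"
  by (simp add: graph_density_def frac_def)

text \<open>
  At times up to one half a fixed part of the walk has not yet left its starting point.
\<close>

lemma graph_density_diagonal_lower:
  assumes s: "0 \<le> s" "s \<le> 1/2" and x: "x \<in> V"
  shows "1 / (4 * measure \<nu> {x}) \<le> graph_density V \<mu> s x x"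
proof -
  have fl: "\<lfloor>s\<rfloor> = 0" using s by (simp add: floor_eq_iff)
  have "1 / (2 * measure \<nu> {x}) \<le> dens 0 x x"
    unfolding dens_eq using walk_nonneg[OF x, of "Suc 0" x] measure_vertex_pos[OF x]
    by (simp add: field_simps)
  then have "1/2 * (1 / (2 * measure \<nu> {x})) \<le> (1 - s) * dens 0 x x"
    using s measure_vertex_pos[OF x] by (intro mult_mono) auto
  moreover have "0 \<le> s * dens (Suc 0) x x" using s dens_nonneg[OF x] by simp
  ultimately show ?thesis using fl by (simp add: graph_density_def frac_def)
qed

end

section \<open>Spectral Gromov--Hausdorff closeness\<close>

text \<open>
  The part of the spectral distance that does not involve densities, with the ambient metric space
  eliminated: \<open>C\<close> is a correspondence whose fibres are small, and the measure of a set is bounded by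
  that of its \<open>\<eta>\<close>-neighbourhood transported by \<open>C\<close>. Distances are measured in the limit space only.
\<close>

definition close_via :: "real \<Rightarrow> 'v set \<Rightarrow> 'v measure \<Rightarrow> 'f::metric_space measure \<Rightarrow> ('v \<times> 'f) set \<Rightarrow> bool" where
  "close_via \<eta> V \<nu> \<pi> C \<longleftrightarrow> correspondence V UNIV C \<and>
     (\<forall>x x' x''. (x, x') \<in> C \<longrightarrow> (x, x'') \<in> C \<longrightarrow> dist x' x'' < \<eta>) \<and>
     (\<forall>A. A \<subseteq> V \<longrightarrow> emeasure \<nu> A
        \<le> emeasure \<pi> {z. \<exists>y y'. (y, y') \<in> C \<and> y \<in> A \<and> dist y' z < \<eta>} + ennreal \<eta>) \<and>
     (\<forall>A. closed A \<longrightarrow> emeasure \<pi> A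
        \<le> emeasure \<nu> {y \<in> V. \<exists>y' z. (y, y') \<in> C \<and> z \<in> A \<and> dist y' z < \<eta>} + ennreal \<eta>)"

lemma close_viaD:
  assumes "close_via \<eta> V \<nu> \<pi> C"
  shows "correspondence V UNIV C"
    and "\<And>x x' x''. (x, x') \<in> C \<Longrightarrow> (x, x'') \<in> C \<Longrightarrow> dist x' x'' < \<eta>"
    and "\<And>A. A \<subseteq> V \<Longrightarrow> emeasure \<nu> A
        \<le> emeasure \<pi> {z. \<exists>y y'. (y, y') \<in> C \<and> y \<in> A \<and> dist y' z < \<eta>} + ennreal \<eta>"
    and "\<And>A. closed A \<Longrightarrow> emeasure \<pi> A
        \<le> emeasure \<nu> {y \<in> V. \<exists>y' z. (y, y') \<in> C \<and> z \<in> A \<and> dist y' z < \<eta>} + ennreal \<eta>"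
  using assms by (simp_all add: close_via_def)

definition densities_within :: "real \<Rightarrow> ('v \<times> 'f) set \<Rightarrow> ('v \<Rightarrow> 'v \<Rightarrow> real) \<Rightarrow> ('f \<Rightarrow> 'f \<Rightarrow> real) \<Rightarrow> bool" where
  "densities_within \<eta> C h g \<longleftrightarrow>
     (\<forall>x x' y y'. (x, x') \<in> C \<longrightarrow> (y, y') \<in> C \<longrightarrow> \<bar>h x y - g x' y'\<bar> \<le> \<eta>)"

lemma sets_metric_borel_finite:
  assumes "Metric_space V d" "finite V"
  shows "sets (metric_borel V d) = Pow V"
proof
  interpret Metric_space V d by fact
  show "sets (metric_borel V d) \<subseteq> Pow V"
    using sets.space_closed[of "metric_borel V d"] by (simp add: space_metric_borel[OF assms(1)])
  show "Pow V \<subseteq> sets (metric_borel V d)"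
  proof
    fix A assume "A \<in> Pow V"
    then have A: "A \<subseteq> V" by simp
    have "closedin mtopology (V - A)"
      using assms(2) Hausdorff_space_mtopology by (intro compactin_imp_closedin finite_imp_compactin) auto
    then have "openin mtopology (V - (V - A))" by (metis openin_diff openin_topspace topspace_mtopology)
    moreover have "V - (V - A) = A" using A by auto
    ultimately show "A \<in> sets (metric_borel V d)"
      using openin_imp_metric_borel[OF assms(1)] by metis
  qed
qed

lemma sets_metric_borel_euclidean: "sets (metric_borel (UNIV :: 'f::metric_space set) dist) = sets borel"
  by (simp add: metric_borel_def borel_of_top_def borel_def)

text \<open>
  A pair in \<open>C\<close> is at distance below \<open>\<epsilon>\<close> in the ambient space, and so is a point from the set whose
  Prohorov enlargement contains it. The triangle inequality turns the two into \<open>2 * \<epsilon>\<close>. The set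
  inequality for the limit space is stated for closed sets, whose image in the ambient space is
  compact and hence Borel.
\<close>

lemma spectral_GH_dist_lessD:
  fixes \<pi> :: "'f::metric_space measure" and V :: "'a set"
  assumes V: "Metric_space V d" "finite V" and F: "compact (UNIV :: 'f set)"
    and sets: "sets \<nu> = Pow V" "sets \<pi> = sets borel" and "0 < \<epsilon>"
    and less: "spectral_GH_dist I V d \<nu> h UNIV dist \<pi> g < ennreal \<epsilon>"
  obtains C where "close_via (2 * \<epsilon>) V \<nu> \<pi> C" "\<And>t. t \<in> I \<Longrightarrow> densities_within \<epsilon> C (h t) (g t)"
proof -
  from less obtain Z :: "('a + 'f) set" and dZ \<phi> \<phi>' C where Z: "Metric_space Z dZ"
    and \<phi>: "isometric_embedding V d Z dZ \<phi>" and \<phi>': "isometric_embedding UNIV dist Z dZ \<phi>'"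
    and C: "correspondence V UNIV C"
    and cost: "spectral_GH_cost I V \<nu> h UNIV \<pi> g Z dZ \<phi> \<phi>' C < ennreal \<epsilon>"
    unfolding spectral_GH_dist_def Inf_less_iff by blast
  interpret Z: Metric_space Z dZ by fact
  have V_sets: "sets \<nu> = sets (metric_borel V d)" using sets V by (simp add: sets_metric_borel_finite)
  have F_sets: "sets \<pi> = sets (metric_borel UNIV dist)" using sets by (simp add: sets_metric_borel_euclidean)
  have CV: "x \<in> V" if "(x, x') \<in> C" for x x' using C that by (auto simp: correspondence_def)
  have in_Z: "x \<in> V \<Longrightarrow> \<phi> x \<in> Z" "\<phi>' x' \<in> Z" for x x'
    using \<phi> \<phi>' by (auto simp: isometric_embedding_def)
  have dist': "dZ (\<phi>' x) (\<phi>' y) = dist x y" for x y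
    using \<phi>' by (auto simp: isometric_embedding_def)
  define H where "H = (SUP ((x, x'), (y, y')) \<in> C \<times> C.
          ennreal (dZ (\<phi> x) (\<phi>' x')) + ennreal (dZ (\<phi> y) (\<phi>' y'))
          + (SUP t\<in>I. ennreal \<bar>h t x y - g t x' y'\<bar>))"
  let ?\<nu> = "distr \<nu> (metric_borel Z dZ) \<phi>" and ?\<pi> = "distr \<pi> (metric_borel Z dZ) \<phi>'"
  have "H \<le> spectral_GH_cost I V \<nu> h UNIV \<pi> g Z dZ \<phi> \<phi>' C"
    "prohorov_dist Z dZ ?\<nu> ?\<pi> \<le> spectral_GH_cost I V \<nu> h UNIV \<pi> g Z dZ \<phi> \<phi>' C"
    unfolding spectral_GH_cost_def H_def by (auto intro: add_increasing add_increasing2)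
  with cost have H: "H < ennreal \<epsilon>" and pro: "prohorov_dist Z dZ ?\<nu> ?\<pi> < ennreal \<epsilon>" by auto
  have bound: "ennreal (dZ (\<phi> x) (\<phi>' x')) + ennreal (dZ (\<phi> y) (\<phi>' y'))
          + (SUP t\<in>I. ennreal \<bar>h t x y - g t x' y'\<bar>) < ennreal \<epsilon>"
    if "(x, x') \<in> C" "(y, y') \<in> C" for x x' y y'
  proof (rule le_less_trans[OF _ H])
    show "ennreal (dZ (\<phi> x) (\<phi>' x')) + ennreal (dZ (\<phi> y) (\<phi>' y'))
          + (SUP t\<in>I. ennreal \<bar>h t x y - g t x' y'\<bar>) \<le> H"
      unfolding H_def using that by (intro SUP_upper2[of "((x, x'), (y, y'))"]) auto
  qed
  have near: "dZ (\<phi> x) (\<phi>' x') < \<epsilon>" if "(x, x') \<in> C" for x x'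
  proof -
    have "ennreal (dZ (\<phi> x) (\<phi>' x')) \<le> ennreal (dZ (\<phi> x) (\<phi>' x')) + ennreal (dZ (\<phi> x) (\<phi>' x'))
          + (SUP t\<in>I. ennreal \<bar>h t x x - g t x' x'\<bar>)"
      by (simp add: add_increasing2 add.assoc)
    with bound[OF that that] have "ennreal (dZ (\<phi> x) (\<phi>' x')) < ennreal \<epsilon>" by (rule le_less_trans[rotated])
    then show ?thesis by (simp add: ennreal_less_iff)
  qed
  have dens: "densities_within \<epsilon> C (h t) (g t)" if t: "t \<in> I" for t
    unfolding densities_within_def
  proof (intro allI impI)
    fix x x' y y' assume xy: "(x, x') \<in> C" "(y, y') \<in> C"
    have "ennreal \<bar>h t x y - g t x' y'\<bar> \<le> (SUP t\<in>I. ennreal \<bar>h t x y - g t x' y'\<bar>)"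
      using t by (rule SUP_upper)
    also have "\<dots> \<le> ennreal (dZ (\<phi> x) (\<phi>' x')) + ennreal (dZ (\<phi> y) (\<phi>' y'))
          + (SUP t\<in>I. ennreal \<bar>h t x y - g t x' y'\<bar>)" by (simp add: add_increasing)
    also have "\<dots> \<le> ennreal \<epsilon>" using bound[OF xy] by simp
    finally show "\<bar>h t x y - g t x' y'\<bar> \<le> \<epsilon>" using \<open>0 < \<epsilon>\<close> by simp
  qed
  from pro obtain e where e: "0 < e" "e < \<epsilon>" and prohorov: "\<And>A. A\<in>sets (metric_borel Z dZ) \<Longrightarrow>
       emeasure ?\<nu> A \<le> emeasure ?\<pi> (enlargement Z dZ A e) + ennreal e \<and>
       emeasure ?\<pi> A \<le> emeasure ?\<nu> (enlargement Z dZ A e) + ennreal e"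
    unfolding prohorov_dist_def Inf_less_iff by (auto simp: ennreal_less_iff)
  have closed_sets: "A \<in> sets (metric_borel Z dZ)" if "closedin Z.mtopology A" for A
  proof -
    have "Z - A \<in> sets (metric_borel Z dZ)"
      using that openin_imp_metric_borel[OF Z] by (auto simp: closedin_def)
    from sets.compl_sets[OF this] show ?thesis
      using that closedin_subset[OF that] by (simp add: space_metric_borel[OF Z] double_diff)
  qed
  have mV: "emeasure ?\<nu> A = emeasure \<nu> {x \<in> V. \<phi> x \<in> A}" if "A \<in> sets (metric_borel Z dZ)" for A
    by (rule emeasure_distr_embedding[OF V(1) Z \<phi> V_sets that])
  have mF: "emeasure ?\<pi> A = emeasure \<pi> {x. \<phi>' x \<in> A}" if "A \<in> sets (metric_borel Z dZ)" for A
    using emeasure_distr_embedding[OF _ Z \<phi>' F_sets that] Met_TC.Metric_space_axioms by simp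
  note enl = openin_imp_metric_borel[OF Z openin_enlargement[OF Z]]
  have "close_via (2 * \<epsilon>) V \<nu> \<pi> C"
    unfolding close_via_def
  proof (intro conjI allI impI C)
    fix x x' x'' assume x: "(x, x') \<in> C" "(x, x'') \<in> C"
    have "dZ (\<phi>' x') (\<phi>' x'') \<le> dZ (\<phi>' x') (\<phi> x) + dZ (\<phi> x) (\<phi>' x'')"
      using in_Z CV x by (intro Z.triangle) auto
    then show "dist x' x'' < 2 * \<epsilon>"
      using near[OF x(1)] near[OF x(2)] by (simp add: dist' Z.commute dist_commute)
  next
    fix A assume A: "A \<subseteq> V"
    have "closedin Z.mtopology (\<phi> ` A)"
      using A in_Z finite_subset[OF A V(2)] Z.Hausdorff_space_mtopology
      by (intro compactin_imp_closedin finite_imp_compactin) auto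
    then have s: "\<phi> ` A \<in> sets (metric_borel Z dZ)" and sub: "\<phi> ` A \<subseteq> Z"
      using closed_sets in_Z A by auto
    have "emeasure \<nu> A \<le> emeasure \<nu> {x \<in> V. \<phi> x \<in> \<phi> ` A}"
      using A by (intro emeasure_mono) (auto simp: sets)
    also have "\<dots> \<le> emeasure \<pi> {z. \<phi>' z \<in> enlargement Z dZ (\<phi> ` A) e} + ennreal e"
      using prohorov[OF s] by (simp add: mV[OF s] mF[OF enl[OF sub]])
    also have "\<dots> \<le> emeasure \<pi> {z. \<exists>y y'. (y, y') \<in> C \<and> y \<in> A \<and> dist y' z < 2 * \<epsilon>} + ennreal (2 * \<epsilon>)"
    proof (intro add_mono emeasure_mono ennreal_leI)
      have "{z. \<exists>y y'. (y, y') \<in> C \<and> y \<in> A \<and> dist y' z < 2 * \<epsilon>}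
          = (\<Union>(y, y')\<in>C \<inter> (A \<times> UNIV). ball y' (2 * \<epsilon>))" by (auto simp: mem_ball; blast)
      moreover have "open \<dots>" by (intro open_UN) auto
      ultimately show "{z. \<exists>y y'. (y, y') \<in> C \<and> y \<in> A \<and> dist y' z < 2 * \<epsilon>} \<in> sets \<pi>"
        by (simp add: sets)
      show "{z. \<phi>' z \<in> enlargement Z dZ (\<phi> ` A) e}
          \<subseteq> {z. \<exists>y y'. (y, y') \<in> C \<and> y \<in> A \<and> dist y' z < 2 * \<epsilon>}"
      proof safe
        fix z assume "\<phi>' z \<in> enlargement Z dZ (\<phi> ` A) e"
        then obtain y where y: "y \<in> A" "dZ (\<phi> y) (\<phi>' z) < e" by (auto simp: enlargement_def)
        moreover obtain y' where y': "(y, y') \<in> C" using C y A by (force simp: correspondence_def)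
        moreover have "dZ (\<phi>' y') (\<phi>' z) \<le> dZ (\<phi>' y') (\<phi> y) + dZ (\<phi> y) (\<phi>' z)"
          using in_Z y A by (intro Z.triangle) auto
        then have "dist y' z < 2 * \<epsilon>" using near[OF y'] y e by (simp add: dist' Z.commute)
        ultimately show "\<exists>y y'. (y, y') \<in> C \<and> y \<in> A \<and> dist y' z < 2 * \<epsilon>" by blast
      qed
    qed (use e in auto)
    finally show "emeasure \<nu> A \<le> emeasure \<pi> {z. \<exists>y y'. (y, y') \<in> C \<and> y \<in> A \<and> dist y' z < 2 * \<epsilon>}
      + ennreal (2 * \<epsilon>)" .
  next
    fix A :: "'f set" assume A: "closed A"
    have "compactin euclidean A" using compact_Int_closed[OF F A] by simp
    then have "compactin Z.mtopology (\<phi>' ` A)"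
      using image_compactin isometric_embedding_continuous[OF Met_TC.Metric_space_axioms Z \<phi>']
      by (simp only: mtopology_is_euclidean) blast
    then have "closedin Z.mtopology (\<phi>' ` A)"
      by (intro compactin_imp_closedin Z.Hausdorff_space_mtopology)
    then have s: "\<phi>' ` A \<in> sets (metric_borel Z dZ)" and sub: "\<phi>' ` A \<subseteq> Z"
      using closed_sets in_Z by auto
    have "emeasure \<pi> A \<le> emeasure \<pi> {x. \<phi>' x \<in> \<phi>' ` A}"
    proof -
      have "{x. \<phi>' x \<in> \<phi>' ` A} = A"
      proof safe
        fix x y assume "\<phi>' x = \<phi>' y" "y \<in> A"
        then show "x \<in> A" using dist'[of x y] in_Z Z.zero by simp
      qed auto
      then show ?thesis by simp
    qed
    also have "\<dots> \<le> emeasure \<nu> {y \<in> V. \<phi> y \<in> enlargement Z dZ (\<phi>' ` A) e} + ennreal e"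
      using prohorov[OF s] by (simp add: mF[OF s] mV[OF enl[OF sub]])
    also have "\<dots> \<le> emeasure \<nu> {y \<in> V. \<exists>y' z. (y, y') \<in> C \<and> z \<in> A \<and> dist y' z < 2 * \<epsilon>} + ennreal (2 * \<epsilon>)"
    proof (intro add_mono emeasure_mono ennreal_leI)
      show "{y \<in> V. \<phi> y \<in> enlargement Z dZ (\<phi>' ` A) e}
          \<subseteq> {y \<in> V. \<exists>y' z. (y, y') \<in> C \<and> z \<in> A \<and> dist y' z < 2 * \<epsilon>}"
      proof safe
        fix y assume y: "y \<in> V" "\<phi> y \<in> enlargement Z dZ (\<phi>' ` A) e"
        then obtain z where z: "z \<in> A" "dZ (\<phi>' z) (\<phi> y) < e" by (auto simp: enlargement_def)
        moreover obtain y' where y': "(y, y') \<in> C" using C y by (force simp: correspondence_def)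
        moreover have "dZ (\<phi>' y') (\<phi>' z) \<le> dZ (\<phi>' y') (\<phi> y) + dZ (\<phi> y) (\<phi>' z)"
          using in_Z y by (intro Z.triangle) auto
        then have "dist y' z < 2 * \<epsilon>" using near[OF y'] z e by (simp add: dist' Z.commute)
        ultimately show "\<exists>y' z. (y, y') \<in> C \<and> z \<in> A \<and> dist y' z < 2 * \<epsilon>" by blast
      qed
    qed (use e in \<open>auto simp: sets\<close>)
    finally show "emeasure \<pi> A \<le> emeasure \<nu> {y \<in> V. \<exists>y' z. (y, y') \<in> C \<and> z \<in> A \<and> dist y' z < 2 * \<epsilon>}
      + ennreal (2 * \<epsilon>)" .
  qed
  then show thesis using dens that by blast
qed

lemma close_via_mono:
  assumes "close_via \<eta> V \<nu> \<pi> C" "\<eta> \<le> \<eta>'" and sets: "sets \<nu> = Pow V" "sets \<pi> = sets borel"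
  shows "close_via \<eta>' V \<nu> \<pi> C"
  unfolding close_via_def
proof (intro conjI allI impI)
  show "correspondence V UNIV C" using assms(1) by (simp add: close_via_def)
  show "dist x' x'' < \<eta>'" if "(x, x') \<in> C" "(x, x'') \<in> C" for x x' x''
    using assms(1,2) that unfolding close_via_def by (meson less_le_trans)
  fix A
  show "emeasure \<nu> A \<le> emeasure \<pi> {z. \<exists>y y'. (y, y') \<in> C \<and> y \<in> A \<and> dist y' z < \<eta>'} + ennreal \<eta>'"
    if "A \<subseteq> V"
  proof -
    have "emeasure \<nu> A \<le> emeasure \<pi> {z. \<exists>y y'. (y, y') \<in> C \<and> y \<in> A \<and> dist y' z < \<eta>} + ennreal \<eta>"
      using assms(1) that by (simp add: close_via_def)
    also have "\<dots> \<le> emeasure \<pi> {z. \<exists>y y'. (y, y') \<in> C \<and> y \<in> A \<and> dist y' z < \<eta>'} + ennreal \<eta>'"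
    proof (intro add_mono emeasure_mono ennreal_leI \<open>\<eta> \<le> \<eta>'\<close>)
      have "{z. \<exists>y y'. (y, y') \<in> C \<and> y \<in> A \<and> dist y' z < \<eta>'}
          = (\<Union>(y, y')\<in>C \<inter> (A \<times> UNIV). ball y' \<eta>')" by (auto simp: mem_ball; blast)
      moreover have "open \<dots>" by (intro open_UN) auto
      ultimately show "{z. \<exists>y y'. (y, y') \<in> C \<and> y \<in> A \<and> dist y' z < \<eta>'} \<in> sets \<pi>"
        by (simp add: sets)
    qed (use \<open>\<eta> \<le> \<eta>'\<close> in force)
    finally show ?thesis .
  qed
next
  fix A :: "'b set"
  assume "closed A"
  then have "emeasure \<pi> A \<le> emeasure \<nu> {y \<in> V. \<exists>y' z. (y, y') \<in> C \<and> z \<in> A \<and> dist y' z < \<eta>} + ennreal \<eta>"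
    using assms(1) by (simp add: close_via_def)
  also have "\<dots> \<le> emeasure \<nu> {y \<in> V. \<exists>y' z. (y, y') \<in> C \<and> z \<in> A \<and> dist y' z < \<eta>'} + ennreal \<eta>'"
    using \<open>\<eta> \<le> \<eta>'\<close> by (intro add_mono emeasure_mono ennreal_leI) (force simp: sets)+
  finally show "emeasure \<pi> A
      \<le> emeasure \<nu> {y \<in> V. \<exists>y' z. (y, y') \<in> C \<and> z \<in> A \<and> dist y' z < \<eta>'} + ennreal \<eta>'" .
qed

section \<open>Densities on the limit space\<close>

locale limit_space = prob_space \<pi> for \<pi> :: "'f::metric_space measure" +
  fixes q :: "real \<Rightarrow> 'f \<Rightarrow> 'f \<Rightarrow> real"
  assumes compact_F: "compact (UNIV :: 'f set)"
    and borel_pi: "sets \<pi> = sets borel"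
    and full_support: "\<And>U. open U \<Longrightarrow> U \<noteq> {} \<Longrightarrow> 0 < emeasure \<pi> U"
    and non_atomic_pi: "non_atomic \<pi>"
    and q_continuous: "jointly_continuous q"
    and q_pos: "\<And>t x y. 0 < t \<Longrightarrow> 0 < q t x y"
begin

lemma space_pi: "space \<pi> = UNIV"
  using sets_eq_imp_space_eq[OF borel_pi] by simp

lemma measure_singleton: "emeasure \<pi> {x} = 0"
proof (rule ccontr)
  assume "emeasure \<pi> {x} \<noteq> 0"
  then have "0 < emeasure \<pi> {x}" by (simp add: zero_less_iff_neq_zero)
  then obtain B where "B \<subseteq> {x}" "0 < emeasure \<pi> B" "emeasure \<pi> B < emeasure \<pi> {x}"
    using non_atomic_pi by (force simp: non_atomic_def borel_pi)
  then show False by (cases "B = {}") (auto simp: subset_singleton_iff)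
qed

lemma small_ball:
  assumes "0 < c"
  obtains r where "0 < r" "emeasure \<pi> (ball x r) < ennreal c"
proof -
  define B where "B n = ball x (1 / real (Suc n))" for n
  have dec: "decseq B" unfolding B_def by (intro decseq_SucI subset_ball) (simp add: frac_le)
  have "(\<Inter>n. B n) = {x}"
  proof (intro equalityI subsetI)
    fix y assume y: "y \<in> (\<Inter>n. B n)"
    have "dist x y < e" if e: "0 < e" for e
    proof -
      obtain n where "inverse (real (Suc n)) < e" using reals_Archimedean[OF e] by blast
      moreover have "y \<in> B n" using y by blast
      then have "dist x y < 1 / real (Suc n)" by (simp add: B_def)
      ultimately show ?thesis by (simp add: divide_inverse)
    qed
    from this[of "dist x y"] show "y \<in> {x}" by auto
  qed (auto simp: B_def)
  then have "(\<lambda>n. emeasure \<pi> (B n)) \<longlonglongrightarrow> 0"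
  proof -
    have "range B \<subseteq> sets \<pi>" by (auto simp: B_def borel_pi)
    from Lim_emeasure_decseq[OF this dec] \<open>(\<Inter>n. B n) = {x}\<close> show ?thesis
      by (simp add: measure_singleton)
  qed
  then have "\<forall>\<^sub>F n in sequentially. emeasure \<pi> (B n) < ennreal c"
    using assms by (intro order_tendstoD(2)) auto
  then obtain n where "emeasure \<pi> (B n) < ennreal c" by (auto simp: eventually_sequentially)
  then show thesis by (intro that[of "1 / real (Suc n)"]) (auto simp: B_def)
qed

text \<open>
  Times are kept in a compact interval away from \<open>0\<close>, where the density may be singular.
\<close>

lemma uniformly_continuous_density:
  assumes "0 < a" "0 < \<eta>"
  obtains \<delta> where "0 < \<delta>"
    and "\<And>s t x y x' y'. s \<in> {a..b} \<Longrightarrow> t \<in> {a..b} \<Longrightarrow> dist s t < \<delta> \<Longrightarrow> dist x x' < \<delta> \<Longrightarrow>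
           dist y y' < \<delta> \<Longrightarrow> \<bar>q s x y - q t x' y'\<bar> < \<eta>"
proof -
  let ?S = "{a..b} \<times> (UNIV :: 'f set) \<times> (UNIV :: 'f set)"
  have "compact ?S" by (intro compact_Times compact_F compact_Icc)
  moreover have "continuous_on ?S (\<lambda>(t, x, y). q t x y)"
    using q_continuous unfolding jointly_continuous_def
    by (rule continuous_on_subset) (use \<open>0 < a\<close> in auto)
  ultimately have "uniformly_continuous_on ?S (\<lambda>(t, x, y). q t x y)"
    by (rule compact_uniformly_continuous[rotated])
  then obtain \<delta> where \<delta>: "0 < \<delta>" "\<And>u v. u \<in> ?S \<Longrightarrow> v \<in> ?S \<Longrightarrow> dist u v < \<delta> \<Longrightarrow>
      dist ((\<lambda>(t, x, y). q t x y) u) ((\<lambda>(t, x, y). q t x y) v) < \<eta>"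
    using \<open>0 < \<eta>\<close> unfolding uniformly_continuous_on_def by (metis dist_commute)
  show thesis
  proof (rule that)
    show "0 < \<delta> / 3" using \<delta> by simp
    fix s t and x y x' y' :: 'f
    assume st: "s \<in> {a..b}" "t \<in> {a..b}" and d: "dist s t < \<delta> / 3" "dist x x' < \<delta> / 3" "dist y y' < \<delta> / 3"
    have "dist (s, x, y) (t, x', y') \<le> dist s t + dist (x, y) (x', y')"
      unfolding dist_Pair_Pair by (intro sqrt_sum_squares_le_sum) auto
    also have "dist (x, y) (x', y') \<le> dist x x' + dist y y'"
      unfolding dist_Pair_Pair by (intro sqrt_sum_squares_le_sum) auto
    finally have "dist (s, x, y) (t, x', y') < \<delta>" using d by linarith
    with \<delta>(2)[of "(s, x, y)" "(t, x', y')"] st show "\<bar>q s x y - q t x' y'\<bar> < \<eta>"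
      by (auto simp: dist_real_def)
  qed
qed

lemma continuous_density: "0 < t \<Longrightarrow> continuous_on UNIV (q t x)"
proof -
  assume t: "0 < t"
  have "continuous_on UNIV (\<lambda>y. (\<lambda>(t, x, y). q t x y) (t, x, y))"
    using q_continuous[unfolded jointly_continuous_def]
    by (rule continuous_on_compose2) (use t in \<open>auto intro!: continuous_on_Pair continuous_on_const continuous_on_id\<close>)
  then show ?thesis by simp
qed

lemma borel_measurable_density: "0 < t \<Longrightarrow> (\<lambda>y. q t x y - 1) \<in> borel_measurable \<pi>"
proof -
  assume "0 < t"
  then have "(\<lambda>y. q t x y - 1) \<in> borel_measurable borel"
    by (intro borel_measurable_continuous_onI continuous_intros continuous_density)
  then show ?thesis by (simp add: measurable_cong_sets[OF borel_pi refl])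
qed

lemma density_bounds:
  assumes "0 < t"
  obtains c K where "0 < c" "c < 1" "0 \<le> K" "\<And>x y. c \<le> q t x y" "\<And>x y. \<bar>q t x y - 1\<bar> \<le> K"
proof -
  have cont: "continuous_on UNIV (\<lambda>(x, y). q t x y)"
  proof -
    have "continuous_on UNIV (\<lambda>z. (\<lambda>(t, x, y). q t x y) (t, z))"
      using q_continuous[unfolded jointly_continuous_def]
      by (rule continuous_on_compose2) (use assms in \<open>auto intro!: continuous_on_Pair continuous_on_const continuous_on_id\<close>)
    then show ?thesis by simp
  qed
  have comp: "compact (UNIV :: ('f \<times> 'f) set)"
    using compact_Times[OF compact_F compact_F] by simp
  obtain u where u: "\<And>z. (\<lambda>(x, y). q t x y) u \<le> (\<lambda>(x, y). q t x y) z"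
    using continuous_attains_inf[OF comp _ cont] by auto
  obtain v where v: "\<And>z. (\<lambda>(x, y). q t x y) z \<le> (\<lambda>(x, y). q t x y) v"
    using continuous_attains_sup[OF comp _ cont] by auto
  let ?c = "min (1/2) ((\<lambda>(x, y). q t x y) u)" and ?K = "1 + (\<lambda>(x, y). q t x y) v"
  have pos: "0 < (\<lambda>(x, y). q t x y) z" for z using q_pos[OF assms] by (cases z) auto
  show thesis
  proof (rule that[of ?c ?K])
    show "?c \<le> q t x y" for x y using u[of "(x, y)"] by simp
    show "\<bar>q t x y - 1\<bar> \<le> ?K" for x y using v[of "(x, y)"] q_pos[OF assms, of x y] by simp
  qed (use pos[of u] pos[of v] in auto)
qed

definition distance :: "ennreal \<Rightarrow> real \<Rightarrow> ennreal" where
  "distance p t = (SUP x. Lp_norm p \<pi> (\<lambda>y. q t x y - 1))"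

lemma distance_finite:
  assumes "1 \<le> p" "0 < t"
  shows "distance p t < \<infinity>"
proof -
  obtain K where K: "0 \<le> K" "\<And>x y. \<bar>q t x y - 1\<bar> \<le> K" using density_bounds[OF assms(2)] by metis
  have "distance p t \<le> ennreal K"
    unfolding distance_def using K assms borel_measurable_density prob_space_axioms
    by (intro SUP_least Lp_norm_le_bound) auto
  then show ?thesis by (rule le_less_trans) simp
qed

text \<open>
  Across the correspondence \<open>h x \<cdot> - 1\<close> and \<open>q t x' \<cdot> - 1\<close> differ little, and the latter varies little
  on small balls. A transported neighbourhood of a superlevel set of one of them therefore lies in a
  slightly lower superlevel set of the other. For the exponent \<open>\<infinity>\<close>, almost everywhere bounds hold
  everywhere on both sides, by full support and continuity on the limit space and because vertices are
  atoms, and the correspondence carries them over. The density \<open>h\<close> is arbitrary so that it can also be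
  an average over consecutive times.
\<close>

lemma Lp_norms_close:
  assumes p: "1 \<le> p" and t: "0 < t" and "0 < \<kappa>"
  obtains \<eta> where "0 < \<eta>"
    and "\<And>(V :: 'v set) \<mu> C h x x'. finite_walk V \<mu> \<Longrightarrow> close_via \<eta> V (graph_measure V \<mu>) \<pi> C \<Longrightarrow>
      densities_within \<eta> C h (q t) \<Longrightarrow> (x, x') \<in> C \<Longrightarrow>
      Lp_norm p (graph_measure V \<mu>) (\<lambda>y. h x y - 1) \<le> Lp_norm p \<pi> (\<lambda>y. q t x' y - 1) + ennreal \<kappa> \<and>
      Lp_norm p \<pi> (\<lambda>y. q t x' y - 1) \<le> Lp_norm p (graph_measure V \<mu>) (\<lambda>y. h x y - 1) + ennreal \<kappa>"
proof -
  obtain K where K: "0 \<le> K" "\<And>x y. \<bar>q t x y - 1\<bar> \<le> K" using density_bounds[OF t] by metis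
  then have K1: "0 \<le> K + 1" by simp
  obtain \<eta>1 where \<eta>1: "0 < \<eta>1" and
    compare1: "\<And>(M :: 'v measure) (M' :: 'f measure) f g.
        prob_space M \<Longrightarrow> prob_space M' \<Longrightarrow> f \<in> borel_measurable M \<Longrightarrow> g \<in> borel_measurable M' \<Longrightarrow>
        (\<And>x. x \<in> space M \<Longrightarrow> \<bar>f x\<bar> \<le> K + 1) \<Longrightarrow> (\<And>x. x \<in> space M' \<Longrightarrow> \<bar>g x\<bar> \<le> K + 1) \<Longrightarrow>
        tails_dominated \<eta>1 M f M' g \<Longrightarrow>
        Lp_norm p M f \<le> Lp_norm p M' g + ennreal \<kappa>"
    using Lp_norm_le_of_tails[OF p K1 \<open>0 < \<kappa>\<close>] by blast
  obtain \<eta>2 where \<eta>2: "0 < \<eta>2" and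
    compare2: "\<And>(M :: 'f measure) (M' :: 'v measure) f g.
        prob_space M \<Longrightarrow> prob_space M' \<Longrightarrow> f \<in> borel_measurable M \<Longrightarrow> g \<in> borel_measurable M' \<Longrightarrow>
        (\<And>x. x \<in> space M \<Longrightarrow> \<bar>f x\<bar> \<le> K + 1) \<Longrightarrow> (\<And>x. x \<in> space M' \<Longrightarrow> \<bar>g x\<bar> \<le> K + 1) \<Longrightarrow>
        tails_dominated \<eta>2 M f M' g \<Longrightarrow>
        Lp_norm p M f \<le> Lp_norm p M' g + ennreal \<kappa>"
    using Lp_norm_le_of_tails[OF p K1 \<open>0 < \<kappa>\<close>] by blast
  define \<eta>0 where "\<eta>0 = min \<eta>1 \<eta>2 / 2"
  have \<eta>0: "0 < \<eta>0" "2 * \<eta>0 \<le> \<eta>1" "2 * \<eta>0 \<le> \<eta>2" using \<eta>1 \<eta>2 by (auto simp: \<eta>0_def)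
  obtain \<delta> where \<delta>: "0 < \<delta>" and q_close: "\<And>x y z. dist y z < \<delta> \<Longrightarrow> \<bar>q t x y - q t x z\<bar> < \<eta>0"
  proof -
    obtain \<delta> where "0 < \<delta>" and *: "\<And>s t' x y x' y'. s \<in> {t..t} \<Longrightarrow> t' \<in> {t..t} \<Longrightarrow> dist s t' < \<delta> \<Longrightarrow>
        dist x x' < \<delta> \<Longrightarrow> dist y y' < \<delta> \<Longrightarrow> \<bar>q s x y - q t' x' y'\<bar> < \<eta>0"
      using uniformly_continuous_density[OF t \<eta>0(1), of t] by metis
    then show thesis using *[of t t] by (intro that[of \<delta>]) auto
  qed
  define \<eta> where "\<eta> = min \<delta> (min \<eta>0 1)"
  have \<eta>: "0 < \<eta>" "\<eta> \<le> \<delta>" "\<eta> \<le> \<eta>0" "\<eta> \<le> 1" using \<delta> \<eta>0 by (auto simp: \<eta>_def)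
  show thesis
  proof (rule that[OF \<eta>(1)])
    fix V :: "'v set" and \<mu> C h x x'
    assume "finite_walk V \<mu>" and close: "close_via \<eta> V (graph_measure V \<mu>) \<pi> C"
      and dens: "densities_within \<eta> C h (q t)" and x: "(x, x') \<in> C"
    interpret finite_walk V \<mu> by fact
    define f where "f = (\<lambda>y. h x y - 1)"
    define g where "g = (\<lambda>y. q t x' y - 1)"
    have g_meas[measurable]: "g \<in> borel_measurable \<pi>" unfolding g_def by (rule borel_measurable_density[OF t])
    have fg: "\<bar>f y - g y'\<bar> \<le> \<eta>" if "(y, y') \<in> C" for y y'
      using dens x that unfolding densities_within_def f_def g_def by fastforce
    have gg: "\<bar>g y - g z\<bar> < \<eta>0" if "dist y z < \<eta>" for y z
      using q_close[of y z x'] that \<eta> by (simp add: g_def)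
    have gK: "\<bar>g y\<bar> \<le> K + 1" for y using K(2)[of x' y] by (simp add: g_def)
    have proj: "fst ` C = V" "snd ` C = UNIV"
      using close_viaD(1)[OF close] by (simp_all add: correspondence_def)
    have corr: "\<exists>y'. (y, y') \<in> C" if "y \<in> V" for y
      using that unfolding proj(1)[symmetric] by force
    have corr': "\<exists>y\<in>V. (y, z) \<in> C" for z
    proof -
      have "z \<in> snd ` C" by (simp add: proj)
      then show ?thesis unfolding proj(1)[symmetric] by force
    qed
    have fK: "\<bar>f y\<bar> \<le> K + 1" if y: "y \<in> V" for y
    proof -
      obtain y' where "(y, y') \<in> C" using corr[OF y] by blast
      then show ?thesis using fg[of y y'] K(2)[of x' y'] \<eta> unfolding g_def by linarith
    qed
    have "tails_dominated \<eta>1 \<nu> f \<pi> g"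
      unfolding tails_dominated_def
    proof (intro conjI allI impI)
      fix r
      have "emeasure \<nu> {y \<in> V. r \<le> \<bar>f y\<bar>}
          \<le> emeasure \<pi> {z. \<exists>y y'. (y, y') \<in> C \<and> y \<in> {y \<in> V. r \<le> \<bar>f y\<bar>} \<and> dist y' z < \<eta>} + ennreal \<eta>"
        by (intro close_viaD(3)[OF close]) auto
      also have "\<dots> \<le> emeasure \<pi> {z. r \<le> \<bar>g z\<bar> + \<eta>1} + ennreal \<eta>1"
      proof (intro add_mono emeasure_mono ennreal_leI subsetI)
        fix z assume "z \<in> {z. \<exists>y y'. (y, y') \<in> C \<and> y \<in> {y \<in> V. r \<le> \<bar>f y\<bar>} \<and> dist y' z < \<eta>}"
        then obtain y y' where "(y, y') \<in> C" "r \<le> \<bar>f y\<bar>" "dist y' z < \<eta>" by blast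
        then have "r \<le> \<bar>g z\<bar> + \<eta>1" using fg[of y y'] gg[of y' z] \<eta> \<eta>0 by linarith
        then show "z \<in> {z. r \<le> \<bar>g z\<bar> + \<eta>1}" by simp
      next
        have "{z \<in> space \<pi>. r \<le> \<bar>g z\<bar> + \<eta>1} \<in> sets \<pi>" by measurable
        then show "{z. r \<le> \<bar>g z\<bar> + \<eta>1} \<in> sets \<pi>" by (simp add: space_pi)
      qed (use \<eta> \<eta>0 in auto)
      finally show "emeasure \<nu> {y \<in> space \<nu>. r \<le> \<bar>f y\<bar>}
          \<le> emeasure \<pi> {z \<in> space \<pi>. r \<le> \<bar>g z\<bar> + \<eta>1} + ennreal \<eta>1"
        by (simp add: space_pi space_graph_measure)
    next
      fix c assume AE: "AE z in \<pi>. \<bar>g z\<bar> \<le> c"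
      have g_le: "\<bar>g z\<bar> \<le> c" for z
      proof (rule ccontr)
        assume "\<not> \<bar>g z\<bar> \<le> c"
        moreover have "open {z. c < \<bar>g z\<bar>}"
          unfolding g_def using continuous_density[OF t] by (intro open_Collect_less continuous_intros) auto
        ultimately have "0 < emeasure \<pi> {z. c < \<bar>g z\<bar>}"
          by (intro full_support) (auto simp: not_le)
        moreover have "emeasure \<pi> {z. c < \<bar>g z\<bar>} = 0"
          using AE \<open>open _\<close> borel_pi by (subst (asm) AE_iff_measurable[of "{z. c < \<bar>g z\<bar>}"])
            (auto simp: space_pi not_le)
        ultimately show False by simp
      qed
      show "AE y in \<nu>. \<bar>f y\<bar> \<le> c + \<eta>1"
        unfolding AE_graph_measure
      proof
        fix y assume "y \<in> V"
        then obtain y' where "(y, y') \<in> C" using corr by blast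
        then show "\<bar>f y\<bar> \<le> c + \<eta>1" using g_le[of y'] fg[of y y'] \<eta> \<eta>0 by linarith
      qed
    qed
    then have "Lp_norm p \<nu> f \<le> Lp_norm p \<pi> g + ennreal \<kappa>"
      by (intro compare1 gK fK prob_space_graph_measure prob_space_axioms borel_measurable_graph_measure g_meas)
        (simp add: space_graph_measure)
    have "tails_dominated \<eta>2 \<pi> g \<nu> f"
      unfolding tails_dominated_def
    proof (intro conjI allI impI)
      fix r
      have "closed {z. r \<le> \<bar>g z\<bar>}"
        unfolding g_def using continuous_density[OF t] by (intro closed_Collect_le continuous_intros) auto
      then have "emeasure \<pi> {z. r \<le> \<bar>g z\<bar>}
          \<le> emeasure \<nu> {y \<in> V. \<exists>y' z. (y, y') \<in> C \<and> z \<in> {z. r \<le> \<bar>g z\<bar>} \<and> dist y' z < \<eta>} + ennreal \<eta>"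
        by (intro close_viaD(4)[OF close])
      also have "\<dots> \<le> emeasure \<nu> {y \<in> V. r \<le> \<bar>f y\<bar> + \<eta>2} + ennreal \<eta>2"
      proof (intro add_mono emeasure_mono ennreal_leI subsetI)
        fix y assume "y \<in> {y \<in> V. \<exists>y' z. (y, y') \<in> C \<and> z \<in> {z. r \<le> \<bar>g z\<bar>} \<and> dist y' z < \<eta>}"
        then obtain y' z where "(y, y') \<in> C" "r \<le> \<bar>g z\<bar>" "dist y' z < \<eta>" "y \<in> V" by blast
        then have "r \<le> \<bar>f y\<bar> + \<eta>2" using fg[of y y'] gg[of y' z] \<eta> \<eta>0 by linarith
        then show "y \<in> {y \<in> V. r \<le> \<bar>f y\<bar> + \<eta>2}" using \<open>y \<in> V\<close> by simp
      qed (use \<eta> \<eta>0 in \<open>auto simp: sets_graph_measure\<close>)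
      finally show "emeasure \<pi> {z \<in> space \<pi>. r \<le> \<bar>g z\<bar>}
          \<le> emeasure \<nu> {y \<in> space \<nu>. r \<le> \<bar>f y\<bar> + \<eta>2} + ennreal \<eta>2"
        by (simp add: space_pi space_graph_measure)
    next
      fix c assume "AE y in \<nu>. \<bar>f y\<bar> \<le> c"
      then have fc: "\<bar>f y\<bar> \<le> c" if "y \<in> V" for y using that by (simp add: AE_graph_measure)
      have "\<bar>g z\<bar> \<le> c + \<eta>2" for z
      proof -
        obtain y where "(y, z) \<in> C" "y \<in> V" using corr' by blast
        then show ?thesis using fc[of y] fg[of y z] \<eta> \<eta>0 by linarith
      qed
      then show "AE z in \<pi>. \<bar>g z\<bar> \<le> c + \<eta>2" by simp
    qed
    then have "Lp_norm p \<pi> g \<le> Lp_norm p \<nu> f + ennreal \<kappa>"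
      by (intro compare2 gK fK prob_space_graph_measure prob_space_axioms borel_measurable_graph_measure g_meas)
        (simp add: space_graph_measure)
    with \<open>Lp_norm p \<nu> f \<le> _\<close> show "Lp_norm p \<nu> (\<lambda>y. h x y - 1) \<le> Lp_norm p \<pi> (\<lambda>y. q t x' y - 1) + ennreal \<kappa> \<and>
        Lp_norm p \<pi> (\<lambda>y. q t x' y - 1) \<le> Lp_norm p \<nu> (\<lambda>y. h x y - 1) + ennreal \<kappa>"
      by (simp add: f_def g_def)
  qed
qed

end

section \<open>Convergence of the distances to stationarity\<close>

lemma tendsto_floor_scaled:
  fixes \<gamma> :: "nat \<Rightarrow> real"
  assumes \<gamma>: "filterlim \<gamma> at_top sequentially" and "0 \<le> t"
  shows "(\<lambda>N. real (nat \<lfloor>\<gamma> N * t\<rfloor>) / \<gamma> N) \<longlonglongrightarrow> t"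
proof (rule tendsto_sandwich)
  have pos: "\<forall>\<^sub>F N in sequentially. 0 < \<gamma> N" using \<gamma> by (simp add: filterlim_at_top_dense)
  then show "\<forall>\<^sub>F N in sequentially. t - 1 / \<gamma> N \<le> real (nat \<lfloor>\<gamma> N * t\<rfloor>) / \<gamma> N"
  proof eventually_elim
    case (elim N)
    have "\<gamma> N * t - 1 \<le> real (nat \<lfloor>\<gamma> N * t\<rfloor>)" by linarith
    then have "(\<gamma> N * t - 1) / \<gamma> N \<le> real (nat \<lfloor>\<gamma> N * t\<rfloor>) / \<gamma> N"
      using elim by (intro divide_right_mono) auto
    then show ?case using elim by (simp add: diff_divide_distrib)
  qed
  from pos show "\<forall>\<^sub>F N in sequentially. real (nat \<lfloor>\<gamma> N * t\<rfloor>) / \<gamma> N \<le> t"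
  proof eventually_elim
    case (elim N)
    then have "real (nat \<lfloor>\<gamma> N * t\<rfloor>) \<le> \<gamma> N * t" using \<open>0 \<le> t\<close> by simp
    then show ?case using elim by (simp add: divide_le_eq mult.commute)
  qed
  have "((\<lambda>N. 1 / \<gamma> N) \<longlongrightarrow> 0) sequentially"
    using tendsto_inverse_0_at_top[OF \<gamma>] by (simp add: inverse_eq_divide)
  from tendsto_diff[OF tendsto_const this, of t] show "(\<lambda>N. t - 1 / \<gamma> N) \<longlonglongrightarrow> t" by simp
qed simp

locale converging_graphs = limit_space \<pi> q
  for \<pi> :: "'f::metric_space measure" and q :: "real \<Rightarrow> 'f \<Rightarrow> 'f \<Rightarrow> real" +
  fixes V :: "nat \<Rightarrow> 'v set" and \<mu> :: "nat \<Rightarrow> 'v \<Rightarrow> 'v \<Rightarrow> real"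
    and d :: "nat \<Rightarrow> 'v \<Rightarrow> 'v \<Rightarrow> real" and \<gamma> :: "nat \<Rightarrow> real"
  assumes walk: "\<And>N. 1 \<le> N \<Longrightarrow> finite_walk (V N) (\<mu> N)"
    and metric: "\<And>N. 1 \<le> N \<Longrightarrow> Metric_space (V N) (d N)"
    and gamma_pos: "\<And>N. 1 \<le> N \<Longrightarrow> 0 < \<gamma> N"
    and spectral_GH_convergence: "\<And>a b. 0 < a \<Longrightarrow> a \<le> b \<Longrightarrow>
          (\<lambda>N. spectral_GH_dist {a..b}
             (V N) (d N) (graph_measure (V N) (\<mu> N)) (\<lambda>t. graph_density (V N) (\<mu> N) (\<gamma> N * t))
             UNIV dist \<pi> q) \<longlonglongrightarrow> 0"
begin

abbreviation close :: "real \<Rightarrow> nat \<Rightarrow> ('v \<times> 'f) set \<Rightarrow> bool" where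
  "close \<eta> N \<equiv> close_via \<eta> (V N) (graph_measure (V N) (\<mu> N)) \<pi>"

lemma eventually_ge_1: "\<forall>\<^sub>F N in sequentially. 1 \<le> (N::nat)"
  by (rule eventually_ge_at_top)

lemma eventually_close:
  assumes "0 < a" "a \<le> b" "0 < \<eta>"
  shows "\<forall>\<^sub>F N in sequentially. \<exists>C. close \<eta> N C \<and>
    (\<forall>t\<in>{a..b}. densities_within \<eta> C (graph_density (V N) (\<mu> N) (\<gamma> N * t)) (q t))"
proof -
  have "\<forall>\<^sub>F N in sequentially. spectral_GH_dist {a..b}
      (V N) (d N) (graph_measure (V N) (\<mu> N)) (\<lambda>t. graph_density (V N) (\<mu> N) (\<gamma> N * t))
      UNIV dist \<pi> q < ennreal (\<eta> / 2)"
    using assms by (intro order_tendstoD(2)[OF spectral_GH_convergence]) auto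
  with eventually_ge_1 show ?thesis
  proof eventually_elim
    case (elim N)
    interpret finite_walk "V N" "\<mu> N" using walk elim by simp
    obtain C where C: "close_via (2 * (\<eta> / 2)) (V N) \<nu> \<pi> C"
      and within: "\<And>t. t \<in> {a..b} \<Longrightarrow>
        densities_within (\<eta> / 2) C (graph_density (V N) (\<mu> N) (\<gamma> N * t)) (q t)"
      using spectral_GH_dist_lessD[OF metric finite_V compact_F sets_graph_measure borel_pi _ elim(2)]
        elim(1) assms(3) by (metis half_gt_zero)
    from within have "densities_within \<eta> C (graph_density (V N) (\<mu> N) (\<gamma> N * t)) (q t)"
      if "t \<in> {a..b}" for t
      using that \<open>0 < \<eta>\<close> unfolding densities_within_def by (smt (verit, best) field_sum_of_halves)
    with C show ?case by auto
  qed
qed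

text \<open>
  If \<open>\<gamma>\<close> stayed below \<open>K\<close> along a subsequence, then at the fixed time \<open>t = 1 / (2 * K)\<close> the walk would
  have made at most half a step. Its density on the diagonal would be at least a quarter of the inverse
  mass of the vertex, while it converges to the finite number \<open>q t x0 x0\<close>. So vertices close to \<open>x0\<close>
  would have mass bounded below, and in the limit so would all balls around \<open>x0\<close>, which is impossible
  as \<open>\<pi>\<close> has no atoms.
\<close>

lemma gamma_at_top: "filterlim \<gamma> at_top sequentially"
proof (rule ccontr)
  assume "\<not> filterlim \<gamma> at_top sequentially"
  then obtain K where "\<not> (\<forall>\<^sub>F N in sequentially. K \<le> \<gamma> N)" by (auto simp: filterlim_at_top)
  then have freq: "\<exists>\<^sub>F N in sequentially. \<gamma> N < K" by (simp add: frequently_def not_less)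
  then obtain N where "\<gamma> N < K" "1 \<le> N"
    using frequently_eventually_frequently[OF freq eventually_ge_1] by (auto dest: frequently_ex)
  then have K: "0 < K" using gamma_pos[of N] by simp
  define t where "t = 1 / (2 * K)"
  have t: "0 < t" using K by (simp add: t_def)
  fix x0 :: 'f
  define c where "c = 1 / (4 * (q t x0 x0 + 1))"
  have c: "0 < c" using q_pos[OF t, of x0 x0] by (simp add: c_def add_pos_pos)
  obtain r where r: "0 < r" "emeasure \<pi> (ball x0 r) < ennreal (c / 2)"
    using small_ball[of "c / 2"] c by auto
  define \<epsilon> where "\<epsilon> = min 1 (min (r / 2) (c / 2))"
  have \<epsilon>: "0 < \<epsilon>" "\<epsilon> \<le> 1" "\<epsilon> \<le> r / 2" "\<epsilon> \<le> c / 2" using r c by (auto simp: \<epsilon>_def)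
  obtain N where N: "\<gamma> N < K" "1 \<le> N" and "\<exists>C. close \<epsilon> N C \<and>
    (\<forall>t\<in>{t..t}. densities_within \<epsilon> C (graph_density (V N) (\<mu> N) (\<gamma> N * t)) (q t))"
    using frequently_ex[OF frequently_eventually_frequently[OF freq
        eventually_conj[OF eventually_ge_1 eventually_close[OF t order_refl \<epsilon>(1)]]]]
    by blast
  then obtain C where C: "close \<epsilon> N C"
    and within: "densities_within \<epsilon> C (graph_density (V N) (\<mu> N) (\<gamma> N * t)) (q t)" by auto
  interpret finite_walk "V N" "\<mu> N" using walk N by simp
  have proj: "fst ` C = V N" "snd ` C = UNIV" using close_viaD(1)[OF C] by (auto simp: correspondence_def)
  have "x0 \<in> snd ` C" using proj by simp
  then obtain x where x: "(x, x0) \<in> C" by auto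
  then have xV: "x \<in> V N" using proj by force
  have "1 / (4 * measure \<nu> {x}) \<le> graph_density (V N) (\<mu> N) (\<gamma> N * t) x x"
    using N K gamma_pos[of N] t xV by (intro graph_density_diagonal_lower) (auto simp: t_def field_simps)
  also have "\<dots> \<le> q t x0 x0 + 1"
    using within x \<epsilon> unfolding densities_within_def by fastforce
  finally have "c \<le> measure \<nu> {x}"
    using measure_vertex_pos[OF xV] q_pos[OF t, of x0 x0] by (simp add: c_def field_simps)
  then have "ennreal c \<le> emeasure \<nu> {x}"
    using prob_space_graph_measure by (simp add: finite_measure.emeasure_eq_measure prob_space.axioms ennreal_leI)
  also have "\<dots> \<le> emeasure \<pi> {z. \<exists>y y'. (y, y') \<in> C \<and> y \<in> {x} \<and> dist y' z < \<epsilon>} + ennreal \<epsilon>"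
    using xV by (intro close_viaD(3)[OF C]) auto
  also have "\<dots> \<le> emeasure \<pi> (ball x0 r) + ennreal \<epsilon>"
  proof (intro add_mono emeasure_mono subsetI)
    fix z assume "z \<in> {z. \<exists>y y'. (y, y') \<in> C \<and> y \<in> {x} \<and> dist y' z < \<epsilon>}"
    then obtain y' where "(x, y') \<in> C" "dist y' z < \<epsilon>" by auto
    moreover from this have "dist x0 y' < \<epsilon>" using close_viaD(2)[OF C x] by blast
    moreover have "dist x0 z \<le> dist x0 y' + dist y' z" by (rule dist_triangle)
    ultimately have "dist x0 z < r" using \<epsilon> by linarith
    then show "z \<in> ball x0 r" by simp
  qed (auto simp: borel_pi)
  also have "\<dots> = ennreal (prob (ball x0 r) + \<epsilon>)"
    using \<epsilon> by (simp add: emeasure_eq_measure)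
  also have "\<dots> < ennreal c"
    using r \<epsilon> c by (intro ennreal_lessI) (auto simp: emeasure_eq_measure ennreal_less_iff)
  finally show False by simp
qed

lemma eventually_densities_near:
  assumes "0 < t" "0 < \<eta>"
  obtains \<delta> where "0 < \<delta>" and "\<forall>\<^sub>F N in sequentially. \<exists>C. close \<eta> N C \<and>
    (\<forall>s. \<bar>s - t\<bar> < \<delta> \<longrightarrow> densities_within \<eta> C (graph_density (V N) (\<mu> N) (\<gamma> N * s)) (q t))"
proof -
  let ?a = "t / 2" and ?b = "2 * t"
  obtain \<delta> where \<delta>: "0 < \<delta>" and
    uc: "\<And>s s' x y x' y'. s \<in> {?a..?b} \<Longrightarrow> s' \<in> {?a..?b} \<Longrightarrow> dist s s' < \<delta> \<Longrightarrow> dist x x' < \<delta> \<Longrightarrow>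
           dist y y' < \<delta> \<Longrightarrow> \<bar>q s x y - q s' x' y'\<bar> < \<eta> / 2"
    using uniformly_continuous_density[of ?a "\<eta> / 2" ?b] assms by (metis half_gt_zero)
  have "\<forall>\<^sub>F N in sequentially. \<exists>C. close (\<eta> / 2) N C \<and>
    (\<forall>s\<in>{?a..?b}. densities_within (\<eta> / 2) C (graph_density (V N) (\<mu> N) (\<gamma> N * s)) (q s))"
    using assms by (intro eventually_close) auto
  with eventually_ge_1 have "\<forall>\<^sub>F N in sequentially. \<exists>C. close \<eta> N C \<and> (\<forall>s. \<bar>s - t\<bar> < min \<delta> (t / 2) \<longrightarrow>
      densities_within \<eta> C (graph_density (V N) (\<mu> N) (\<gamma> N * s)) (q t))"
  proof eventually_elim
    case (elim N)
    interpret finite_walk "V N" "\<mu> N" using walk elim by simp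
    obtain C where C: "close (\<eta> / 2) N C" and within: "\<And>s. s\<in>{?a..?b} \<Longrightarrow>
        densities_within (\<eta> / 2) C (graph_density (V N) (\<mu> N) (\<gamma> N * s)) (q s)"
      using elim by blast
    have "close \<eta> N C"
      using close_via_mono[OF C _ sets_graph_measure borel_pi] assms by simp
    moreover have "densities_within \<eta> C (graph_density (V N) (\<mu> N) (\<gamma> N * s)) (q t)"
      if s: "\<bar>s - t\<bar> < min \<delta> (t / 2)" for s
      unfolding densities_within_def
    proof (intro allI impI)
      fix x x' y y' assume xy: "(x, x') \<in> C" "(y, y') \<in> C"
      have "\<bar>s - t\<bar> < t / 2" using s by simp
      then have sI: "s \<in> {?a..?b}" unfolding abs_less_iff atLeastAtMost_iff by linarith
      have "\<bar>graph_density (V N) (\<mu> N) (\<gamma> N * s) x y - q s x' y'\<bar> \<le> \<eta> / 2"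
        using within[OF sI] xy unfolding densities_within_def by blast
      moreover have "\<bar>q s x' y' - q t x' y'\<bar> < \<eta> / 2"
        using uc[OF sI, of t x' x' y' y'] s assms \<delta> by (simp add: dist_real_def)
      ultimately show "\<bar>graph_density (V N) (\<mu> N) (\<gamma> N * s) x y - q t x' y'\<bar> \<le> \<eta>"
        by linarith
    qed
    ultimately show ?case by blast
  qed
  then show thesis using \<delta> assms by (intro that[of "min \<delta> (t / 2)"]) auto
qed

text \<open>
  Two consecutive times are treated with one correspondence, as their average is needed in the proof of
  the contraction. They have the same rescaled limit because \<open>\<gamma>\<close> diverges.
\<close>

lemma eventually_dens:
  assumes n: "(\<lambda>N. real (n N) / \<gamma> N) \<longlonglongrightarrow> t" and "0 < t" "0 < \<eta>"
  shows "\<forall>\<^sub>F N in sequentially. \<exists>C. close \<eta> N C \<and>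
    densities_within \<eta> C (smoothed_density (V N) (\<mu> N) (n N)) (q t) \<and>
    densities_within \<eta> C (smoothed_density (V N) (\<mu> N) (Suc (n N))) (q t)"
proof -
  obtain \<delta> where \<delta>: "0 < \<delta>" and close: "\<forall>\<^sub>F N in sequentially. \<exists>C. close \<eta> N C \<and>
    (\<forall>s. \<bar>s - t\<bar> < \<delta> \<longrightarrow> densities_within \<eta> C (graph_density (V N) (\<mu> N) (\<gamma> N * s)) (q t))"
    using eventually_densities_near[OF assms(2,3)] by blast
  have "((\<lambda>N. 1 / \<gamma> N) \<longlongrightarrow> 0) sequentially"
    using tendsto_inverse_0_at_top[OF gamma_at_top] by (simp add: inverse_eq_divide)
  from tendsto_add[OF n this] have n': "(\<lambda>N. real (Suc (n N)) / \<gamma> N) \<longlonglongrightarrow> t"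
    by (simp add: add_divide_distrib add.commute)
  from close eventually_ge_1 tendstoD[OF n \<delta>] tendstoD[OF n' \<delta>] show ?thesis
  proof eventually_elim
    case (elim N)
    interpret finite_walk "V N" "\<mu> N" using walk elim by simp
    from elim(1) obtain C where C: "close \<eta> N C" and within: "\<And>s. \<bar>s - t\<bar> < \<delta> \<Longrightarrow>
        densities_within \<eta> C (graph_density (V N) (\<mu> N) (\<gamma> N * s)) (q t)" by blast
    have "graph_density (V N) (\<mu> N) (\<gamma> N * (real k / \<gamma> N)) = dens k" for k
      using gamma_pos elim(2) graph_density_of_nat[of k] by (force simp: fun_eq_iff)
    with within[of "real (n N) / \<gamma> N"] within[of "real (Suc (n N)) / \<gamma> N"] elim(3,4) C
    show ?case unfolding dist_real_def by metis
  qed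
qed

lemma eventually_graph_distance_le:
  assumes p: "1 \<le> p" and n: "(\<lambda>N. real (n N) / \<gamma> N) \<longlonglongrightarrow> t" and t: "0 < t"
    and c: "distance p t < ennreal c"
  shows "\<forall>\<^sub>F N in sequentially. graph_distance p (V N) (\<mu> N) (n N) \<le> ennreal c"
proof -
  obtain D where D: "distance p t = ennreal D" "0 \<le> D"
    using c by (cases "distance p t") auto
  define \<kappa> where "\<kappa> = c - D"
  have \<kappa>: "0 < \<kappa>" using c D by (simp add: \<kappa>_def ennreal_less_iff)
  obtain \<eta> where \<eta>: "0 < \<eta>" and near: "\<And>(V :: 'v set) \<mu> C h x x'. finite_walk V \<mu> \<Longrightarrow>
      close_via \<eta> V (graph_measure V \<mu>) \<pi> C \<Longrightarrow> densities_within \<eta> C h (q t) \<Longrightarrow> (x, x') \<in> C \<Longrightarrow>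
      Lp_norm p (graph_measure V \<mu>) (\<lambda>y. h x y - 1) \<le> Lp_norm p \<pi> (\<lambda>y. q t x' y - 1) + ennreal \<kappa> \<and>
      Lp_norm p \<pi> (\<lambda>y. q t x' y - 1) \<le> Lp_norm p (graph_measure V \<mu>) (\<lambda>y. h x y - 1) + ennreal \<kappa>"
    using Lp_norms_close[OF p t \<kappa>] by blast
  from eventually_ge_1 eventually_dens[OF n t \<eta>] show ?thesis
  proof eventually_elim
    case (elim N)
    then obtain C where C: "close \<eta> N C" "densities_within \<eta> C (smoothed_density (V N) (\<mu> N) (n N)) (q t)"
      by blast
    show ?case unfolding graph_distance_def
    proof (rule SUP_least)
      fix x assume "x \<in> V N"
      then obtain x' where x': "(x, x') \<in> C"
        using close_viaD(1)[OF C(1)] by (force simp: correspondence_def)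
      have "Lp_norm p (graph_measure (V N) (\<mu> N)) (\<lambda>y. smoothed_density (V N) (\<mu> N) (n N) x y - 1)
          \<le> Lp_norm p \<pi> (\<lambda>y. q t x' y - 1) + ennreal \<kappa>"
        using near[OF walk C x'] elim by simp
      also have "\<dots> \<le> distance p t + ennreal \<kappa>"
        unfolding distance_def by (intro add_mono SUP_upper) auto
      also have "\<dots> = ennreal c" using D \<kappa> by (simp add: \<kappa>_def flip: ennreal_plus)
      finally show "Lp_norm p (graph_measure (V N) (\<mu> N)) (\<lambda>y. smoothed_density (V N) (\<mu> N) (n N) x y - 1)
          \<le> ennreal c" .
    qed
  qed
qed

lemma eventually_graph_distance_greater:
  assumes p: "1 \<le> p" and n: "(\<lambda>N. real (n N) / \<gamma> N) \<longlonglongrightarrow> t" and t: "0 < t"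
    and c: "ennreal c < distance p t" "0 \<le> c"
  shows "\<forall>\<^sub>F N in sequentially. ennreal c < graph_distance p (V N) (\<mu> N) (n N)"
proof -
  obtain x' where x': "ennreal c < Lp_norm p \<pi> (\<lambda>y. q t x' y - 1)"
    using c by (auto simp: distance_def less_SUP_iff)
  have "Lp_norm p \<pi> (\<lambda>y. q t x' y - 1) \<le> distance p t"
    unfolding distance_def by (rule SUP_upper) simp
  then have "Lp_norm p \<pi> (\<lambda>y. q t x' y - 1) < \<infinity>"
    using distance_finite[OF p t] by (rule le_less_trans)
  then obtain D where D: "Lp_norm p \<pi> (\<lambda>y. q t x' y - 1) = ennreal D" "0 \<le> D"
    by (cases "Lp_norm p \<pi> (\<lambda>y. q t x' y - 1)") auto
  define \<kappa> where "\<kappa> = (D - c) / 2"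
  have \<kappa>: "0 < \<kappa>" using x' c D by (simp add: \<kappa>_def ennreal_less_iff)
  obtain \<eta> where \<eta>: "0 < \<eta>" and near: "\<And>(V :: 'v set) \<mu> C h x x'. finite_walk V \<mu> \<Longrightarrow>
      close_via \<eta> V (graph_measure V \<mu>) \<pi> C \<Longrightarrow> densities_within \<eta> C h (q t) \<Longrightarrow> (x, x') \<in> C \<Longrightarrow>
      Lp_norm p (graph_measure V \<mu>) (\<lambda>y. h x y - 1) \<le> Lp_norm p \<pi> (\<lambda>y. q t x' y - 1) + ennreal \<kappa> \<and>
      Lp_norm p \<pi> (\<lambda>y. q t x' y - 1) \<le> Lp_norm p (graph_measure V \<mu>) (\<lambda>y. h x y - 1) + ennreal \<kappa>"
    using Lp_norms_close[OF p t \<kappa>] by blast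
  from eventually_ge_1 eventually_dens[OF n t \<eta>] show ?thesis
  proof eventually_elim
    case (elim N)
    then obtain C where C: "close \<eta> N C" "densities_within \<eta> C (smoothed_density (V N) (\<mu> N) (n N)) (q t)"
      by blast
    have proj: "fst ` C = V N" "snd ` C = UNIV"
      using close_viaD(1)[OF C(1)] by (simp_all add: correspondence_def)
    have "x' \<in> snd ` C" by (simp add: proj)
    then obtain x where x: "(x, x') \<in> C" by auto
    then have "x \<in> V N" using proj(1) by force
    have "ennreal D \<le> Lp_norm p (graph_measure (V N) (\<mu> N)) (\<lambda>y. smoothed_density (V N) (\<mu> N) (n N) x y - 1)
        + ennreal \<kappa>"
      using near[OF walk C x] elim D by simp
    also have "\<dots> \<le> graph_distance p (V N) (\<mu> N) (n N) + ennreal \<kappa>"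
      unfolding graph_distance_def using \<open>x \<in> V N\<close> by (intro add_mono SUP_upper) auto
    finally have le: "ennreal D \<le> graph_distance p (V N) (\<mu> N) (n N) + ennreal \<kappa>" .
    show ?case
    proof (rule ccontr)
      assume "\<not> ennreal c < graph_distance p (V N) (\<mu> N) (n N)"
      then have "graph_distance p (V N) (\<mu> N) (n N) + ennreal \<kappa> \<le> ennreal (c + \<kappa>)"
        using c \<kappa> by (simp add: not_less add_right_mono)
      with le have "ennreal D \<le> ennreal (c + \<kappa>)" by (rule order_trans)
      then show False using \<kappa> c by (simp add: \<kappa>_def field_simps del: ennreal_plus)
    qed
  qed
qed

text \<open>
  The contraction is exact on the graphs, for the average of two consecutive smoothed densities, and
  passes to the limit since that average converges to \<open>q (t + s)\<close>. The lower bound on the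
  graphs comes from that of \<open>q s\<close>, of which one half is spent on the approximation error. The constant
  depends on \<open>s\<close> alone, so the estimate can be iterated.
\<close>

lemma distance_contraction:
  assumes p: "1 \<le> p" and s: "0 < s"
  obtains c :: real where "0 < c" "c < 1"
    and "\<And>t. 0 < t \<Longrightarrow> distance p (t + s) \<le> ennreal (1 - c) * distance p t"
proof -
  obtain c0 K where c0: "0 < c0" "c0 < 1" "\<And>x y. c0 \<le> q s x y"
    using density_bounds[OF s] by metis
  define c where "c = c0 / 2"
  have c: "0 < c" "c < 1" using c0 by (auto simp: c_def)
  have "distance p (t + s) \<le> ennreal (1 - c) * distance p t" if t: "0 < t" for t
  proof -
    obtain D where D: "distance p t = ennreal D" "0 \<le> D"
      using distance_finite[OF p t] by (cases "distance p t") auto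
    have ts: "0 < t + s" using t s by simp
    define m where "m N = nat \<lfloor>\<gamma> N * t\<rfloor>" for N
    define k where "k N = nat \<lfloor>\<gamma> N * s\<rfloor>" for N
    have m: "(\<lambda>N. real (m N) / \<gamma> N) \<longlonglongrightarrow> t" and k: "(\<lambda>N. real (k N) / \<gamma> N) \<longlonglongrightarrow> s"
      unfolding m_def k_def using t s by (auto intro!: tendsto_floor_scaled gamma_at_top)
    from tendsto_add[OF m k] have mk: "(\<lambda>N. real (m N + k N) / \<gamma> N) \<longlonglongrightarrow> t + s"
      by (simp add: add_divide_distrib)
    have "Lp_norm p \<pi> (\<lambda>y. q (t + s) x' y - 1) \<le> ennreal ((1 - c) * D) + ennreal e" if e: "0 < e" for x' e
    proof -
      define \<kappa> where "\<kappa> = e / 2"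
      have \<kappa>: "0 < \<kappa>" using e by (simp add: \<kappa>_def)
      obtain \<eta> where \<eta>: "0 < \<eta>" and near: "\<And>(V :: 'v set) \<mu> C h x x'. finite_walk V \<mu> \<Longrightarrow>
        close_via \<eta> V (graph_measure V \<mu>) \<pi> C \<Longrightarrow> densities_within \<eta> C h (q (t + s)) \<Longrightarrow> (x, x') \<in> C \<Longrightarrow>
        Lp_norm p (graph_measure V \<mu>) (\<lambda>y. h x y - 1) \<le> Lp_norm p \<pi> (\<lambda>y. q (t + s) x' y - 1) + ennreal \<kappa> \<and>
        Lp_norm p \<pi> (\<lambda>y. q (t + s) x' y - 1) \<le> Lp_norm p (graph_measure V \<mu>) (\<lambda>y. h x y - 1) + ennreal \<kappa>"
        using Lp_norms_close[OF p ts \<kappa>] by blast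
      have "distance p t < ennreal (D + \<kappa>)" using D \<kappa> by (simp add: ennreal_less_iff del: ennreal_plus)
      then have "\<forall>\<^sub>F N in sequentially. graph_distance p (V N) (\<mu> N) (m N) \<le> ennreal (D + \<kappa>)"
        by (rule eventually_graph_distance_le[OF p m t])
      from eventually_happens'[OF trivial_limit_sequentially
          eventually_conj[OF eventually_conj[OF eventually_ge_1 this]
            eventually_conj[OF eventually_dens[OF k s c(1)] eventually_dens[OF mk ts \<eta>]]]]
      obtain N where N: "1 \<le> N" and gd: "graph_distance p (V N) (\<mu> N) (m N) \<le> ennreal (D + \<kappa>)"
        and Ck: "\<exists>C. close c N C \<and> densities_within c C (smoothed_density (V N) (\<mu> N) (k N)) (q s) \<and>
            densities_within c C (smoothed_density (V N) (\<mu> N) (Suc (k N))) (q s)"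
        and Cmk: "\<exists>C. close \<eta> N C \<and>
            densities_within \<eta> C (smoothed_density (V N) (\<mu> N) (m N + k N)) (q (t + s)) \<and>
            densities_within \<eta> C (smoothed_density (V N) (\<mu> N) (Suc (m N + k N))) (q (t + s))"
        by blast
      interpret finite_walk "V N" "\<mu> N" by (rule walk[OF N])
      have lower: "c \<le> dens (k N) x z" if xz: "x \<in> V N" "z \<in> V N" for x z
      proof -
        obtain C where C: "close c N C" "densities_within c C (dens (k N)) (q s)" using Ck by blast
        have "fst ` C = V N" using close_viaD(1)[OF C(1)] by (simp add: correspondence_def)
        then obtain x' z' where "(x, x') \<in> C" "(z, z') \<in> C" using xz by force
        then have "\<bar>dens (k N) x z - q s x' z'\<bar> \<le> c" using C(2) unfolding densities_within_def by blast
        then show ?thesis using c0(3)[of x' z'] unfolding c_def by linarith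
      qed
      from Cmk obtain C where C: "close \<eta> N C" and within: "densities_within \<eta> C (dens (m N + k N)) (q (t + s))"
        "densities_within \<eta> C (dens (Suc (m N + k N))) (q (t + s))" by blast
      let ?h = "\<lambda>x y. (dens (m N + k N) x y + dens (Suc (m N + k N)) x y) / 2"
      have h: "densities_within \<eta> C ?h (q (t + s))"
        unfolding densities_within_def
      proof (intro allI impI)
        fix x x' y y' assume "(x, x') \<in> C" "(y, y') \<in> C"
        then have "\<bar>dens (m N + k N) x y - q (t + s) x' y'\<bar> \<le> \<eta>"
          "\<bar>dens (Suc (m N + k N)) x y - q (t + s) x' y'\<bar> \<le> \<eta>"
          using within unfolding densities_within_def by blast+
        then show "\<bar>?h x y - q (t + s) x' y'\<bar> \<le> \<eta>" unfolding abs_le_iff by (simp add: field_simps)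
      qed
      have proj: "fst ` C = V N" "snd ` C = UNIV"
        using close_viaD(1)[OF C] by (simp_all add: correspondence_def)
      have "x' \<in> snd ` C" by (simp add: proj)
      then obtain x where x: "(x, x') \<in> C" by auto
      then have xV: "x \<in> V N" using proj(1) by force
      have "Lp_norm p \<pi> (\<lambda>y. q (t + s) x' y - 1) \<le> Lp_norm p \<nu> (\<lambda>y. ?h x y - 1) + ennreal \<kappa>"
        using near[OF walk[OF N] C h x] by blast
      also have "Lp_norm p \<nu> (\<lambda>y. ?h x y - 1) \<le> ennreal ((1 - c) * (D + \<kappa>))"
        using D \<kappa> c by (intro Lp_norm_dens_average_le[OF p _ gd _ lower xV]) auto
      also have "ennreal ((1 - c) * (D + \<kappa>)) + ennreal \<kappa> = ennreal ((1 - c) * (D + \<kappa>) + \<kappa>)"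
        using c D \<kappa> by (intro ennreal_plus[symmetric]) auto
      also have "\<dots> \<le> ennreal ((1 - c) * D + e)"
      proof (rule ennreal_leI)
        have "(1 - c) * \<kappa> \<le> \<kappa>" using c \<kappa> by simp
        then show "(1 - c) * (D + \<kappa>) + \<kappa> \<le> (1 - c) * D + e" by (simp add: distrib_left \<kappa>_def)
      qed
      also have "\<dots> = ennreal ((1 - c) * D) + ennreal e" using c D e by (intro ennreal_plus) auto
      finally show ?thesis by (simp add: add_right_mono)
    qed
    then have "Lp_norm p \<pi> (\<lambda>y. q (t + s) x' y - 1) \<le> ennreal ((1 - c) * D)" for x'
      by (rule ennreal_le_epsilon)
    then have "distance p (t + s) \<le> ennreal ((1 - c) * D)" unfolding distance_def by (rule SUP_least)
    then show ?thesis using c D by (simp add: ennreal_mult)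
  qed
  with c show thesis by (rule that)
qed

end

section \<open>Distance to stationarity at short times\<close>

lemma openin_borel_of_top: "openin T U \<Longrightarrow> U \<in> sets (borel_of_top T)"
  unfolding borel_of_top_def by (subst sets_measure_of) (auto dest: openin_subset)

lemma space_cemetery: "space (borel_of_top (cemetery_top :: 'f::metric_space option topology)) = UNIV"
proof -
  have "(insert None (range Some) :: 'f option set) = UNIV" by (metis UNIV_option_conv)
  then show ?thesis by (simp add: borel_of_top_def space_measure_of_conv)
qed

lemma borel_measurable_at_state:
  fixes f :: "'f::metric_space \<Rightarrow> real"
  assumes "continuous_on UNIV f"
  shows "at_state f \<in> borel_measurable (borel_of_top cemetery_top)"
proof (rule borel_measurableI)
  fix S :: "real set" assume "open S"
  have some: "Some ` U \<in> sets (borel_of_top cemetery_top)" if "open U" for U :: "'f set"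
    using that by (intro openin_borel_of_top) simp
  have "UNIV - range Some \<in> sets (borel_of_top (cemetery_top :: 'f option topology))"
    using sets.compl_sets[OF some[OF open_UNIV]] by (simp add: space_cemetery)
  moreover have "UNIV - range Some = {None :: 'f option}" by (auto simp: UNIV_option_conv)
  ultimately have none: "{None :: 'f option} \<in> sets (borel_of_top cemetery_top)" by simp
  have "at_state f -` S \<inter> space (borel_of_top cemetery_top)
      = Some ` (f -` S) \<union> (if 0 \<in> S then {None} else {})"
    unfolding space_cemetery by (auto simp: at_state_def split: option.splits)
  moreover have "open (f -` S)" using assms \<open>open S\<close> by (simp add: continuous_on_open_vimage)
  moreover have "(if 0 \<in> S then {None :: 'f option} else {}) \<in> sets (borel_of_top cemetery_top)"
    using none by simp
  ultimately show "at_state f -` S \<inter> space (borel_of_top cemetery_top) \<in> sets (borel_of_top cemetery_top)"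
    using some by (simp only: sets.Un)
qed

text \<open>
  The paths start at \<open>x\<close> and are right-continuous at time \<open>0\<close>, so \<open>f\<close> along the path converges almost
  surely, and boundedly.
\<close>

lemma hunt_process_tendsto_start:
  fixes f :: "'f::metric_space \<Rightarrow> real"
  assumes "hunt_process M Fil X \<theta> P" and f: "continuous_on UNIV f" and bound: "\<And>y. \<bar>f y\<bar> \<le> B"
  shows "((\<lambda>t. \<integral>\<omega>. at_state f (X (ennreal t) \<omega>) \<partial>P (Some x)) \<longlongrightarrow> f x) (at_right 0)"
proof (rule tendsto_at_right_sequentially[of _ 1])
  interpret hunt_process M Fil X \<theta> P by fact
  interpret P: prob_space "P (Some x)" by (rule prob_law)
  have space_P: "space (P (Some x)) = space M" by (rule sets_eq_imp_space_eq[OF sets_law])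
  have X_meas: "(\<lambda>\<omega>. at_state f (X t \<omega>)) \<in> borel_measurable (P (Some x))" for t
  proof -
    have "(\<lambda>\<omega>. at_state f (X t \<omega>)) \<in> borel_measurable (Fil t)"
      by (rule measurable_compose[OF adapted borel_measurable_at_state[OF f]])
    moreover have "sets (Fil t) \<subseteq> sets (P (Some x))" using sets_Fil sets_law by simp
    ultimately show ?thesis
      using space_F[of t] space_P unfolding measurable_def by auto
  qed
  have start: "AE \<omega> in P (Some x). X 0 \<omega> = Some x"
    using normal[of "Some x"] P.AE_iff_emeasure_eq_1[of "\<lambda>\<omega>. X 0 \<omega> = Some x"]
      emeasure_neq_0_sets[of "P (Some x)" "{\<omega> \<in> space M. X 0 \<omega> = Some x}"]
    by (simp add: space_P pred_def)
  fix S :: "nat \<Rightarrow> real" assume S: "\<And>n. 0 < S n" "S \<longlonglongrightarrow> 0"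
  have "filterlim (\<lambda>n. ennreal (S n)) (at_right 0) sequentially"
    using S tendsto_ennrealI[OF S(2)] by (simp add: filterlim_at ennreal_eq_0_iff not_le)
  then have conv: "(\<lambda>n. at_state f (X (ennreal (S n)) \<omega>)) \<longlonglongrightarrow> f x"
    if \<omega>: "\<omega> \<in> space M" "X 0 \<omega> = Some x" for \<omega>
  proof (rule filterlim_compose[rotated], intro tendstoI)
    fix e :: real assume "0 < e"
    let ?U = "{y. dist (f y) (f x) < e}"
    have "open ?U" using f by (intro open_Collect_less continuous_intros)
    moreover have "limitin cemetery_top (\<lambda>s. X s \<omega>) (Some x) (at_right 0)"
      using right_continuous[OF \<omega>(1), of 0] \<omega>(2) by simp
    ultimately have "\<forall>\<^sub>F s in at_right 0. X s \<omega> \<in> Some ` ?U"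
      using \<open>0 < e\<close> unfolding limitin_def by simp
    then show "\<forall>\<^sub>F s in at_right 0. dist (at_state f (X s \<omega>)) (f x) < e"
      by eventually_elim (auto simp: at_state_def)
  qed
  have B: "0 \<le> B" using bound[of x] by linarith
  have "(\<lambda>n. \<integral>\<omega>. at_state f (X (ennreal (S n)) \<omega>) \<partial>P (Some x)) \<longlonglongrightarrow> (\<integral>\<omega>. f x \<partial>P (Some x))"
  proof (rule integral_dominated_convergence[where w = "\<lambda>_. B"])
    show "AE \<omega> in P (Some x). (\<lambda>n. at_state f (X (ennreal (S n)) \<omega>)) \<longlonglongrightarrow> f x"
      using start AE_space by eventually_elim (simp add: conv space_P)
    show "AE \<omega> in P (Some x). norm (at_state f (X (ennreal (S n)) \<omega>)) \<le> B" for n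
      using bound B by (intro always_eventually) (auto simp: at_state_def split: option.splits)
  qed (use X_meas in auto)
  then show "(\<lambda>n. \<integral>\<omega>. at_state f (X (ennreal (S n)) \<omega>) \<partial>P (Some x)) \<longlonglongrightarrow> f x"
    by (simp add: P.prob_space)
qed simp

text \<open>
  A bump function at \<open>x0\<close> supported in a ball of \<open>\<pi>\<close>-measure below \<open>1/4\<close> has mean close to \<open>1\<close> under
  \<open>q t x0\<close> for small \<open>t\<close>, but mean below \<open>1/4\<close> under \<open>\<pi>\<close>. The gap is a lower bound for the \<open>L\<^sup>1\<close> norm,
  hence for the \<open>L\<^sup>p\<close> norm, of \<open>q t x0 \<cdot> - 1\<close>.
\<close>

lemma (in limit_space) distance_greater_short_time:
  assumes hunt: "hunt_process M Fil X \<theta> P" and q_density: "transition_density \<pi> X P q" and p: "1 \<le> p"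
  shows "\<forall>\<^sub>F t in at_right 0. ennreal (1/4) < distance p t"
proof -
  fix x0 :: 'f
  obtain r where r: "0 < r" "emeasure \<pi> (ball x0 r) < ennreal (1/4)" using small_ball[of "1/4"] by auto
  define f where "f y = max 0 (1 - dist x0 y / r)" for y
  have cont: "continuous_on UNIV f" unfolding f_def using r by (intro continuous_intros) auto
  have f01: "0 \<le> f y" "f y \<le> 1" for y using r by (auto simp: f_def)
  have "continuous_on UNIV f \<Longrightarrow> f \<in> borel_measurable borel" by (rule borel_measurable_continuous_onI)
  with cont have meas[measurable]: "f \<in> borel_measurable \<pi>" by (simp add: measurable_cong_sets[OF borel_pi refl])
  have int_f: "integrable \<pi> f" using f01 by (intro integrable_const_bound[where B=1]) auto
  have "integrable \<pi> (indicator (ball x0 r) :: 'f \<Rightarrow> real)"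
    by (intro integrable_real_indicator) (auto simp: borel_pi less_top[symmetric])
  moreover have "f y \<le> indicator (ball x0 r) y" for y
    using r f01[of y] by (auto simp: f_def field_simps split: split_indicator)
  ultimately have "integral\<^sup>L \<pi> f \<le> integral\<^sup>L \<pi> (indicator (ball x0 r))"
    using int_f by (intro integral_mono)
  also have "\<dots> < 1/4"
    using r by (simp add: borel_pi space_pi emeasure_eq_measure ennreal_less_iff)
  finally have small: "integral\<^sup>L \<pi> f < 1/4" .
  have "((\<lambda>t. \<integral>\<omega>. at_state f (X (ennreal t) \<omega>) \<partial>P (Some x0)) \<longlongrightarrow> f x0) (at_right 0)"
    using f01 by (intro hunt_process_tendsto_start[OF hunt cont, of 1]) (simp add: abs_le_iff)
  then have "\<forall>\<^sub>F t in at_right 0. 3/4 < (\<integral>\<omega>. at_state f (X (ennreal t) \<omega>) \<partial>P (Some x0))"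
    by (rule order_tendstoD(1)) (simp add: f_def)
  moreover have "\<forall>\<^sub>F t in at_right (0::real). 0 < t" by (rule eventually_at_right_less)
  ultimately show ?thesis
  proof eventually_elim
    case (elim t)
    have "bounded (range f)" unfolding bounded_iff using f01 by (auto intro!: exI[of _ 1])
    then have mean: "3/4 < (\<integral>y. q t x0 y * f y \<partial>\<pi>)"
      using elim q_density cont unfolding transition_density_def by metis
    obtain K where K: "\<And>x y. \<bar>q t x y - 1\<bar> \<le> K" using density_bounds[OF elim(2)] by metis
    note q_meas[measurable] = borel_measurable_density[OF elim(2), of x0]
    have int: "integrable \<pi> (\<lambda>y. (q t x0 y - 1) * f y)"
    proof (rule integrable_const_bound[where B=K])
      show "AE y in \<pi>. norm ((q t x0 y - 1) * f y) \<le> K"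
      proof (rule AE_I2)
        fix y
        have "\<bar>q t x0 y - 1\<bar> * \<bar>f y\<bar> \<le> K * 1"
          using K[of x0 y] f01[of y] by (intro mult_mono) auto
        then show "norm ((q t x0 y - 1) * f y) \<le> K" by (simp add: abs_mult)
      qed
    qed measurable
    have "(\<integral>y. q t x0 y * f y \<partial>\<pi>) = (\<integral>y. (q t x0 y - 1) * f y + f y \<partial>\<pi>)" by (simp add: algebra_simps)
    also have "\<dots> = (\<integral>y. (q t x0 y - 1) * f y \<partial>\<pi>) + integral\<^sup>L \<pi> f"
      using int int_f by simp
    finally have lower: "1/4 < (\<integral>y. (q t x0 y - 1) * f y \<partial>\<pi>)" using mean small by simp
    show ?case
    proof (rule ccontr)
      assume "\<not> ennreal (1/4) < distance p t"
      then have "Lp_norm p \<pi> (\<lambda>y. q t x0 y - 1) \<le> ennreal (1/4)"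
        unfolding distance_def not_less by (simp add: SUP_le_iff)
      then have "(\<integral>y. (q t x0 y - 1) * f y \<partial>\<pi>) \<le> 1/4"
        using K f01 by (intro integral_mult_le_Lp_norm[OF prob_space_axioms p q_meas meas]) auto
      with lower show False by simp
    qed
  qed
qed

section \<open>Convergence of the mixing times\<close>

lemma ennreal_quarter: "ennreal (1/4) = 1/4"
  by (metis divide_ennreal ennreal_1 ennreal_numeral zero_le_one zero_less_numeral zero_le_numeral)

context limit_space
begin

lemma mixing_time_space_eq:
  "mixing_time_space p \<pi> q = Inf {ennreal t | t. 0 < t \<and> distance p t \<le> ennreal (1/4)}"
  by (simp add: mixing_time_space_def distance_def ennreal_quarter)

lemma mixing_time_space_pos:
  assumes "hunt_process M Fil X \<theta> P" "transition_density \<pi> X P q" "1 \<le> p"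
  shows "0 < mixing_time_space p \<pi> q"
proof -
  obtain \<tau> where \<tau>: "0 < \<tau>" "\<And>t. 0 < t \<Longrightarrow> t < \<tau> \<Longrightarrow> ennreal (1/4) < distance p t"
    using distance_greater_short_time[OF assms] by (auto simp: eventually_at_right_field)
  have "ennreal \<tau> \<le> mixing_time_space p \<pi> q"
    unfolding mixing_time_space_eq using \<tau>(2)
    by (intro Inf_greatest) (auto intro!: ennreal_leI simp: not_le[symmetric])
  moreover have "0 < ennreal \<tau>" using \<tau>(1) by simp
  ultimately show ?thesis by (rule less_le_trans[rotated])
qed

end

context converging_graphs
begin

text \<open>
  The level \<open>1/4\<close> is crossed strictly. Without this the graphs might linger just above the level long
  after the limit has reached it.
\<close>

lemma distance_less_after:
  assumes p: "1 \<le> p" and t: "0 < t" "distance p t \<le> ennreal (1/4)" and "t < t'"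
  shows "distance p t' < ennreal (1/4)"
proof -
  have "0 < t' - t" using \<open>t < t'\<close> by simp
  then obtain c where c: "0 < c" "c < 1"
    "\<And>u. 0 < u \<Longrightarrow> distance p (u + (t' - t)) \<le> ennreal (1 - c) * distance p u"
    using distance_contraction[OF p] by blast
  have "distance p t' \<le> ennreal (1 - c) * distance p t" using c(3)[OF t(1)] by simp
  also have "\<dots> \<le> ennreal (1 - c) * ennreal (1/4)" by (rule mult_left_mono[OF t(2)]) simp
  also have "\<dots> = ennreal ((1 - c) * (1/4))" using c by (intro ennreal_mult[symmetric]) auto
  also have "\<dots> < ennreal (1/4)" using c by (intro ennreal_lessI) auto
  finally show ?thesis .
qed

lemma mixing_time_space_finite:
  assumes p: "1 \<le> p"
  shows "mixing_time_space p \<pi> q < \<infinity>"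
proof -
  obtain c where c: "0 < c" "c < 1" "\<And>t. 0 < t \<Longrightarrow> distance p (t + 1) \<le> ennreal (1 - c) * distance p t"
    using distance_contraction[OF p, of 1] by auto
  obtain D where D: "distance p 1 = ennreal D" "0 \<le> D"
    using distance_finite[OF p, of 1] by (cases "distance p 1") auto
  have le: "distance p (1 + real n) \<le> ennreal ((1 - c) ^ n * D)" for n
  proof (induction n)
    case (Suc n)
    have "distance p (1 + real (Suc n)) \<le> ennreal (1 - c) * distance p (1 + real n)"
      using c(3)[of "1 + real n"] by (simp add: add_ac)
    also have "\<dots> \<le> ennreal (1 - c) * ennreal ((1 - c) ^ n * D)" by (rule mult_left_mono[OF Suc]) simp
    also have "\<dots> = ennreal ((1 - c) ^ Suc n * D)" using c D by (subst ennreal_mult[symmetric]) (auto simp: mult.assoc)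
    finally show ?case .
  qed (simp add: D)
  have "(\<lambda>n. (1 - c) ^ n * D) \<longlonglongrightarrow> 0 * D"
    using c by (intro tendsto_mult LIMSEQ_power_zero tendsto_const) auto
  then have "\<forall>\<^sub>F n in sequentially. (1 - c) ^ n * D < 1/4"
    by (intro order_tendstoD(2)) auto
  then obtain n where "(1 - c) ^ n * D < 1/4" by (auto simp: eventually_sequentially)
  then have "distance p (1 + real n) \<le> ennreal (1/4)"
    using le[of n] by (meson ennreal_leI less_imp_le order_trans)
  then have "mixing_time_space p \<pi> q \<le> ennreal (1 + real n)"
    unfolding mixing_time_space_eq by (intro Inf_lower) (auto intro!: exI[of _ "1 + real n"])
  then show ?thesis by (rule le_less_trans) simp
qed

lemma mixing_time_graph_eq:
  "mixing_time_graph p (V N) (\<mu> N)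
     = Inf {of_nat m | m. 0 < m \<and> graph_distance p (V N) (\<mu> N) m \<le> ennreal (1/4)}"
  by (simp add: mixing_time_graph_def graph_distance_def ennreal_quarter)

lemma rescaled_time: "1 \<le> N \<Longrightarrow> 0 \<le> t \<Longrightarrow> inverse (ennreal (\<gamma> N)) * ennreal (\<gamma> N * t) = ennreal t"
proof -
  assume N: "1 \<le> N" and t: "0 \<le> t"
  have "inverse (ennreal (\<gamma> N)) * ennreal (\<gamma> N * t) = ennreal (inverse (\<gamma> N) * (\<gamma> N * t))"
    using gamma_pos[OF N] t by (simp add: inverse_ennreal ennreal_mult[symmetric])
  moreover have "inverse (\<gamma> N) * (\<gamma> N * t) = t" using gamma_pos[OF N] by simp
  ultimately show ?thesis by (simp only:)
qed

text \<open>
  Before the mixing time of the limit the distance exceeds \<open>1/4\<close>, hence eventually so does that of the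
  graphs at the corresponding step, and by monotonicity at all earlier steps. After it the distance is
  strictly below \<open>1/4\<close>, hence eventually the graphs have mixed by the corresponding step.
\<close>

lemma mixing_time_graph_tendsto:
  assumes p: "1 \<le> p"
  shows "(\<lambda>N. inverse (ennreal (\<gamma> N)) * mixing_time_graph p (V N) (\<mu> N)) \<longlonglongrightarrow> mixing_time_space p \<pi> q"
proof (rule order_tendstoI)
  fix a assume "a < mixing_time_space p \<pi> q"
  then obtain u where u: "a < u" "u < mixing_time_space p \<pi> q" by (metis dense)
  then obtain t where ut: "u = ennreal t" "0 \<le> t" by (cases u) auto
  have t: "0 < t" using u(1) ut by (cases "t = 0") auto
  have "ennreal (1/4) < distance p t"
  proof (rule ccontr)
    assume "\<not> ennreal (1/4) < distance p t"
    then have "mixing_time_space p \<pi> q \<le> ennreal t"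
      unfolding mixing_time_space_eq using t by (intro Inf_lower) (auto simp: not_less)
    with u ut show False by simp
  qed
  then have "\<forall>\<^sub>F N in sequentially.
      ennreal (1/4) < graph_distance p (V N) (\<mu> N) (nat \<lfloor>\<gamma> N * t\<rfloor>)"
    using t by (intro eventually_graph_distance_greater[OF p tendsto_floor_scaled[OF gamma_at_top]]) auto
  with eventually_ge_1
  show "\<forall>\<^sub>F N in sequentially. a < inverse (ennreal (\<gamma> N)) * mixing_time_graph p (V N) (\<mu> N)"
  proof eventually_elim
    case (elim N)
    interpret finite_walk "V N" "\<mu> N" using walk elim by simp
    have "ennreal (\<gamma> N * t) \<le> mixing_time_graph p (V N) (\<mu> N)"
      unfolding mixing_time_graph_eq
    proof (rule Inf_greatest, safe)
      fix n assume n: "0 < n" "graph_distance p (V N) (\<mu> N) n \<le> ennreal (1/4)"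
      have "nat \<lfloor>\<gamma> N * t\<rfloor> < n"
      proof (rule ccontr)
        assume "\<not> nat \<lfloor>\<gamma> N * t\<rfloor> < n"
        then have "graph_distance p (V N) (\<mu> N) (nat \<lfloor>\<gamma> N * t\<rfloor>) \<le> ennreal (1/4)"
          by (intro graph_distance_le_mono[OF p _ n(2)]) auto
        with elim(2) show False by simp
      qed
      then have "\<gamma> N * t \<le> real n" by linarith
      then have "ennreal (\<gamma> N * t) \<le> ennreal (real n)" by (rule ennreal_leI)
      then show "ennreal (\<gamma> N * t) \<le> of_nat n" by (simp add: ennreal_of_nat_eq_real_of_nat)
    qed
    then have "ennreal t \<le> inverse (ennreal (\<gamma> N)) * mixing_time_graph p (V N) (\<mu> N)"
      using rescaled_time[OF elim(1), of t] t by (metis less_imp_le mult_left_mono zero_le)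
    with u ut show ?case by (auto intro: less_le_trans)
  qed
next
  fix b assume "mixing_time_space p \<pi> q < b"
  then obtain s where s: "0 < s" "distance p s \<le> ennreal (1/4)" "ennreal s < b"
    unfolding mixing_time_space_eq Inf_less_iff by auto
  then obtain u where u: "ennreal s < u" "u < b" by (metis dense)
  then obtain t where ut: "u = ennreal t" "0 \<le> t" by (cases u) auto
  have t: "s < t" using u s ut by (simp add: ennreal_less_iff)
  then have t0: "0 < t" using s by simp
  have "distance p t < ennreal (1/4)" by (rule distance_less_after[OF p s(1,2) t])
  then have "\<forall>\<^sub>F N in sequentially.
      graph_distance p (V N) (\<mu> N) (nat \<lfloor>\<gamma> N * t\<rfloor>) \<le> ennreal (1/4)"
    using t0 by (intro eventually_graph_distance_le[OF p tendsto_floor_scaled[OF gamma_at_top]]) auto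
  moreover have "\<forall>\<^sub>F N in sequentially. 1 / t \<le> \<gamma> N"
    using gamma_at_top by (simp add: filterlim_at_top)
  ultimately
  show "\<forall>\<^sub>F N in sequentially. inverse (ennreal (\<gamma> N)) * mixing_time_graph p (V N) (\<mu> N) < b"
    using eventually_ge_1
  proof eventually_elim
    case (elim N)
    let ?m = "nat \<lfloor>\<gamma> N * t\<rfloor>"
    have "1 \<le> \<gamma> N * t" using elim(2) t0 by (simp add: field_simps)
    then have "0 < ?m" and m: "real ?m \<le> \<gamma> N * t" by linarith+
    then have "mixing_time_graph p (V N) (\<mu> N) \<le> of_nat ?m"
      unfolding mixing_time_graph_eq using elim(1) by (intro Inf_lower) auto
    also have "\<dots> \<le> ennreal (\<gamma> N * t)" using m by (simp add: ennreal_of_nat_eq_real_of_nat ennreal_leI)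
    finally have "inverse (ennreal (\<gamma> N)) * mixing_time_graph p (V N) (\<mu> N) \<le> ennreal t"
      using rescaled_time[OF elim(3), of t] t0 by (metis less_imp_le mult_left_mono zero_le)
    with u ut show ?case by (auto intro: le_less_trans)
  qed
qed

end

theorem theorem1p4:
  fixes \<pi> :: "'f::metric_space measure"
    and q :: "real \<Rightarrow> 'f \<Rightarrow> 'f \<Rightarrow> real"
    and M :: "'w measure"
    and Fil :: "ennreal \<Rightarrow> 'w measure"
    and X :: "ennreal \<Rightarrow> 'w \<Rightarrow> 'f option"
    and \<theta> :: "ennreal \<Rightarrow> 'w \<Rightarrow> 'w"
    and P :: "'f option \<Rightarrow> 'w measure"
    and V :: "nat \<Rightarrow> 'v set"
    and E :: "nat \<Rightarrow> 'v set set"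
    and \<mu> :: "nat \<Rightarrow> 'v \<Rightarrow> 'v \<Rightarrow> real"
    and d :: "nat \<Rightarrow> 'v \<Rightarrow> 'v \<Rightarrow> real"
    and \<gamma> :: "nat \<Rightarrow> real"
    and p :: ennreal
  assumes compact_F: "compact (UNIV :: 'f set)"
    and prob_pi: "prob_space \<pi>"
    and borel_pi: "sets \<pi> = sets borel"
    and non_atomic_pi: "non_atomic \<pi>"
    and full_support: "\<And>U. open U \<Longrightarrow> U \<noteq> {} \<Longrightarrow> 0 < emeasure \<pi> U"
    and null_spheres: "\<And>x r. 0 < r \<Longrightarrow> emeasure \<pi> (frontier (ball x r)) = 0"
    and hunt: "hunt_process M Fil X \<theta> P"
    and symmetric: "symmetric_process \<pi> X P"
    and conservative: "conservative_process \<pi> X P"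
    and q_continuous: "jointly_continuous q"
    and q_density: "transition_density \<pi> X P q"
    and q_pos: "\<And>t x y. 0 < t \<Longrightarrow> 0 < q t x y"
    and q_not_one: "\<And>t x. 0 < t \<Longrightarrow> \<exists>y. q t x y \<noteq> 1"
    and graph: "\<And>N. 1 \<le> N \<Longrightarrow> weighted_graph (V N) (E N) (\<mu> N)"
    and connected: "\<And>N. 1 \<le> N \<Longrightarrow> connected_graph (V N) (E N)"
    and two_vertices: "\<And>N. 1 \<le> N \<Longrightarrow> 2 \<le> card (V N)"
    and metric: "\<And>N. 1 \<le> N \<Longrightarrow> Metric_space (V N) (d N)"
    and gamma_pos: "\<And>N. 1 \<le> N \<Longrightarrow> 0 < \<gamma> N"
    and spectral_GH_convergence: "\<And>a b. 0 < a \<Longrightarrow> a \<le> b \<Longrightarrow>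
          (\<lambda>N. spectral_GH_dist {a..b}
             (V N) (d N) (graph_measure (V N) (\<mu> N)) (\<lambda>t. graph_density (V N) (\<mu> N) (\<gamma> N * t))
             UNIV dist \<pi> q) \<longlonglongrightarrow> 0"
    and p_ge_1: "1 \<le> p"
    and Lp_convergence: "\<And>x. ((\<lambda>t. Lp_norm p \<pi> (\<lambda>y. q t x y - 1)) \<longlongrightarrow> 0) at_top"
  shows "0 < mixing_time_space p \<pi> q \<and> mixing_time_space p \<pi> q < \<infinity> \<and>
         (\<lambda>N. inverse (ennreal (\<gamma> N)) * mixing_time_graph p (V N) (\<mu> N))
           \<longlonglongrightarrow> mixing_time_space p \<pi> q"
proof -
  interpret limit_space \<pi> q
    using compact_F prob_pi borel_pi full_support non_atomic_pi q_continuous q_pos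
    by (simp add: limit_space_def limit_space_axioms_def)
  interpret converging_graphs \<pi> q V \<mu> d \<gamma>
  proof (intro converging_graphs.intro converging_graphs_axioms.intro limit_space_axioms)
    show "finite_walk (V N) (\<mu> N)" if "1 \<le> N" for N
      using that by (intro finite_walk_of_connected_graph[OF graph connected two_vertices])
  qed (fact metric gamma_pos spectral_GH_convergence)+
  show ?thesis
    using mixing_time_space_pos[OF hunt q_density p_ge_1] mixing_time_space_finite[OF p_ge_1]
      mixing_time_graph_tendsto[OF p_ge_1] by blast
qed

end
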